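(* Let $k$ be an algebraically closed field of characteristic zero, $n\ge3$, $R=k[x_1,\ldots,x_n]$, and let $\mathbf d=(d_1,d,d)$ with $1\le d_1\le d$. Then $I_{d_1+d,\mathbf d}=[0,d_1d]\cap\mathbb Z$. Moreover: (i) An ideal $J$ with degree vector $\mathbf d$ realizes the admissible pair $(d_1+d,0)$ if and only if $J$ is a complete intersection. (ii) If $d_1<d$, then the admissible pair $(d_1+d,1)$ is realizable.
   Context: For $\mathbf d=(d_1,d_2,d_3)$ with $1\le d_1\le d_2\le d_3$, an ideal with degree vector $\mathbf d$ is an ideal $J=(f_1,f_2,f_3)\subseteq R$ minimally generated by homogeneous forms with $\deg f_i=d_i$ and $\gcd(f_1,f_2,f_3)=1$. $\mathrm{Syz}(J)$ is the kernel of $\bigoplus_{i=1}^3R(-d_i)\xrightarrow{[f_1\ f_2\ f_3]}J$, graded as a submodule of $\bigoplus_iR(-d_i)$ ("shifted" grading): a syzygy $(a_1,a_2,a_3)$ has shifted degree $q$ if $\deg a_i=q-d_i$ whenever $a_i\neq0$. $\mathrm{indeg}(\mathrm{Syz}(J))$ is the least $q$ with $\mathrm{Syz}(J)_q\ne0$. $\deg(R/J)$ is the codimension-two degree $\sum_{\mathfrak p\in\mathrm{Ass}(R/J),\,\mathrm{ht}\,\mathfrak p=2}\mathrm{length}((R/J)_{\mathfrak p})\deg(R/\mathfrak p)$: the usual multiplicity if $\mathrm{ht}(J)=2$, and $0$ if $\mathrm{ht}(J)\ge3$. With $D=d_1+d_2+d_3$, $\sigma=d_1d_2+d_1d_3+d_2d_3$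 and $F_{\mathbf d}(e)=e^2-eD+\sigma$, put $I_{e,\mathbf d}=[\max\{\sigma-eD,0\},F_{\mathbf d}(e)]\cap\mathbb Z$. A pair $(e,j)\in\mathbb Z^2$ is admissible for $\mathbf d$ if $d_2<e\le d_1+d_2$ and $j\in I_{e,\mathbf d}$. An ideal $J\subseteq R$ with degree vector $\mathbf d$ realizes $(e,j)$ if $\mathrm{indeg}(\mathrm{Syz}(J))=e$ and $\deg(R/J)=j$; the pair is realizable over $R$ if some such $J$ exists. "$J$ is a complete intersection" means $\mathrm{ht}(J)=3$. *)

theory Defs
  imports
    "HOL-Library.Poly_Mapping"
    "HOL-Library.Cardinality"
    "HOL-Library.Extended_Real"
    "HOL-Computational_Algebra.Polynomial"
    "HOL-Algebra.Algebraic_Closure_Type"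
begin

section \<open>Commutative algebra\<close>

definition prime_height :: "('a, 'b) ring_scheme \<Rightarrow> 'a set \<Rightarrow> enat" where
  "prime_height A P = Sup {enat m | m C. (\<forall>i\<le>m. primeideal (C i) A)
     \<and> (\<forall>i<m. C i \<subset> C (Suc i)) \<and> C m = P}"

definition ideal_height :: "('a, 'b) ring_scheme \<Rightarrow> 'a set \<Rightarrow> enat" where
  "ideal_height A J = (INF P \<in> {P. primeideal P A \<and> J \<subseteq> P}. prime_height A P)"

text \<open>The associated primes of the \<open>A\<close>-module \<open>A/J\<close>: the primes that are annihilators of elements.\<close>

definition assoc_primes :: "('a, 'b) ring_scheme \<Rightarrow> 'a set \<Rightarrow> 'a set set" where
  "assoc_primes A J = {P. primeideal P A \<and> (\<exists>x \<in> carrier (A Quot J).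
     P = {r \<in> carrier A. (J +>\<^bsub>A\<^esub> r) \<otimes>\<^bsub>A Quot J\<^esub> x = \<zero>\<^bsub>A Quot J\<^esub>})}"

text \<open>The localization \<open>S\<^sup>-\<^sup>1 A\<close> of a commutative ring at a multiplicative set; the fraction \<open>a/s\<close>
  is the equivalence class of the pair \<open>(a, s)\<close>.\<close>

definition frac_rel :: "('a, 'b) ring_scheme \<Rightarrow> 'a set \<Rightarrow> (('a \<times> 'a) \<times> ('a \<times> 'a)) set" where
  "frac_rel A S = {((a, s), (b, t)). a \<in> carrier A \<and> b \<in> carrier A \<and> s \<in> S \<and> t \<in> S
     \<and> (\<exists>u\<in>S. u \<otimes>\<^bsub>A\<^esub> (t \<otimes>\<^bsub>A\<^esub> a) = u \<otimes>\<^bsub>A\<^esub> (s \<otimes>\<^bsub>A\<^esub> b))}"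

definition localization :: "('a, 'b) ring_scheme \<Rightarrow> 'a set \<Rightarrow> ('a \<times> 'a) set ring" where
  "localization A S =
    \<lparr>carrier = (carrier A \<times> S) // frac_rel A S,
     monoid.mult = (\<lambda>U V. frac_rel A S `` {(a \<otimes>\<^bsub>A\<^esub> b, s \<otimes>\<^bsub>A\<^esub> t) | a s b t. (a, s) \<in> U \<and> (b, t) \<in> V}),
     one = frac_rel A S `` {(\<one>\<^bsub>A\<^esub>, \<one>\<^bsub>A\<^esub>)},
     zero = frac_rel A S `` {(\<zero>\<^bsub>A\<^esub>, \<one>\<^bsub>A\<^esub>)},
     add = (\<lambda>U V. frac_rel A S `` {((t \<otimes>\<^bsub>A\<^esub> a) \<oplus>\<^bsub>A\<^esub> (s \<otimes>\<^bsub>A\<^esub> b), s \<otimes>\<^bsub>A\<^esub> t)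
              | a s b t. (a, s) \<in> U \<and> (b, t) \<in> V})\<rparr>"

text \<open>The length of a commutative ring as a module over itself; its submodules are its ideals.\<close>

definition ring_length :: "('a, 'b) ring_scheme \<Rightarrow> enat" where
  "ring_length A = Sup {enat m | m C. (\<forall>i\<le>m. ideal (C i) A) \<and> (\<forall>i<m. C i \<subset> C (Suc i))}"

text \<open>\<open>(A/J)\<^sub>P\<close> for a prime \<open>P \<supseteq> J\<close>, as the localization of the ring \<open>A/J\<close> at the prime \<open>P/J\<close>.
  Since \<open>A\<^sub>P \<rightarrow> (A/J)\<^sub>P\<close> is surjective, the length of \<open>(A/J)\<^sub>P\<close> over \<open>A\<^sub>P\<close> is its length over itself.\<close>

definition quot_local :: "('a, 'b) ring_scheme \<Rightarrow> 'a set \<Rightarrow> 'a set \<Rightarrow> ('a set \<times> 'a set) set ring" where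
  "quot_local A J P =
     localization (A Quot J) (carrier (A Quot J) - (\<lambda>r. J +>\<^bsub>A\<^esub> r) ` P)"

section \<open>The standard graded polynomial ring\<close>

text \<open>A finite linearly ordered type \<open>'n\<close> indexes the variables \<open>x\<^sub>1, \<dots>, x\<^sub>n\<close>, so \<open>n = CARD('n)\<close>.
  The order plays no role in the mathematics; with it, the type is an instance of \<^class>\<open>idom\<close>.\<close>

type_synonym ('n, 'k) mpoly = "('n \<Rightarrow>\<^sub>0 nat) \<Rightarrow>\<^sub>0 'k"

abbreviation polyring :: "('n::{finite,linorder}, 'k::field) mpoly ring" where
  "polyring \<equiv> ring_of_type_algebra"

definition mdeg :: "('n::finite \<Rightarrow>\<^sub>0 nat) \<Rightarrow> nat" where
  "mdeg m = (\<Sum>i\<in>UNIV. Poly_Mapping.lookup m i)"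

text \<open>The graded piece \<open>R\<^sub>q\<close>; it contains \<open>0\<close>.\<close>

definition forms :: "nat \<Rightarrow> ('n::{finite,linorder}, 'k::field) mpoly set" where
  "forms q = {f. \<forall>m \<in> Poly_Mapping.keys f. mdeg m = q}"

definition kdim :: "('n::{finite,linorder}, 'k::field) mpoly set \<Rightarrow> nat" where
  "kdim V = vector_space.dim (\<lambda>c f. Poly_Mapping.single 0 c * f) V"

text \<open>The Hilbert function of \<open>R/P\<close> for a homogeneous ideal \<open>P\<close>, where \<open>(R/P)\<^sub>t = R\<^sub>t / (P \<inter> R\<^sub>t)\<close>.\<close>

definition hilbert_fun :: "('n::{finite,linorder}, 'k::field) mpoly set \<Rightarrow> nat \<Rightarrow> real" where
  "hilbert_fun P t = real (kdim (forms t :: ('n, 'k) mpoly set)) - real (kdim (P \<inter> forms t))"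

definition hilbert_poly :: "('n::{finite,linorder}, 'k::field) mpoly set \<Rightarrow> real poly" where
  "hilbert_poly P = (THE H. \<forall>\<^sub>F t in sequentially. poly H (real t) = hilbert_fun P t)"

text \<open>The degree \<open>deg(R/P)\<close> when \<open>dim(R/P) \<ge> 1\<close>. The Hilbert polynomial then has degree
  \<open>dim(R/P) - 1\<close>. This covers all primes of height two in \<open>n \<ge> 3\<close> variables.\<close>

definition quot_degree :: "('n::{finite,linorder}, 'k::field) mpoly set \<Rightarrow> real" where
  "quot_degree P = fact (Polynomial.degree (hilbert_poly P)) * lead_coeff (hilbert_poly P)"

text \<open>The codimension-two degree \<open>deg(R/J)\<close>. It is an extended real because lengths may be infinite
  when \<open>J\<close> has height less than two.\<close>

definition codim2_degree :: "('n::{finite,linorder}, 'k::field) mpoly set \<Rightarrow> ereal" where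
  "codim2_degree J =
     (\<Sum>P \<in> {P \<in> assoc_primes polyring J. prime_height polyring P = 2}.
        ereal_of_enat (ring_length (quot_local polyring J P)) * ereal (quot_degree P))"

section \<open>Ideals with a degree vector\<close>

text \<open>An ideal with degree vector \<open>d\<close> is given by its three generators, because \<open>Syz(J)\<close> refers to them.\<close>

fun gen_ideal :: "('n::{finite,linorder}, 'k::field) mpoly \<times> ('n, 'k) mpoly \<times> ('n, 'k) mpoly
    \<Rightarrow> ('n, 'k) mpoly set" where
  "gen_ideal (f1, f2, f3) = Idl\<^bsub>polyring\<^esub> {f1, f2, f3}"

fun has_degree_vector :: "nat \<times> nat \<times> nat
    \<Rightarrow> ('n::{finite,linorder}, 'k::field) mpoly \<times> ('n, 'k) mpoly \<times> ('n, 'k) mpoly \<Rightarrow> bool" where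
  "has_degree_vector (d1, d2, d3) (f1, f2, f3) \<longleftrightarrow>
     1 \<le> d1 \<and> d1 \<le> d2 \<and> d2 \<le> d3
     \<and> f1 \<noteq> 0 \<and> f2 \<noteq> 0 \<and> f3 \<noteq> 0
     \<and> f1 \<in> forms d1 \<and> f2 \<in> forms d2 \<and> f3 \<in> forms d3
     \<and> Idl\<^bsub>polyring\<^esub> {f2, f3} \<noteq> gen_ideal (f1, f2, f3)
     \<and> Idl\<^bsub>polyring\<^esub> {f1, f3} \<noteq> gen_ideal (f1, f2, f3)
     \<and> Idl\<^bsub>polyring\<^esub> {f1, f2} \<noteq> gen_ideal (f1, f2, f3)
     \<and> (\<forall>g. g dvd f1 \<and> g dvd f2 \<and> g dvd f3 \<longrightarrow> g dvd 1)"

fun syz :: "('n::{finite,linorder}, 'k::field) mpoly \<times> ('n, 'k) mpoly \<times> ('n, 'k) mpoly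
    \<Rightarrow> (('n, 'k) mpoly \<times> ('n, 'k) mpoly \<times> ('n, 'k) mpoly) set" where
  "syz (f1, f2, f3) = {(a1, a2, a3). a1 * f1 + a2 * f2 + a3 * f3 = 0}"

text \<open>The degree \<open>q\<close> piece of \<open>R(-d\<^sub>1) \<oplus> R(-d\<^sub>2) \<oplus> R(-d\<^sub>3)\<close>. The guard \<open>d\<^sub>i \<le> q\<close> is needed because
  subtraction on \<^typ>\<open>nat\<close> truncates.\<close>

fun shifted_piece :: "nat \<times> nat \<times> nat \<Rightarrow> nat
    \<Rightarrow> (('n::{finite,linorder}, 'k::field) mpoly \<times> ('n, 'k) mpoly \<times> ('n, 'k) mpoly) set" where
  "shifted_piece (d1, d2, d3) q = {(a1, a2, a3).
     (a1 \<noteq> 0 \<longrightarrow> d1 \<le> q \<and> a1 \<in> forms (q - d1))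
     \<and> (a2 \<noteq> 0 \<longrightarrow> d2 \<le> q \<and> a2 \<in> forms (q - d2))
     \<and> (a3 \<noteq> 0 \<longrightarrow> d3 \<le> q \<and> a3 \<in> forms (q - d3))}"

definition indeg_syz :: "nat \<times> nat \<times> nat
    \<Rightarrow> ('n::{finite,linorder}, 'k::field) mpoly \<times> ('n, 'k) mpoly \<times> ('n, 'k) mpoly \<Rightarrow> nat" where
  "indeg_syz d f = (LEAST q. \<exists>a \<in> syz f \<inter> shifted_piece d q. a \<noteq> (0, 0, 0))"

fun I_set :: "int \<Rightarrow> nat \<times> nat \<times> nat \<Rightarrow> int set" where
  "I_set e (d1, d2, d3) =
     (let D = int d1 + int d2 + int d3;
          \<sigma> = int d1 * int d2 + int d1 * int d3 + int d2 * int d3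
      in {max (\<sigma> - e * D) 0 .. e\<^sup>2 - e * D + \<sigma>})"

fun admissible :: "nat \<times> nat \<times> nat \<Rightarrow> int \<times> int \<Rightarrow> bool" where
  "admissible (d1, d2, d3) (e, j) \<longleftrightarrow>
     int d2 < e \<and> e \<le> int d1 + int d2 \<and> j \<in> I_set e (d1, d2, d3)"

fun realizes :: "nat \<times> nat \<times> nat
    \<Rightarrow> ('n::{finite,linorder}, 'k::field) mpoly \<times> ('n, 'k) mpoly \<times> ('n, 'k) mpoly
    \<Rightarrow> int \<times> int \<Rightarrow> bool" where
  "realizes d f (e, j) \<longleftrightarrow> has_degree_vector d f
     \<and> int (indeg_syz d f) = e \<and> codim2_degree (gen_ideal f) = ereal (real_of_int j)"

definition complete_intersection :: "('n::{finite,linorder}, 'k::field) mpoly set \<Rightarrow> bool" where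
  "complete_intersection J \<longleftrightarrow> ideal_height polyring J = 3"

end

theory Submission
  imports Defs
begin

text \<open>
  Prime ideals of \<open>R\<close> of height at most two decide everything. Since \<open>gcd(f\<^sub>1, f\<^sub>2, f\<^sub>3) = 1\<close> and \<open>R\<close> is
  factorial, every prime over \<open>J\<close> has height at least two; one of height exactly two is minimal over
  \<open>J\<close>, hence associated, and contributes a positive term to the codimension-two degree. Some prime over
  \<open>J\<close> has height at most three: otherwise \<open>J\<close> would meet every subring generated by \<open>n - 3\<close> of the
  variables, so \<open>R/J\<close> would grow more slowly than the quotient of \<open>R\<close> by three forms can. Upper
  bounds for heights come from growth as well: passing to a strictly larger prime lowers the order of
  growth of the quotient by at least one.

  If no prime of height two contains \<open>J\<close>, then for a suitable constant \<open>c\<close> the forms \<open>f\<^sub>1\<close> and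
  \<open>g = f\<^sub>2 + c f\<^sub>3\<close> are coprime, and \<open>f\<^sub>3\<close> is not a zero divisor modulo \<open>(f\<^sub>1, g)\<close>. To see the
  latter, make \<open>f\<^sub>1\<close> monic in \<open>x\<close> by a linear change of coordinates and let \<open>A\<close> be the polynomial ring
  in the other variables. If \<open>a \<notin> (f\<^sub>1, g)\<close>, then the ideal \<open>((f\<^sub>1, g) : a) \<inter> A\<close> is an ideal of
  denominators, so it lies in a principal ideal \<open>(\<delta>)\<close> of \<open>A\<close> with \<open>\<delta>\<close> irreducible; hence
  \<open>((f\<^sub>1, g) : a)\<close> meets the subring of \<open>n - 2\<close> suitable variables only in \<open>0\<close> and is contained in a
  prime of height at most two. Consequently all syzygies of \<open>J\<close> of degree less than \<open>d\<^sub>1 + d\<close> vanish.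

  The pair \<open>(d\<^sub>1 + d, 1)\<close> is realized by \<open>(x z\<^sup>d\<^sup>1\<^sup>-\<^sup>1, y\<^sup>d, y z\<^sup>d\<^sup>-\<^sup>1 + x\<^sup>d)\<close>, whose only prime of height
  two is \<open>(x, y)\<close>.
\<close>

section \<open>Gradings by subsets of the variables\<close>

text \<open>The equality of the two larger degrees enters through g = f2 + c f3: g is again a form
  of degree d, and a syzygy (a1, a2, a3) becomes a1 f1 + a2 g + (a3 - c a2) f3 = 0. The form f2
  itself will not do, since f1 and f2 may share a factor although the three forms do not. The choice
  of c and the coordinate change both need infinitely many scalars; characteristic zero supplies
  them. Heights speak of chains of arbitrary primes, whereas growth is visible on ideals. The bridge
  is the intersection with a polynomial subring k[T]: an ideal meeting k[T] only in 0 lies in a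
  prime with the same property, and the growth of k[T] caps every chain below that prime at n - |T|.
  The same criterion serves with |T| = n - 2 and with |T| = n - 3. The example is designed around
  inverting z: the first form then yields x and the third yields y, so J becomes (x, y) locally and
  the length is one. The powers of z only raise degrees, while y^d and x^d keep every other prime of
  height two away from J.\<close>

abbreviation monom_of :: "('n \<Rightarrow>\<^sub>0 nat) \<Rightarrow> ('n::{finite,linorder}, 'k::field) mpoly" where
  "monom_of m \<equiv> Poly_Mapping.single m 1"

abbreviation const :: "'k \<Rightarrow> ('n::{finite,linorder}, 'k::field) mpoly" where
  "const c \<equiv> Poly_Mapping.single 0 c"

definition var :: "'n \<Rightarrow> ('n::{finite,linorder}, 'k::field) mpoly" where
  "var i = monom_of (Poly_Mapping.single i 1)"

text \<open>One weight covers three gradings: \<open>T = UNIV\<close> gives the total degree,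
  \<open>T = {x}\<close> the degree in one variable, and \<open>T = - V\<close> detects the
  variables outside \<open>V\<close>.\<close>

definition wt :: "'n set \<Rightarrow> ('n::finite \<Rightarrow>\<^sub>0 nat) \<Rightarrow> nat" where
  "wt T m = (\<Sum>i\<in>T. Poly_Mapping.lookup m i)"

definition whom :: "'n set \<Rightarrow> nat \<Rightarrow> ('n::{finite,linorder}, 'k::field) mpoly set" where
  "whom T j = {f. \<forall>m \<in> Poly_Mapping.keys f. wt T m = j}"

definition hcomp :: "'n set \<Rightarrow> nat \<Rightarrow> ('n::{finite,linorder}, 'k::field) mpoly \<Rightarrow> ('n, 'k) mpoly" where
  "hcomp T j f = (\<Sum>m \<in> {m \<in> Poly_Mapping.keys f. wt T m = j}.
     Poly_Mapping.single m (Poly_Mapping.lookup f m))"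

text \<open>The inserted 0 gives the zero polynomial degree 0, so additivity under products needs
  nonzero factors.\<close>

definition wdeg :: "'n set \<Rightarrow> ('n::{finite,linorder}, 'k::field) mpoly \<Rightarrow> nat" where
  "wdeg T f = Max (insert 0 (wt T ` Poly_Mapping.keys f))"

text \<open>The subring k[V], encoded as weight 0 for the complement of \<open>V\<close>; that it
  contains every divisor of its nonzero elements is then additivity of \<open>wdeg\<close>.\<close>

definition polys_in :: "'n set \<Rightarrow> ('n::{finite,linorder}, 'k::field) mpoly set" where
  "polys_in V = whom (- V) 0"

lemma wt_zero [simp]: "wt T 0 = 0"
  by (simp add: wt_def)

lemma wt_add: "wt T (a + b) = wt T a + wt T b"
  by (simp add: wt_def lookup_add sum.distrib)

lemma wt_UNIV: "wt UNIV = mdeg"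
  by (simp add: wt_def mdeg_def fun_eq_iff)

lemma wt_singleton [simp]: "wt {i} m = Poly_Mapping.lookup m i"
  by (simp add: wt_def)

lemma wt_eq_0_iff: "wt T m = 0 \<longleftrightarrow> (\<forall>i\<in>T. Poly_Mapping.lookup m i = 0)"
  for T :: "'n::finite set"
  by (simp add: wt_def)

lemma wt_mono: "T \<subseteq> T' \<Longrightarrow> wt T m \<le> wt T' m"
  for T :: "'n::finite set"
  unfolding wt_def by (rule sum_mono2) auto

lemma forms_eq_whom: "forms q = whom UNIV q"
  by (simp add: forms_def whom_def wt_UNIV)

lemma whom_zero [simp]: "0 \<in> whom T j"
  by (simp add: whom_def)

lemma whom_add: "f \<in> whom T j \<Longrightarrow> g \<in> whom T j \<Longrightarrow> f + g \<in> whom T j"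
  using Poly_Mapping.keys_add[of f g] by (auto simp: whom_def)

lemma whom_uminus: "f \<in> whom T j \<Longrightarrow> - f \<in> whom T j"
  by (auto simp: whom_def in_keys_iff)

lemma whom_diff: "f \<in> whom T j \<Longrightarrow> g \<in> whom T j \<Longrightarrow> f - g \<in> whom T j"
  using whom_add[OF _ whom_uminus, of f T j g] by simp

lemma whom_sum: "(\<And>x. x \<in> A \<Longrightarrow> f x \<in> whom T j) \<Longrightarrow> sum f A \<in> whom T j"
  by (induction A rule: infinite_finite_induct) (auto intro: whom_add)

lemma whom_mult: "f \<in> whom T i \<Longrightarrow> g \<in> whom T j \<Longrightarrow> f * g \<in> whom T (i + j)"
  using keys_mult[of f g] by (fastforce simp: whom_def wt_add)

lemma whom_single [simp]: "Poly_Mapping.single m c \<in> whom T j \<longleftrightarrow> c = 0 \<or> wt T m = j"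
  by (auto simp: whom_def)

lemma whom_const [simp]: "const c \<in> whom T 0"
  by simp

lemma whom_one [simp]: "1 \<in> whom T 0"
  using whom_const[of 1] by simp

lemma whom_power: "f \<in> whom T j \<Longrightarrow> f ^ k \<in> whom T (k * j)"
  by (induction k) (use whom_mult in \<open>auto simp: whom_one\<close>)

lemma var_whom: "var i \<in> whom T (if i \<in> T then 1 else 0)"
  by (simp add: var_def wt_def lookup_single sum.delta when_def)

lemma lookup_hcomp:
  "Poly_Mapping.lookup (hcomp T j f) m = (if wt T m = j then Poly_Mapping.lookup f m else 0)"
  by (auto simp: hcomp_def lookup_sum lookup_single when_def sum.delta' in_keys_iff)

lemma keys_hcomp: "Poly_Mapping.keys (hcomp T j f) = {m \<in> Poly_Mapping.keys f. wt T m = j}"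
  by (auto simp: in_keys_iff lookup_hcomp split: if_splits)

lemma hcomp_eq_0I: "(\<And>m. m \<in> Poly_Mapping.keys f \<Longrightarrow> wt T m \<noteq> j) \<Longrightarrow> hcomp T j f = 0"
  using keys_hcomp[of T j f] keys_eq_empty[of "hcomp T j f"] by blast

lemma hcomp_whom [simp]: "hcomp T j f \<in> whom T j"
  by (simp add: whom_def keys_hcomp)

lemma hcomp_whom_other: "f \<in> whom T' i \<Longrightarrow> hcomp T j f \<in> whom T' i"
  by (simp add: whom_def keys_hcomp)

lemma hcomp_id: "f \<in> whom T j \<Longrightarrow> hcomp T i f = (if i = j then f else 0)"
  by (rule poly_mapping_eqI) (auto simp: lookup_hcomp whom_def in_keys_iff)

lemma hcomp_add: "hcomp T j (f + g) = hcomp T j f + hcomp T j g"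
  by (rule poly_mapping_eqI) (simp add: lookup_hcomp lookup_add)

lemma hcomp_diff: "hcomp T j (f - g) = hcomp T j f - hcomp T j g"
  by (rule poly_mapping_eqI) (simp add: lookup_hcomp lookup_minus)

lemma hcomp_zero [simp]: "hcomp T j 0 = 0"
  by (rule poly_mapping_eqI) (simp add: lookup_hcomp)

lemma hcomp_sum: "hcomp T j (sum f A) = (\<Sum>x\<in>A. hcomp T j (f x))"
  by (induction A rule: infinite_finite_induct) (auto simp: hcomp_add)

lemma hcomp_one_0 [simp]: "hcomp T 0 1 = 1"
  by (simp add: hcomp_id[OF whom_one])

lemma sum_hcomp:
  assumes "finite A" "wt T ` Poly_Mapping.keys f \<subseteq> A"
  shows "(\<Sum>j\<in>A. hcomp T j f) = f"
proof (rule poly_mapping_eqI)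
  fix m
  have "wt T m \<in> A" if "Poly_Mapping.lookup f m \<noteq> 0"
    using assms(2) that by (auto simp: in_keys_iff)
  then show "Poly_Mapping.lookup (\<Sum>j\<in>A. hcomp T j f) m = Poly_Mapping.lookup f m"
    using assms(1) by (auto simp: lookup_sum lookup_hcomp)
qed

lemma wt_le_wdeg: "m \<in> Poly_Mapping.keys f \<Longrightarrow> wt T m \<le> wdeg T f"
  by (simp add: wdeg_def)

lemma wdeg_le_iff: "wdeg T f \<le> k \<longleftrightarrow> (\<forall>m\<in>Poly_Mapping.keys f. wt T m \<le> k)"
  by (simp add: wdeg_def)

lemma sum_hcomp_atMost: "(\<Sum>j\<le>wdeg T f. hcomp T j f) = f"
  by (rule sum_hcomp) (auto simp: wt_le_wdeg)

lemma hcomp_mult_whom: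
  assumes f: "f \<in> whom T i"
  shows "hcomp T j (f * g) = (if i \<le> j then f * hcomp T (j - i) g else 0)"
proof (cases "i \<le> j")
  case True
  define g2 where "g2 = g - hcomp T (j - i) g"
  have k2: "wt T m \<noteq> j - i" if "m \<in> Poly_Mapping.keys g2" for m
    using that by (auto simp: g2_def in_keys_iff lookup_minus lookup_hcomp split: if_splits)
  have "wt T m \<noteq> j" if m: "m \<in> Poly_Mapping.keys (f * g2)" for m
  proof -
    obtain a b where "m = a + b" "a \<in> Poly_Mapping.keys f" "b \<in> Poly_Mapping.keys g2"
      using m keys_mult[of f g2] by blast
    then show ?thesis using f k2[of b] True by (auto simp: whom_def wt_add)
  qed
  then have 2: "hcomp T j (f * g2) = 0" by (rule hcomp_eq_0I)
  have "f * g = f * hcomp T (j - i) g + f * g2"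
    by (simp add: g2_def algebra_simps)
  then have "hcomp T j (f * g) = hcomp T j (f * hcomp T (j - i) g) + hcomp T j (f * g2)"
    by (metis hcomp_add)
  moreover have "f * hcomp T (j - i) g \<in> whom T j"
    using whom_mult[OF f hcomp_whom, of "j - i" g] True by simp
  ultimately show ?thesis using 2 True by (simp add: hcomp_id[where j = j])
next
  case False
  have "wt T m \<noteq> j" if m: "m \<in> Poly_Mapping.keys (f * g)" for m
  proof -
    obtain a b where "m = a + b" "a \<in> Poly_Mapping.keys f" "b \<in> Poly_Mapping.keys g"
      using m keys_mult[of f g] by blast
    then show ?thesis using f False by (auto simp: whom_def wt_add)
  qed
  then have "hcomp T j (f * g) = 0" by (rule hcomp_eq_0I)
  then show ?thesis using False by simp
qed

lemma hcomp_mult: "hcomp T j (f * g) = (\<Sum>i\<le>j. hcomp T i f * hcomp T (j - i) g)"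
proof -
  \<comment> \<open>The range must contain every nonzero component of \<open>f\<close> and every
    index up to \<open>j\<close>.\<close>
  define N where "N = max j (wdeg T f)"
  have "f = (\<Sum>i\<le>N. hcomp T i f)"
    by (rule sum_hcomp[symmetric]) (auto simp: N_def le_max_iff_disj wt_le_wdeg)
  then have "hcomp T j (f * g) = hcomp T j ((\<Sum>i\<le>N. hcomp T i f) * g)"
    by (rule arg_cong[where f = "\<lambda>u. hcomp T j (u * g)"])
  also have "\<dots> = (\<Sum>i\<le>N. hcomp T j (hcomp T i f * g))"
    by (simp only: sum_distrib_right hcomp_sum)
  also have "\<dots> = (\<Sum>i\<le>N. if i \<le> j then hcomp T i f * hcomp T (j - i) g else 0)"
    by (simp add: hcomp_mult_whom[OF hcomp_whom])
  also have "\<dots> = (\<Sum>i\<le>j. hcomp T i f * hcomp T (j - i) g)"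
    by (rule sum.mono_neutral_cong_right) (auto simp: N_def)
  finally show ?thesis .
qed

lemma hcomp_mult_0: "hcomp T 0 (f * g) = hcomp T 0 f * hcomp T 0 g"
  by (simp add: hcomp_mult)

lemma hcomp_wdeg_nonzero: "f \<noteq> 0 \<Longrightarrow> hcomp T (wdeg T f) f \<noteq> 0"
proof -
  assume "f \<noteq> 0"
  then have ne: "Poly_Mapping.keys f \<noteq> {}" by simp
  then have "wdeg T f = Max (wt T ` Poly_Mapping.keys f)"
    by (simp add: wdeg_def)
  then have "wdeg T f \<in> wt T ` Poly_Mapping.keys f"
    using ne by simp
  then obtain m where "m \<in> Poly_Mapping.keys f" "wt T m = wdeg T f" by auto
  then have "m \<in> Poly_Mapping.keys (hcomp T (wdeg T f) f)" by (simp add: keys_hcomp)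
  then show ?thesis by auto
qed

lemma hcomp_above_wdeg: "wdeg T f < j \<Longrightarrow> hcomp T j f = 0"
  by (rule hcomp_eq_0I) (use wt_le_wdeg[of _ f T] in force)

lemma wdeg_ge: "hcomp T j f \<noteq> 0 \<Longrightarrow> j \<le> wdeg T f"
  using hcomp_above_wdeg not_le by blast

text \<open>Among the products of components whose indices add up to
  \<open>wdeg T f + wdeg T g\<close>, only that of the two top components survives, and it is
  nonzero in a domain.\<close>

lemma wdeg_mult:
  assumes "f \<noteq> 0" "g \<noteq> 0"
  shows "wdeg T (f * g) = wdeg T f + wdeg T g"
proof (rule antisym)
  show "wdeg T (f * g) \<le> wdeg T f + wdeg T g"
    unfolding wdeg_le_iff
  proof
    fix m assume "m \<in> Poly_Mapping.keys (f * g)"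
    then obtain a b where "m = a + b" "a \<in> Poly_Mapping.keys f" "b \<in> Poly_Mapping.keys g"
      using keys_mult[of f g] by blast
    then show "wt T m \<le> wdeg T f + wdeg T g"
      using wt_le_wdeg[of a f T] wt_le_wdeg[of b g T] by (simp add: wt_add)
  qed
  have "hcomp T (wdeg T f + wdeg T g) (f * g)
      = (\<Sum>i\<le>wdeg T f + wdeg T g. hcomp T i f * hcomp T (wdeg T f + wdeg T g - i) g)"
    by (rule hcomp_mult)
  also have "\<dots> = (\<Sum>i\<in>{wdeg T f}. hcomp T i f * hcomp T (wdeg T f + wdeg T g - i) g)"
  proof (rule sum.mono_neutral_right)
    show "\<forall>i\<in>{..wdeg T f + wdeg T g} - {wdeg T f}. hcomp T i f * hcomp T (wdeg T f + wdeg T g - i) g = 0"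
    proof
      fix i assume "i \<in> {..wdeg T f + wdeg T g} - {wdeg T f}"
      then have "i > wdeg T f \<or> wdeg T f + wdeg T g - i > wdeg T g" by auto
      then show "hcomp T i f * hcomp T (wdeg T f + wdeg T g - i) g = 0"
        using hcomp_above_wdeg[of T f i] hcomp_above_wdeg[of T g "wdeg T f + wdeg T g - i"] by auto
    qed
  qed auto
  also have "\<dots> \<noteq> 0"
    using hcomp_wdeg_nonzero[OF assms(1), of T] hcomp_wdeg_nonzero[OF assms(2), of T] by simp
  finally show "wdeg T f + wdeg T g \<le> wdeg T (f * g)" by (rule wdeg_ge)
qed

lemma wdeg_zero [simp]: "wdeg T 0 = 0"
  by (simp add: wdeg_def)

lemma wdeg_whom: "f \<in> whom T j \<Longrightarrow> f \<noteq> 0 \<Longrightarrow> wdeg T f = j"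
  using hcomp_wdeg_nonzero[of f T] hcomp_id[of f T j "wdeg T f"] by (auto split: if_splits)

lemma wdeg_mult_le: "wdeg T (f * g) \<le> wdeg T f + wdeg T g"
  by (cases "f = 0 \<or> g = 0") (auto simp: wdeg_mult)

lemma wdeg_add_le: "wdeg T (f + g) \<le> max (wdeg T f) (wdeg T g)"
  unfolding wdeg_le_iff using Poly_Mapping.keys_add[of f g] wt_le_wdeg[of _ f T] wt_le_wdeg[of _ g T]
  by (fastforce simp: le_max_iff_disj)

lemma wdeg_uminus [simp]: "wdeg T (- f) = wdeg T f"
proof -
  have "Poly_Mapping.keys (- f) = Poly_Mapping.keys f" by (auto simp: in_keys_iff)
  then show ?thesis by (simp add: wdeg_def)
qed

lemma wdeg_diff_le: "wdeg T (f - g) \<le> max (wdeg T f) (wdeg T g)"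
  using wdeg_add_le[of T f "- g"] by simp

lemma wdeg_mono: "T \<subseteq> T' \<Longrightarrow> wdeg T f \<le> wdeg T' f"
  unfolding wdeg_le_iff using wt_mono wt_le_wdeg order_trans by metis

lemma wdeg_eq_0_iff: "wdeg T f = 0 \<longleftrightarrow> f \<in> whom T 0"
  using wdeg_le_iff[of T f 0] by (simp add: whom_def)

lemma wdeg_dvd_le: "f dvd g \<Longrightarrow> g \<noteq> 0 \<Longrightarrow> wdeg T f \<le> wdeg T g"
  by (auto simp: dvd_def wdeg_mult)

text \<open>The component of \<open>f * g\<close> in weight \<open>k\<close> is \<open>f\<close>
  times the component of \<open>g\<close> in weight \<open>k - i\<close>; cancelling
  \<open>f\<close> identifies \<open>g\<close> with that component. For \<open>g \<noteq> 0\<close>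
  this forces \<open>i \<le> k\<close>, so the subtraction does not truncate.\<close>

lemma whom_factor:
  assumes "f * g \<in> whom T k" "f \<in> whom T i" "f \<noteq> 0"
  shows "g \<in> whom T (k - i)"
proof (cases "g = 0")
  case False
  then have fg: "f * g \<noteq> 0" using assms by simp
  have "hcomp T k (f * g) = f * g" using assms(1) by (simp add: hcomp_id)
  then have "i \<le> k" "f * hcomp T (k - i) g = f * g"
    using hcomp_mult_whom[OF assms(2), of k g] fg by (auto split: if_splits)
  then have "hcomp T (k - i) g = g" using assms(3) by simp
  then show ?thesis using hcomp_whom by metis
qed simp

subsection \<open>The subring of polynomials in a set of variables\<close>

lemma polys_in_wdeg: "f \<in> polys_in V \<longleftrightarrow> wdeg (- V) f = 0"
  by (simp add: polys_in_def wdeg_eq_0_iff)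

lemma polys_in_zero [simp]: "0 \<in> polys_in V"
  and polys_in_one [simp]: "1 \<in> polys_in V"
  and polys_in_const [simp]: "const c \<in> polys_in V"
  and polys_in_add: "f \<in> polys_in V \<Longrightarrow> g \<in> polys_in V \<Longrightarrow> f + g \<in> polys_in V"
  and polys_in_diff: "f \<in> polys_in V \<Longrightarrow> g \<in> polys_in V \<Longrightarrow> f - g \<in> polys_in V"
  and polys_in_mult: "f \<in> polys_in V \<Longrightarrow> g \<in> polys_in V \<Longrightarrow> f * g \<in> polys_in V"
  using whom_mult[of f "- V" 0 g 0]
  by (simp_all add: polys_in_def whom_add whom_diff)

lemma polys_in_power: "f \<in> polys_in V \<Longrightarrow> f ^ k \<in> polys_in V"
  by (induction k) (auto intro: polys_in_mult)

lemma polys_in_hcomp: "f \<in> polys_in V \<Longrightarrow> hcomp T j f \<in> polys_in V"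
  unfolding polys_in_def by (rule hcomp_whom_other)

lemma polys_in_dvd: "f dvd g \<Longrightarrow> g \<in> polys_in V \<Longrightarrow> g \<noteq> 0 \<Longrightarrow> f \<in> polys_in V"
  using wdeg_dvd_le[of f g "- V"] by (simp add: polys_in_wdeg)

lemma polys_in_factor: "f * g \<in> polys_in V \<Longrightarrow> f * g \<noteq> 0 \<Longrightarrow> f \<in> polys_in V \<and> g \<in> polys_in V"
  using polys_in_dvd[of f "f * g" V] polys_in_dvd[of g "f * g" V] by auto

lemma polys_in_mono: "V \<subseteq> W \<Longrightarrow> f \<in> polys_in V \<Longrightarrow> f \<in> polys_in W"
  using wdeg_mono[of "- W" "- V" f] by (auto simp: polys_in_wdeg)

lemma polys_in_UNIV [simp]: "f \<in> polys_in UNIV"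
  by (simp add: polys_in_def whom_def wt_def)

lemma polys_in_var: "i \<in> V \<Longrightarrow> var i \<in> polys_in V"
  using var_whom[of i "- V"] by (simp add: polys_in_def)

lemma polys_in_keys: "f \<in> polys_in V \<Longrightarrow> m \<in> Poly_Mapping.keys f \<Longrightarrow> i \<notin> V \<Longrightarrow> Poly_Mapping.lookup m i = 0"
  by (auto simp: polys_in_def whom_def wt_eq_0_iff)

lemma polys_in_empty: "f \<in> polys_in {} \<longleftrightarrow> (\<exists>c. f = const c)"
proof
  assume f: "f \<in> polys_in {}"
  then have "m = 0" if "m \<in> Poly_Mapping.keys f" for m
    using that by (intro poly_mapping_eqI) (auto simp: polys_in_keys)
  then have "f = const (Poly_Mapping.lookup f 0)"
    by (intro poly_mapping_eqI) (auto simp: lookup_single when_def in_keys_iff)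
  then show "\<exists>c. f = const c" ..
qed auto

lemma const_mult: "const a * const b = const (a * b)"
  by (simp add: mult_single)

lemma const_unit: "c \<noteq> 0 \<Longrightarrow> const c dvd (1 :: ('n::{finite,linorder}, 'k::field) mpoly)"
  by (rule dvdI[of _ _ "const (inverse c)"]) (simp add: const_mult)

lemma is_unit_iff: "f dvd 1 \<longleftrightarrow> f \<noteq> 0 \<and> wdeg UNIV f = 0"
  for f :: "('n::{finite,linorder}, 'k::field) mpoly"
proof
  assume u: "f dvd 1"
  have "wdeg UNIV (1 :: ('n, 'k) mpoly) = 0"
    by (simp add: wdeg_eq_0_iff)
  then show "f \<noteq> 0 \<and> wdeg UNIV f = 0"
    using wdeg_dvd_le[OF u, of UNIV] u by auto
next
  assume f: "f \<noteq> 0 \<and> wdeg UNIV f = 0"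
  then obtain c where c: "f = const c"
    using polys_in_empty[of f] by (auto simp: polys_in_wdeg)
  then have "c \<noteq> 0" using f by auto
  then show "f dvd 1" using const_unit c by simp
qed

lemma is_unit_whom_0: "f \<noteq> 0 \<Longrightarrow> f \<in> whom UNIV 0 \<Longrightarrow> f dvd 1"
  by (simp add: is_unit_iff wdeg_eq_0_iff)

lemma wdeg_pos_var:
  assumes "wdeg UNIV f \<noteq> 0"
  obtains y where "wdeg {y} f > 0"
proof -
  obtain m where m: "m \<in> Poly_Mapping.keys f" "wt UNIV m \<noteq> 0"
    using assms by (auto simp: wdeg_eq_0_iff whom_def)
  then obtain y where "Poly_Mapping.lookup m y \<noteq> 0" by (auto simp: wt_eq_0_iff)
  then have "wdeg {y} f > 0" using wt_le_wdeg[OF m(1), of "{y}"] by simp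
  then show ?thesis by (rule that)
qed

section \<open>Unique factorization\<close>

text \<open>The lowest components outside \<open>Q\<close> of the two factors have a product that does not cancel
  modulo \<open>Q\<close>.\<close>

lemma prime_by_components:
  fixes f g :: "('n::{finite,linorder}, 'k::field) mpoly"
  assumes Q: "Q 0" "\<And>a b. Q a \<Longrightarrow> Q b \<Longrightarrow> Q (a - b)" "\<And>a b. Q a \<Longrightarrow> Q (a * b)"
    and prime: "\<And>i j. Q (hcomp T i f * hcomp T j g) \<Longrightarrow> Q (hcomp T i f) \<or> Q (hcomp T j g)"
    and fg: "\<And>j. Q (hcomp T j (f * g))"
  shows "(\<forall>i. Q (hcomp T i f)) \<or> (\<forall>j. Q (hcomp T j g))"
proof (rule ccontr)
  assume "\<not> ?thesis"
  then have ex: "\<exists>i. \<not> Q (hcomp T i f)" "\<exists>j. \<not> Q (hcomp T j g)" by auto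
  define i where "i = (LEAST i. \<not> Q (hcomp T i f))"
  define j where "j = (LEAST j. \<not> Q (hcomp T j g))"
  have i: "\<not> Q (hcomp T i f)" "\<And>k. k < i \<Longrightarrow> Q (hcomp T k f)"
    unfolding i_def using LeastI_ex[OF ex(1)] not_less_Least by blast+
  have j: "\<not> Q (hcomp T j g)" "\<And>k. k < j \<Longrightarrow> Q (hcomp T k g)"
    unfolding j_def using LeastI_ex[OF ex(2)] not_less_Least by blast+
  have Qadd: "Q (a + b)" if "Q a" "Q b" for a b
    using Q(2)[OF that(1) Q(2)[OF Q(1) that(2)]] by simp
  have Qsum: "Q (sum h A)" if "\<And>x. x \<in> A \<Longrightarrow> Q (h x)" for h and A :: "nat set"
    using that by (induction A rule: infinite_finite_induct) (auto intro: Q(1) Qadd)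
  have "hcomp T (i + j) (f * g) = (\<Sum>k\<le>i + j. hcomp T k f * hcomp T (i + j - k) g)"
    by (rule hcomp_mult)
  also have "\<dots> = hcomp T i f * hcomp T j g
      + (\<Sum>k\<in>{..i + j} - {i}. hcomp T k f * hcomp T (i + j - k) g)"
    by (subst sum.remove[of _ i]) auto
  finally have "hcomp T i f * hcomp T j g = hcomp T (i + j) (f * g)
      - (\<Sum>k\<in>{..i + j} - {i}. hcomp T k f * hcomp T (i + j - k) g)" by simp
  moreover have "Q (\<Sum>k\<in>{..i + j} - {i}. hcomp T k f * hcomp T (i + j - k) g)"
  proof (rule Qsum)
    fix k assume k: "k \<in> {..i + j} - {i}"
    show "Q (hcomp T k f * hcomp T (i + j - k) g)"
    proof (cases "k < i")
      case True
      then show ?thesis using i(2) Q(3) by blast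
    next
      case False
      then have "i + j - k < j" using k by auto
      then have "Q (hcomp T (i + j - k) g * hcomp T k f)" using j(2) Q(3) by blast
      then show ?thesis by (simp add: mult.commute)
    qed
  qed
  ultimately have "Q (hcomp T i f * hcomp T j g)" using Q(2) fg by presburger
  then show False using prime i(1) j(1) by blast
qed

lemma irreducible_factor_exists:
  fixes f :: "('n::{finite,linorder}, 'k::field) mpoly"
  assumes "f \<noteq> 0" "\<not> f dvd 1"
  shows "\<exists>p. irreducible p \<and> p dvd f"
  using assms
proof (induction "wdeg UNIV f" arbitrary: f rule: less_induct)
  case less
  show ?case
  proof (cases "irreducible f")
    case False
    then obtain a b where ab: "f = a * b" "\<not> a dvd 1" "\<not> b dvd 1"
      using less.prems by (auto simp: irreducible_def)
    then have "wdeg UNIV a < wdeg UNIV f"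
      using less.prems by (auto simp: wdeg_mult is_unit_iff)
    then obtain p where "irreducible p" "p dvd a"
      using less.hyps[of a] ab less.prems by auto
    then show ?thesis using ab by auto
  qed auto
qed

lemma dvd_hcomp_iff:
  assumes "p \<in> whom T 0"
  shows "p dvd f \<longleftrightarrow> (\<forall>i. p dvd hcomp T i f)"
proof
  assume "p dvd f"
  then show "\<forall>i. p dvd hcomp T i f"
    using assms by (auto simp: dvd_def hcomp_mult_whom)
next
  assume "\<forall>i. p dvd hcomp T i f"
  then have "p dvd (\<Sum>i\<le>wdeg T f. hcomp T i f)" by (auto intro: dvd_sum)
  then show "p dvd f" by (simp add: sum_hcomp_atMost)
qed

lemma var_power: "(var i :: ('n::{finite,linorder}, 'k::field) mpoly) ^ k = monom_of (Poly_Mapping.single i k)"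
proof (induction k)
  case (Suc k)
  then show ?case by (simp add: var_def mult_single flip: single_add)
qed simp

lemma var_nonzero [simp]: "(var i :: ('n::{finite,linorder}, 'k::field) mpoly) \<noteq> 0"
  by (metis keys_single keys_zero insert_not_empty var_def zero_neq_one)

lemma poly_mapping_sum_single:
  "f = (\<Sum>m\<in>Poly_Mapping.keys f. Poly_Mapping.single m (Poly_Mapping.lookup f m))"
  by (rule poly_mapping_eqI) (auto simp: lookup_sum lookup_single when_def sum.delta' in_keys_iff)

lemma whom_var_factor:
  assumes "f \<in> whom {x} k"
  shows "\<exists>c. f = var x ^ k * c \<and> c \<in> whom {x} 0"
proof -
  define c where "c = (\<Sum>m\<in>Poly_Mapping.keys f.
    Poly_Mapping.single (m - Poly_Mapping.single x k) (Poly_Mapping.lookup f m))"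
  have "var x ^ k * c = (\<Sum>m\<in>Poly_Mapping.keys f. Poly_Mapping.single m (Poly_Mapping.lookup f m))"
    unfolding c_def sum_distrib_left
  proof (rule sum.cong)
    fix m assume m: "m \<in> Poly_Mapping.keys f"
    have "Poly_Mapping.single x k + (m - Poly_Mapping.single x k) = m"
      using assms m
      by (intro poly_mapping_eqI) (auto simp: whom_def lookup_add lookup_minus lookup_single when_def)
    then show "var x ^ k * Poly_Mapping.single (m - Poly_Mapping.single x k) (Poly_Mapping.lookup f m)
      = Poly_Mapping.single m (Poly_Mapping.lookup f m)"
      by (simp add: var_power mult_single)
  qed auto
  then have 1: "f = var x ^ k * c" using poly_mapping_sum_single[of f] by simp
  moreover have "var x ^ k \<in> whom {x} k" by (simp add: var_power)
  ultimately have "c \<in> whom {x} (k - k)" using assms by (intro whom_factor) auto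
  then show ?thesis using 1 by auto
qed

lemma polys_in_insert_whom_0: "f \<in> polys_in (insert x V) \<Longrightarrow> f \<in> whom {x} 0 \<Longrightarrow> f \<in> polys_in V"
  by (auto simp: polys_in_def whom_def wt_eq_0_iff) blast

lemma polys_in_whom_0: "f \<in> polys_in V \<Longrightarrow> x \<notin> V \<Longrightarrow> f \<in> whom {x} 0"
  by (auto simp: polys_in_def whom_def wt_eq_0_iff)

text \<open>The factor \<open>c\<close> is the coefficient of x^i; this is how k[V][x] is handled
  inside the one ring of all polynomials.\<close>

lemma hcomp_var_factor:
  assumes "f \<in> polys_in (insert x V)"
  shows "\<exists>c\<in>polys_in V. hcomp {x} i f = var x ^ i * c"
proof -
  obtain c where c: "hcomp {x} i f = var x ^ i * c" "c \<in> whom {x} 0"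
    using whom_var_factor[OF hcomp_whom] by blast
  have "c \<in> polys_in (insert x V)"
  proof (cases "c = 0")
    case False
    then show ?thesis
      using polys_in_factor[of "var x ^ i" c "insert x V"] polys_in_hcomp[OF assms, of "{x}" i] c(1)
      by simp
  qed simp
  then show ?thesis using c polys_in_insert_whom_0 by blast
qed

text \<open>Primality inside k[V], meant for induction on the variables. Divisibility may be taken
  in the whole ring because divisors of nonzero elements of k[V] stay in k[V].\<close>

definition prime_wrt :: "'n set \<Rightarrow> ('n::{finite,linorder}, 'k::field) mpoly \<Rightarrow> bool" where
  "prime_wrt V p \<longleftrightarrow> (\<forall>f\<in>polys_in V. \<forall>g\<in>polys_in V. p dvd f * g \<longrightarrow> p dvd f \<or> p dvd g)"

text \<open>Gauss: \<open>p\<close> divides a polynomial in \<open>x\<close> over k[V] exactly when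
  it divides all its coefficients, so a prime of k[V] stays prime in k[V][x].\<close>

lemma prime_wrt_insert:
  assumes p: "p \<in> polys_in V" "p \<noteq> 0" "prime_wrt V p" and x: "x \<notin> V"
  shows "prime_wrt (insert x V) p"
  unfolding prime_wrt_def
proof (intro ballI impI)
  fix f g assume fg: "f \<in> polys_in (insert x V)" "g \<in> polys_in (insert x V)" "p dvd f * g"
  have p0: "p \<in> whom {x} 0" using polys_in_whom_0[OF p(1) x] .
  have "(\<forall>i. p dvd hcomp {x} i f) \<or> (\<forall>j. p dvd hcomp {x} j g)"
  proof (rule prime_by_components[where Q = "\<lambda>r. p dvd r"])
    fix i j assume d: "p dvd hcomp {x} i f * hcomp {x} j g"
    obtain c where c: "c \<in> polys_in V" "hcomp {x} i f = var x ^ i * c"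
      using hcomp_var_factor[OF fg(1)] by blast
    obtain c' where c': "c' \<in> polys_in V" "hcomp {x} j g = var x ^ j * c'"
      using hcomp_var_factor[OF fg(2)] by blast
    have eq: "hcomp {x} i f * hcomp {x} j g = var x ^ (i + j) * (c * c')"
      by (simp add: c c' power_add)
    then obtain r where r: "var x ^ (i + j) * (c * c') = p * r" using d by (auto simp: dvd_def)
    have "var x ^ (i + j) * (c * c') \<in> whom {x} (i + j)"
      using whom_mult[OF hcomp_whom hcomp_whom, of "{x}" i f j g] eq by simp
    then have "r \<in> whom {x} (i + j)" using whom_factor[of p r "{x}" "i + j" 0] r p0 p(2) by simp
    then obtain s where "r = var x ^ (i + j) * s" using whom_var_factor by blast
    then have "var x ^ (i + j) * (c * c') = var x ^ (i + j) * (p * s)" using r by (simp add: ac_simps)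
    then have "c * c' = p * s" by (subst (asm) mult_cancel_left) simp
    then have "p dvd c \<or> p dvd c'" using p(3) c(1) c'(1) by (auto simp: prime_wrt_def)
    then show "p dvd hcomp {x} i f \<or> p dvd hcomp {x} j g" by (auto simp: c c')
  next
    fix j show "p dvd hcomp {x} j (f * g)" using fg(3) dvd_hcomp_iff[OF p0] by blast
  qed auto
  then show "p dvd f \<or> p dvd g" using dvd_hcomp_iff[OF p0] by blast
qed

text \<open>Ordinary division would need an invertible leading coefficient of \<open>h\<close>; its
  powers are collected in \<open>c\<close> instead, so that no fraction field has to be
  built.\<close>

lemma pseudo_division:
  assumes x: "x \<notin> V" and h: "h \<in> polys_in (insert x V)" "h \<noteq> 0" and f: "f \<in> polys_in (insert x V)"
  shows "\<exists>c\<in>polys_in V - {0}. \<exists>q\<in>polys_in (insert x V). \<exists>r\<in>polys_in (insert x V).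
    c * f = q * h + r \<and> (r = 0 \<or> wdeg {x} r < wdeg {x} h)"
  using f
proof (induction "wdeg {x} f" arbitrary: f rule: less_induct)
  case less
  define d where "d = wdeg {x} h"
  show ?case
  proof (cases "f = 0 \<or> wdeg {x} f < d")
    case True
    have "1 * f = 0 * h + f \<and> (f = 0 \<or> wdeg {x} f < wdeg {x} h)"
      using True by (simp add: d_def)
    moreover have "1 \<in> polys_in V - {0}" by simp
    ultimately show ?thesis using less.prems polys_in_zero by blast
  next
    case False
    define e where "e = wdeg {x} f"
    have e: "f \<noteq> 0" "d \<le> e" using False by (auto simp: e_def)
    obtain a where a: "a \<in> polys_in V" "hcomp {x} d h = var x ^ d * a"
      using hcomp_var_factor[OF h(1)] by blast
    obtain b where b: "b \<in> polys_in V" "hcomp {x} e f = var x ^ e * b"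
      using hcomp_var_factor[OF less.prems] by blast
    have a0: "a \<noteq> 0" using a hcomp_wdeg_nonzero[OF h(2), of "{x}"] by (auto simp: d_def)
    define q0 where "q0 = var x ^ (e - d) * b"
    have sub: "polys_in V \<subseteq> polys_in (insert x V)"
      by (auto intro: polys_in_mono[of V "insert x V"])
    have q0: "q0 \<in> polys_in (insert x V)"
      using b(1) sub by (auto simp: q0_def intro!: polys_in_mult polys_in_power polys_in_var)
    \<comment> \<open>Multiplying crosswise by the leading coefficients \<open>a\<close> of
      \<open>h\<close> and \<open>b\<close> of \<open>f\<close> cancels the terms in x^e.\<close>
    define f1 where "f1 = a * f - q0 * h"
    have f1: "f1 \<in> polys_in (insert x V)"
      using a(1) sub less.prems h(1) q0 by (auto simp: f1_def intro!: polys_in_mult polys_in_diff)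
    have x0: "b \<in> whom {x} 0" "a \<in> whom {x} 0"
      using a(1) b(1) x polys_in_whom_0 by auto
    have q0w: "q0 \<in> whom {x} (e - d)"
      using whom_mult[OF _ x0(1), of "var x ^ (e - d)" "e - d"] by (simp add: q0_def var_power)
    have f1_deg: "wdeg {x} f1 < e" if "f1 \<noteq> 0"
    proof -
      have "wdeg {x} a = 0" "wdeg {x} q0 \<le> e - d"
        using x0(2) wdeg_whom[OF q0w] by (auto simp: wdeg_eq_0_iff) (cases "q0 = 0"; simp)
      then have "wdeg {x} (a * f) \<le> e" "wdeg {x} (q0 * h) \<le> e"
        using wdeg_mult_le[of "{x}" a f] wdeg_mult_le[of "{x}" q0 h] e(2) by (auto simp: e_def d_def)
      then have "wdeg {x} f1 \<le> e"
        using wdeg_diff_le[of "{x}" "a * f" "q0 * h"] by (simp add: f1_def)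
      moreover have "hcomp {x} e f1 = a * hcomp {x} e f - q0 * hcomp {x} d h"
        using hcomp_mult_whom[OF x0(2), of e f] hcomp_mult_whom[OF q0w, of e h] e(2)
        by (simp add: f1_def hcomp_diff)
      then have "hcomp {x} e f1 = a * b * var x ^ e - a * b * (var x ^ (e - d) * var x ^ d)"
        by (simp add: a b q0_def ac_simps)
      then have "hcomp {x} e f1 = 0" using e(2) by (simp flip: power_add)
      then have "wdeg {x} f1 \<noteq> e" using hcomp_wdeg_nonzero[OF that, of "{x}"] by auto
      ultimately show ?thesis by simp
    qed
    show ?thesis
    proof (cases "f1 = 0")
      case True
      then have "a * f = q0 * h + 0 \<and> (0 = 0 \<or> wdeg {x} 0 < wdeg {x} h)" by (simp add: f1_def)
      then show ?thesis using a(1) a0 q0 polys_in_zero by blast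
    next
      case False
      then obtain c q r where c: "c \<in> polys_in V - {0}" "q \<in> polys_in (insert x V)"
          "r \<in> polys_in (insert x V)" "c * f1 = q * h + r" "r = 0 \<or> wdeg {x} r < wdeg {x} h"
        using less.hyps[of f1] f1_deg f1 unfolding e_def by blast
      have "(c * a) * f = (q + c * q0) * h + r"
        using c(4) by (simp add: f1_def algebra_simps)
      moreover have "c * a \<in> polys_in V - {0}" using c(1) a(1) a0 polys_in_mult by auto
      moreover have "q + c * q0 \<in> polys_in (insert x V)"
        using c q0 sub by (auto intro!: polys_in_mult polys_in_add)
      ultimately show ?thesis using c(3,5) by blast
    qed
  qed
qed

text \<open>The irreducible factors of \<open>c\<close> are cancelled one at a time. Each is prime
  in k[V][x] by Gauss and divides p s, where c g = p s; it cannot divide \<open>p\<close>, which is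
  irreducible of positive degree in \<open>x\<close>, so it divides s.\<close>

lemma irreducible_dvd_cancel_const:
  fixes p :: "('n::{finite,linorder}, 'k::field) mpoly"
  assumes IH: "\<forall>\<pi>\<in>(polys_in V :: ('n, 'k) mpoly set). irreducible \<pi> \<longrightarrow> prime_wrt V \<pi>" and x: "x \<notin> V"
    and p: "irreducible p" "p \<in> polys_in (insert x V)" "wdeg {x} p > 0"
    and c: "c \<in> polys_in V" "c \<noteq> 0" and g: "g \<in> polys_in (insert x V)" "p dvd c * g"
  shows "p dvd g"
  using c g(2)
proof (induction "wdeg UNIV c" arbitrary: c rule: less_induct)
  case less
  show ?case
  proof (cases "c dvd 1")
    case True
    then obtain c' where "c * c' = 1" by (metis dvdE)
    then have g': "c' * (c * g) = g" by (simp add: mult.assoc[symmetric] mult.commute[of c' c])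
    show ?thesis using dvd_mult[OF less.prems(3), of c'] by (simp only: g')
  next
    case False
    then obtain \<pi> where \<pi>: "irreducible \<pi>" "\<pi> dvd c"
      using irreducible_factor_exists less.prems(2) by blast
    then obtain c' where c': "c = \<pi> * c'" by (auto simp: dvd_def)
    have A: "\<pi> \<in> polys_in V" "c' \<in> polys_in V" "\<pi> \<noteq> 0" "c' \<noteq> 0"
      using polys_in_factor[of \<pi> c' V] less.prems c' by auto
    obtain s where s: "c * g = p * s" using less.prems(3) by (auto simp: dvd_def)
    have \<pi>x: "wdeg {x} \<pi> = 0" using polys_in_whom_0[OF A(1) x] by (simp add: wdeg_eq_0_iff)
    have "p dvd c' * g"
    proof (cases "g = 0")
      case False
      have "c * g \<in> polys_in (insert x V)"
        using less.prems(1) g(1) polys_in_mono[of V "insert x V"] by (auto intro!: polys_in_mult)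
      moreover have "p * s \<noteq> 0" using s False less.prems(2) by (metis mult_eq_0_iff)
      ultimately have sB: "s \<in> polys_in (insert x V)"
        using polys_in_factor[of p s "insert x V"] s by simp
      have "\<pi> dvd p * s" using s c' by (metis dvd_triv_left mult.assoc)
      then have "\<pi> dvd p \<or> \<pi> dvd s"
        using prime_wrt_insert[OF A(1,3) IH[rule_format, OF A(1) \<pi>(1)] x] p(2) sB by (auto simp: prime_wrt_def)
      moreover have "\<not> \<pi> dvd p"
      proof
        assume "\<pi> dvd p"
        then obtain t where t: "p = \<pi> * t" by (auto simp: dvd_def)
        then have "t dvd 1" using p(1) \<pi>(1) by (auto simp: irreducible_def)
        then have "wdeg {x} t = 0" using wdeg_mono[of "{x}" UNIV t] by (simp add: is_unit_iff)
        then show False using p(1,3) t \<pi>x by (auto simp: wdeg_mult irreducible_def)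
      qed
      ultimately obtain s' where "s = \<pi> * s'" by (auto simp: dvd_def)
      then have "\<pi> * (c' * g) = \<pi> * (p * s')" using s c' by (simp add: ac_simps)
      then have "c' * g = p * s'" using A(3) by simp
      then show ?thesis by simp
    qed auto
    moreover have "wdeg UNIV c' < wdeg UNIV c"
      using c' A \<pi>(1) by (simp add: wdeg_mult) (simp add: irreducible_def is_unit_iff)
    ultimately show ?thesis using less.hyps A by blast
  qed
qed

text \<open>The irreducible factors of \<open>c\<close> are primes of k[V][x], so each can be
  removed from \<open>q\<close> or from \<open>h\<close>. Once \<open>c\<close> is a unit,
  irreducibility of \<open>p\<close> makes one of the two remaining factors a unit: either
  \<open>p\<close> divides what is left of \<open>h\<close>, or only factors free of
  \<open>x\<close> were ever present in \<open>h\<close>.\<close>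

lemma irreducible_dvd_or_const:
  fixes p :: "('n::{finite,linorder}, 'k::field) mpoly"
  assumes IH: "\<forall>\<pi>\<in>(polys_in V :: ('n, 'k) mpoly set). irreducible \<pi> \<longrightarrow> prime_wrt V \<pi>" and x: "x \<notin> V"
    and p: "irreducible p"
    and q: "q \<in> polys_in (insert x V)" and h: "h \<in> polys_in (insert x V)"
    and c: "c \<in> polys_in V" "c \<noteq> 0" and eq: "c * p = q * h"
  shows "p dvd h \<or> wdeg {x} h = 0"
  using c q h eq
proof (induction "wdeg UNIV c" arbitrary: c q h rule: less_induct)
  case less
  have p0: "p \<noteq> 0" using p by auto
  show ?case
  proof (cases "c dvd 1")
    case True
    then obtain c' where c': "c * c' = 1" by (metis dvdE)
    have "c' * (c * p) = c' * (q * h)" using less.prems(5) by simp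
    then have "p = (c' * q) * h" using c' by (simp add: mult.assoc[symmetric] mult.commute[of c' c])
    then have "c' * q dvd 1 \<or> h dvd 1" using p by (auto simp: irreducible_def)
    then show ?thesis
    proof
      assume "c' * q dvd 1"
      then obtain t where t: "c' * q * t = 1" by (metis dvdE)
      have "p * t = h * (c' * q * t)" by (subst \<open>p = (c' * q) * h\<close>) (simp only: ac_simps)
      then have "h = p * t" using t by simp
      then have "p dvd h" by simp
      then show ?thesis ..
    next
      assume "h dvd 1"
      then show ?thesis using wdeg_mono[of "{x}" UNIV h] by (simp add: is_unit_iff)
    qed
  next
    case False
    then obtain \<pi> where \<pi>: "irreducible \<pi>" "\<pi> dvd c"
      using irreducible_factor_exists less.prems(2) by blast
    then obtain c' where c': "c = \<pi> * c'" by (auto simp: dvd_def)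
    have A: "\<pi> \<in> polys_in V" "c' \<in> polys_in V" "\<pi> \<noteq> 0" "c' \<noteq> 0"
      using polys_in_factor[of \<pi> c' V] less.prems c' by auto
    have \<pi>x: "wdeg {x} \<pi> = 0" using polys_in_whom_0[OF A(1) x] by (simp add: wdeg_eq_0_iff)
    have deg: "wdeg UNIV c' < wdeg UNIV c"
      using c' A \<pi>(1) by (simp add: wdeg_mult) (simp add: irreducible_def is_unit_iff)
    have "\<pi> dvd q * h" using less.prems(5) c' by (metis dvd_triv_left mult.assoc)
    then have "\<pi> dvd q \<or> \<pi> dvd h"
      using prime_wrt_insert[OF A(1,3) IH[rule_format, OF A(1) \<pi>(1)] x] less.prems by (auto simp: prime_wrt_def)
    then show ?thesis
    proof
      assume "\<pi> dvd q"
      then obtain q' where q': "q = \<pi> * q'" by (auto simp: dvd_def)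
      have "\<pi> * (c' * p) = \<pi> * (q' * h)" using less.prems(5) c' q' by (simp add: ac_simps)
      then have e: "c' * p = q' * h" using A(3) by simp
      have "q' \<noteq> 0" using e A p0 by auto
      then have "q' \<in> polys_in (insert x V)"
        using polys_in_factor[of \<pi> q' "insert x V"] less.prems(3) q' A by auto
      then show ?thesis by (rule less.hyps[OF deg A(2,4) _ less.prems(4) e])
    next
      assume "\<pi> dvd h"
      then obtain h' where h': "h = \<pi> * h'" by (auto simp: dvd_def)
      have "\<pi> * (c' * p) = \<pi> * (q * h')" using less.prems(5) c' h' by (simp add: ac_simps)
      then have e: "c' * p = q * h'" using A(3) by simp
      have h'0: "h' \<noteq> 0" using e A p0 by auto
      then have "h' \<in> polys_in (insert x V)"
        using polys_in_factor[of \<pi> h' "insert x V"] less.prems(4) h' A by auto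
      then have "p dvd h' \<or> wdeg {x} h' = 0" by (rule less.hyps[OF deg A(2,4) less.prems(3) _ e])
      then show ?thesis using h' \<pi>x h'0 A(3) by (auto simp: wdeg_mult)
    qed
  qed
qed

text \<open>Take for \<open>h\<close> an element of least degree in \<open>x\<close> of the ideal \<open>(p, f)\<close>.\<close>

lemma minimal_combination:
  assumes x: "x \<notin> V" and p: "p \<in> polys_in (insert x V)" "p \<noteq> 0" and f: "f \<in> polys_in (insert x V)"
  obtains u v h where "u \<in> polys_in (insert x V)" "v \<in> polys_in (insert x V)" "h = u * p + v * f" "h \<noteq> 0"
    "h \<in> polys_in (insert x V)"
    "\<And>w. w \<in> {p, f} \<Longrightarrow> \<exists>c\<in>polys_in V - {0}. \<exists>q\<in>polys_in (insert x V). c * w = q * h"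
proof -
  let ?B = "polys_in (insert x V)"
  define M where "M = {u * p + v * f | u v. u \<in> ?B \<and> v \<in> ?B}"
  have MI: "u \<in> ?B \<Longrightarrow> v \<in> ?B \<Longrightarrow> u * p + v * f \<in> M" for u v by (auto simp: M_def)
  have pM: "p \<in> M" using MI[of 1 0] by simp
  have fM: "f \<in> M" using MI[of 0 1] by simp
  obtain h where h: "h \<in> M - {0}" "\<And>y. y \<in> M - {0} \<Longrightarrow> wdeg {x} h \<le> wdeg {x} y"
    using ex_has_least_nat[of "\<lambda>h. h \<in> M - {0}" p "wdeg {x}"] pM p(2) by auto
  then obtain u v where uv: "u \<in> ?B" "v \<in> ?B" "h = u * p + v * f" by (auto simp: M_def)
  have hB: "h \<in> ?B" using uv p f by (auto intro!: polys_in_add polys_in_mult)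
  have sub: "polys_in V \<subseteq> ?B" by (auto intro: polys_in_mono[of V "insert x V"])
  have "\<exists>c\<in>polys_in V - {0}. \<exists>q\<in>?B. c * w = q * h" if w: "w \<in> {p, f}" for w
  proof -
    have wB: "w \<in> ?B" using w p f by auto
    obtain c q r where c: "c \<in> polys_in V - {0}" "q \<in> ?B" "r \<in> ?B" "c * w = q * h + r"
        "r = 0 \<or> wdeg {x} r < wdeg {x} h"
      using pseudo_division[OF x hB _ wB] h(1) by blast
    obtain a b where ab: "a \<in> ?B" "b \<in> ?B" "w = a * p + b * f"
      using w pM fM by (auto simp: M_def)
    have "r = (c * a - q * u) * p + (c * b - q * v) * f"
      using c(4) uv(3) ab(3) by (simp add: algebra_simps)
    moreover have "c * a - q * u \<in> ?B" "c * b - q * v \<in> ?B"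
      using c ab uv sub by (auto intro!: polys_in_diff polys_in_mult)
    ultimately have "r \<in> M" using MI by auto
    then have "r = 0" using h(2)[of r] c(5) by (cases "r = 0") auto
    then show ?thesis using c by auto
  qed
  then show ?thesis using that[OF uv(1,2,3) _ hB] h(1) by blast
qed

text \<open>Induction on the variables, for a product f g divisible by \<open>p\<close>. Over the
  fraction field of k[V] the ideal of \<open>p\<close> and f would be generated by a gcd; the
  combination h of least degree in x plays this role up to denominators. If \<open>p\<close> divides
  h, it divides f; if h is free of x, then h g is a multiple of \<open>p\<close>, and h
  cancels.\<close>

lemma irreducible_prime_wrt:
  fixes V :: "'n::{finite,linorder} set" and p :: "('n, 'k::field) mpoly"
  assumes "p \<in> polys_in V" "irreducible p"
  shows "prime_wrt V p"
proof -
  have "finite V" by simp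
  then have "\<forall>p :: ('n, 'k) mpoly. p \<in> polys_in V \<longrightarrow> irreducible p \<longrightarrow> prime_wrt V p"
  proof (induction V rule: finite_induct)
    case empty
    have False if p: "p \<in> polys_in {}" "irreducible p" for p :: "('n, 'k) mpoly"
      using p by (auto simp: polys_in_wdeg irreducible_def is_unit_iff)
    then show ?case by blast
  next
    case (insert x V)
    let ?B = "polys_in (insert x V) :: ('n, 'k) mpoly set"
    have IH: "\<forall>\<pi>\<in>(polys_in V :: ('n, 'k) mpoly set). irreducible \<pi> \<longrightarrow> prime_wrt V \<pi>"
      using insert by blast
    have sub: "polys_in V \<subseteq> ?B" by (auto intro: polys_in_mono[of V "insert x V"])
    have "prime_wrt (insert x V) p" if p: "p \<in> ?B" "irreducible p" for p
    proof (cases "wdeg {x} p = 0")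
      case True
      then have "p \<in> polys_in V"
        using p polys_in_insert_whom_0 by (auto simp: wdeg_eq_0_iff)
      then show ?thesis using prime_wrt_insert[of p V x] IH p insert.hyps(2) by (metis not_irreducible_zero)
    next
      case False
      have p0: "p \<noteq> 0" using p by auto
      show ?thesis unfolding prime_wrt_def
      proof (intro ballI impI)
        fix f g assume fg: "f \<in> ?B" "g \<in> ?B" "p dvd f * g"
        obtain u v h where h: "u \<in> ?B" "v \<in> ?B" "h = u * p + v * f" "h \<noteq> 0" "h \<in> ?B"
          "\<And>w. w \<in> {p, f} \<Longrightarrow> \<exists>c\<in>polys_in V - {0}. \<exists>q\<in>?B. c * w = q * h"
          using minimal_combination[OF insert.hyps(2) p(1) p0 fg(1)] by metis
        obtain c q where c: "c \<in> polys_in V" "c \<noteq> 0" "q \<in> ?B" "c * p = q * h" using h(6)[of p] by auto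
        have "p dvd h \<or> wdeg {x} h = 0"
          using irreducible_dvd_or_const[OF IH insert.hyps(2) p(2) c(3) h(5) c(1,2,4)] by blast
        then show "p dvd f \<or> p dvd g"
        proof
          assume "p dvd h"
          obtain c' q' where c': "c' \<in> polys_in V" "c' \<noteq> 0" "c' * f = q' * h" using h(6)[of f] by auto
          then have "p dvd c' * f" using \<open>p dvd h\<close> by simp
          then have "p dvd f"
            using irreducible_dvd_cancel_const[OF IH insert.hyps(2) p(2,1) _ c'(1,2) fg(1)] False by simp
          then show ?thesis ..
        next
          assume "wdeg {x} h = 0"
          then have hV: "h \<in> polys_in V"
            using h(5) polys_in_insert_whom_0 by (auto simp: wdeg_eq_0_iff)
          have "h * g = p * (u * g) + v * (f * g)" by (simp add: h(3) algebra_simps)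
          then have "p dvd h * g" using fg(3) by simp
          then have "p dvd g"
            using irreducible_dvd_cancel_const[OF IH insert.hyps(2) p(2,1) _ hV h(4) fg(2)] False by simp
          then show ?thesis ..
        qed
      qed
    qed
    then show ?case by blast
  qed
  then show ?thesis using assms by simp
qed

theorem irreducible_imp_prime_mpoly:
  fixes p :: "('n::{finite,linorder}, 'k::field) mpoly"
  assumes "irreducible p"
  shows "prime_elem p"
proof (rule prime_elemI)
  show "p \<noteq> 0" "\<not> p dvd 1" using assms by (auto simp: irreducible_not_unit)
  show "p dvd a \<or> p dvd b" if "p dvd a * b" for a b
    using irreducible_prime_wrt[OF polys_in_UNIV assms] that by (simp add: prime_wrt_def)
qed

section \<open>Ideals and Noetherianity\<close>

text \<open>Type-class versions of ideals and primes keep computations in ordinary ring notation;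
  they are matched with \<open>ideal\<close> and \<open>primeideal\<close> later on.\<close>

definition is_ideal :: "'a::comm_ring_1 set \<Rightarrow> bool" where
  "is_ideal I \<longleftrightarrow> 0 \<in> I \<and> (\<forall>a\<in>I. \<forall>b\<in>I. a + b \<in> I) \<and> (\<forall>a\<in>I. \<forall>r. r * a \<in> I)"

definition is_prime :: "'a::comm_ring_1 set \<Rightarrow> bool" where
  "is_prime P \<longleftrightarrow> is_ideal P \<and> 1 \<notin> P \<and> (\<forall>a b. a * b \<in> P \<longrightarrow> a \<in> P \<or> b \<in> P)"

lemma is_idealD:
  assumes "is_ideal I"
  shows "0 \<in> I" "a \<in> I \<Longrightarrow> b \<in> I \<Longrightarrow> a + b \<in> I" "a \<in> I \<Longrightarrow> r * a \<in> I" "a \<in> I \<Longrightarrow> a * r \<in> I"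
    "a \<in> I \<Longrightarrow> - a \<in> I" "a \<in> I \<Longrightarrow> b \<in> I \<Longrightarrow> a - b \<in> I"
proof -
  show 0: "0 \<in> I" "a \<in> I \<Longrightarrow> b \<in> I \<Longrightarrow> a + b \<in> I" "a \<in> I \<Longrightarrow> r * a \<in> I" for a b r
    using assms by (auto simp: is_ideal_def)
  show "a \<in> I \<Longrightarrow> a * r \<in> I" using 0(3) by (simp add: mult.commute)
  show m: "a \<in> I \<Longrightarrow> - a \<in> I" for a using 0(3)[of a "-1"] by simp
  show "a \<in> I \<Longrightarrow> b \<in> I \<Longrightarrow> a - b \<in> I" using 0(2)[of a "- b"] m[of b] by simp
qed

lemma is_ideal_sum: "is_ideal I \<Longrightarrow> (\<And>x. x \<in> A \<Longrightarrow> f x \<in> I) \<Longrightarrow> sum f A \<in> I"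
  by (induction A rule: infinite_finite_induct) (auto intro: is_idealD)

lemma is_primeD:
  assumes "is_prime P"
  shows "is_ideal P" "1 \<notin> P" "a * b \<in> P \<Longrightarrow> a \<in> P \<or> b \<in> P"
  using assms by (auto simp: is_prime_def)

lemma is_prime_power: "is_prime P \<Longrightarrow> a ^ k \<in> P \<Longrightarrow> a \<in> P"
  by (induction k) (auto simp: is_prime_def)

lemma is_prime_unit: "is_prime P \<Longrightarrow> a dvd 1 \<Longrightarrow> a \<notin> P"
  unfolding is_prime_def is_ideal_def by (metis dvdE mult.commute)

lemma is_prime_zero: "is_prime {0 :: 'a::idom}"
  by (auto simp: is_prime_def is_ideal_def)

lemma is_prime_multiples:
  assumes "prime_elem (p :: 'a::idom)"
  shows "is_prime {r. p dvd r}"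
  using assms by (auto simp: is_prime_def is_ideal_def prime_elem_def)

lemma is_ideal_adjoin:
  assumes "is_ideal I"
  shows "is_ideal {i + r * a | i r. i \<in> I}" "I \<subseteq> {i + r * a | i r. i \<in> I}" "a \<in> {i + r * a | i r. i \<in> I}"
proof -
  show "is_ideal {i + r * a | i r. i \<in> I}"
    unfolding is_ideal_def
  proof (intro conjI ballI allI)
    have "0 = 0 + 0 * a" by simp
    then show "0 \<in> {i + r * a | i r. i \<in> I}" using is_idealD(1)[OF assms] by blast
  next
    fix x y assume "x \<in> {i + r * a | i r. i \<in> I}" "y \<in> {i + r * a | i r. i \<in> I}"
    then obtain i r j s where "x = i + r * a" "y = j + s * a" "i \<in> I" "j \<in> I" by auto
    moreover have "i + r * a + (j + s * a) = (i + j) + (r + s) * a" by (simp add: algebra_simps)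
    ultimately show "x + y \<in> {i + r * a | i r. i \<in> I}" using is_idealD(2)[OF assms] by blast
  next
    fix x t assume "x \<in> {i + r * a | i r. i \<in> I}"
    then obtain i r where "x = i + r * a" "i \<in> I" by auto
    moreover have "t * (i + r * a) = t * i + (t * r) * a" by (simp add: algebra_simps)
    ultimately show "t * x \<in> {i + r * a | i r. i \<in> I}" using is_idealD(3)[OF assms] by blast
  qed
  have "i = i + 0 * a" for i by simp
  then show "I \<subseteq> {i + r * a | i r. i \<in> I}" by blast
  have "a = 0 + 1 * a" by simp
  then show "a \<in> {i + r * a | i r. i \<in> I}" using is_idealD(1)[OF assms] by blast
qed

lemma is_ideal_colon: "is_ideal I \<Longrightarrow> is_ideal {r. r * a \<in> I}"
  by (auto simp: is_ideal_def distrib_right mult.assoc)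

subsection \<open>Dickson's lemma and the Hilbert basis theorem\<close>

text \<open>Some subsequence is monotone; if it is nonincreasing, it is constant from the place
  where it attains its minimum.\<close>

lemma nondecreasing_subseq_nat:
  fixes s :: "nat \<Rightarrow> nat"
  shows "\<exists>r :: nat \<Rightarrow> nat. strict_mono r \<and> (\<forall>i j. i \<le> j \<longrightarrow> s (r i) \<le> s (r j))"
proof -
  obtain r :: "nat \<Rightarrow> nat" where r: "strict_mono r" "monoseq (\<lambda>n. s (r n))"
    using seq_monosub[of s] by auto
  show ?thesis
  proof (cases "\<forall>m. \<forall>n\<ge>m. s (r m) \<le> s (r n)")
    case True
    then show ?thesis using r(1) by - (rule exI[of _ r], simp)
  next
    case False
    then have dec: "\<And>m n. m \<le> n \<Longrightarrow> s (r n) \<le> s (r m)" using r(2) by (auto simp: monoseq_def)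
    obtain N where N: "\<And>n. s (r N) \<le> s (r n)"
      using ex_has_least_nat[of "\<lambda>_. True" 0 "\<lambda>n. s (r n)"] by auto
    have "s (r (N + i)) = s (r N)" for i using N[of "N + i"] dec[of N "N + i"] by simp
    moreover have "strict_mono (\<lambda>i. r (N + i))" using r(1) by (auto simp: strict_mono_def)
    ultimately show ?thesis by - (rule exI[of _ "\<lambda>i. r (N + i)"], simp)
  qed
qed

text \<open>Dickson's lemma in sequence form: a nondecreasing subsequence is extracted for one
  variable after another, and monotonicity in the earlier variables survives each
  refinement.\<close>

lemma dickson_subseq:
  fixes s :: "nat \<Rightarrow> ('n::finite \<Rightarrow>\<^sub>0 nat)"
  shows "\<exists>r :: nat \<Rightarrow> nat. strict_mono r \<and> (\<forall>v. \<forall>i j. i \<le> j \<longrightarrow> Poly_Mapping.lookup (s (r i)) v \<le> Poly_Mapping.lookup (s (r j)) v)"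
proof -
  have "\<exists>r :: nat \<Rightarrow> nat. strict_mono r \<and> (\<forall>v\<in>V. \<forall>i j. i \<le> j \<longrightarrow>
      Poly_Mapping.lookup (s (r i)) v \<le> Poly_Mapping.lookup (s (r j)) v)" if "finite V" for V :: "'n set"
    using that
  proof (induction V rule: finite_induct)
    case empty
    show ?case by (intro exI[of _ "\<lambda>i. i"]) (simp add: strict_mono_def)
  next
    case (insert x V)
    then obtain r :: "nat \<Rightarrow> nat" where r: "strict_mono r" "\<And>v i j. v \<in> V \<Longrightarrow> i \<le> j \<Longrightarrow>
        Poly_Mapping.lookup (s (r i)) v \<le> Poly_Mapping.lookup (s (r j)) v" by blast
    obtain q :: "nat \<Rightarrow> nat" where q: "strict_mono q" "\<And>i j. i \<le> j \<Longrightarrow>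
        Poly_Mapping.lookup (s (r (q i))) x \<le> Poly_Mapping.lookup (s (r (q j))) x"
      using nondecreasing_subseq_nat[of "\<lambda>i. Poly_Mapping.lookup (s (r i)) x"] by blast
    have "strict_mono (\<lambda>i. r (q i))" using r(1) q(1) by (simp add: strict_mono_def)
    moreover have "i \<le> j \<Longrightarrow> q i \<le> q j" for i j
      using q(1) by (simp add: strict_mono_less_eq)
    ultimately show ?case using r(2) q(2) by - (rule exI[of _ "\<lambda>i. r (q i)"], auto)
  qed
  from this[of UNIV] show ?thesis by simp
qed

text \<open>The exponent sets of monomial ideals.\<close>

definition upclosed :: "('n \<Rightarrow>\<^sub>0 nat) set \<Rightarrow> bool" where
  "upclosed U \<longleftrightarrow> (\<forall>m\<in>U. \<forall>a. m + a \<in> U)"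

lemma upclosed_le:
  assumes "upclosed U" "a \<in> U" "\<And>i. Poly_Mapping.lookup a i \<le> Poly_Mapping.lookup b i"
  shows "b \<in> U"
proof -
  have "a + (b - a) = b"
    using assms(3) by (intro poly_mapping_eqI) (simp add: lookup_add lookup_minus)
  then show ?thesis using assms(1,2) by (metis upclosed_def)
qed

text \<open>From a chain that never stabilizes, a new monomial can be picked at each strict
  enlargement. By Dickson's lemma a later one is a multiple of an earlier one, so it was not
  new.\<close>

lemma upclosed_chain_stabilizes:
  fixes U :: "nat \<Rightarrow> ('n::finite \<Rightarrow>\<^sub>0 nat) set"
  assumes up: "\<And>i. upclosed (U i)" and inc: "\<And>i. U i \<subseteq> U (Suc i)"
  shows "\<exists>N. \<forall>i\<ge>N. U i = U N"
proof (rule ccontr)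
  assume n: "\<not> ?thesis"
  have mono: "i \<le> j \<Longrightarrow> U i \<subseteq> U j" for i j using inc lift_Suc_mono_le by blast
  have "\<exists>i>N. \<not> U i \<subseteq> U N" for N
  proof -
    obtain i where "i \<ge> N" "U i \<noteq> U N" using n by blast
    then have "i > N" "\<not> U i \<subseteq> U N" using mono[of N i] by (cases "i = N"; auto)+
    then show ?thesis by blast
  qed
  then obtain nxt where nxt: "\<And>N. nxt N > N" "\<And>N. \<not> U (nxt N) \<subseteq> U N" by metis
  define k where "k = rec_nat 0 (\<lambda>_. nxt)"
  have k: "k (Suc i) = nxt (k i)" for i by (simp add: k_def)
  then have kmono: "i \<le> j \<Longrightarrow> k i \<le> k j" for i j
    using nxt(1) by (metis lift_Suc_mono_le less_imp_le)
  have "\<forall>i. \<exists>y. y \<in> U (k (Suc i)) \<and> y \<notin> U (k i)" using nxt(2) k by auto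
  then obtain s where s: "\<And>i. s i \<in> U (k (Suc i))" "\<And>i. s i \<notin> U (k i)" by metis
  obtain r :: "nat \<Rightarrow> nat" where r: "strict_mono r" "\<And>v i j. i \<le> j \<Longrightarrow>
      Poly_Mapping.lookup (s (r i)) v \<le> Poly_Mapping.lookup (s (r j)) v"
    using dickson_subseq by blast
  have "s (r 1) \<in> U (k (Suc (r 0)))"
    using upclosed_le[OF up s(1)[of "r 0"]] r(2) by simp
  moreover have "Suc (r 0) \<le> r 1" using r(1) by (simp add: strict_mono_def Suc_le_eq)
  ultimately show False using mono[OF kmono] s(2)[of "r 1"] by blast
qed

text \<open>The order compares exponents at the first variable where two monomials differ. Listing
  the variables in increasing order embeds it into the lexicographic order on lists of a fixed
  length, which is well-founded.\<close>

lemma wf_monomials: "wf {(a, b :: 'n::{finite,linorder} \<Rightarrow>\<^sub>0 nat). a < b}"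
proof -
  define xs where "xs = sorted_list_of_set (UNIV :: 'n set)"
  have xs: "sorted xs" "set xs = UNIV" "distinct xs" by (simp_all add: xs_def)
  define F where "F = (\<lambda>m :: 'n \<Rightarrow>\<^sub>0 nat. map (Poly_Mapping.lookup m) xs)"
  have "(F a, F b) \<in> lexn less_than (length xs)" if ab: "a < b" for a b
  proof -
    obtain v where v: "Poly_Mapping.lookup a v < Poly_Mapping.lookup b v"
        "\<And>u. u < v \<Longrightarrow> Poly_Mapping.lookup a u = Poly_Mapping.lookup b u"
      using ab unfolding less_poly_mapping.rep_eq less_fun_def by blast
    obtain i where i: "i < length xs" "xs ! i = v" using xs(2) by (metis UNIV_I in_set_conv_nth)
    have "xs ! j < v" if "j < i" for j
      using xs(1,3) i that by (metis less_le order_less_trans nth_eq_iff_index_eq order_less_imp_le sorted_nth_mono)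
    then have eq: "take i (F a) = take i (F b)"
      using i v(2) by (intro nth_equalityI) (auto simp: F_def)
    have "F a = take i (F a) @ (F a ! i) # drop (Suc i) (F a)"
      using i by (intro id_take_nth_drop) (simp add: F_def)
    moreover have "F b = take i (F b) @ (F b ! i) # drop (Suc i) (F b)"
      using i by (intro id_take_nth_drop) (simp add: F_def)
    ultimately show ?thesis
      unfolding lexn_conv using eq i v(1) by (auto simp: F_def)
  qed
  then have "{(a, b). a < b} \<subseteq> inv_image (lexn less_than (length xs)) F" by auto
  then show ?thesis using wf_subset wf_inv_image wf_lexn wf_less_than by metis
qed

section \<open>Leading monomials and reduction\<close>

lemma single_eq_0_iff: "Poly_Mapping.single m c = 0 \<longleftrightarrow> c = 0"
  by (metis lookup_single_eq lookup_zero single_zero)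

text \<open>The order ignores the total degree, so the leading monomial of a non-homogeneous
  polynomial need not have top degree. For 0 the maximum is taken over the empty set, whence the
  guards \<open>f \<noteq> 0\<close>.\<close>

definition lm :: "('n::{finite,linorder}, 'k::field) mpoly \<Rightarrow> ('n \<Rightarrow>\<^sub>0 nat)" where
  "lm f = Max (Poly_Mapping.keys f)"

lemma lm_in_keys: "f \<noteq> 0 \<Longrightarrow> lm f \<in> Poly_Mapping.keys f"
  by (simp add: lm_def)

lemma lm_ge: "m \<in> Poly_Mapping.keys f \<Longrightarrow> m \<le> lm f"
  by (simp add: lm_def)

lemma lookup_single_mult:
  "Poly_Mapping.lookup (Poly_Mapping.single a c * f) (a + m) = c * Poly_Mapping.lookup f m"
  for f :: "('n::{finite,linorder}, 'k::field) mpoly"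
proof -
  have "Poly_Mapping.single a c * f
      = (\<Sum>b\<in>Poly_Mapping.keys f. Poly_Mapping.single (a + b) (c * Poly_Mapping.lookup f b))"
    by (subst poly_mapping_sum_single[of f]) (simp add: sum_distrib_left mult_single)
  then show ?thesis
    by (auto simp: lookup_sum lookup_single when_def sum.delta' in_keys_iff)
qed

lemma keys_single_mult:
  fixes f :: "('n::{finite,linorder}, 'k::field) mpoly"
  assumes "c \<noteq> 0"
  shows "Poly_Mapping.keys (Poly_Mapping.single a c * f) = (+) a ` Poly_Mapping.keys f"
proof
  show "Poly_Mapping.keys (Poly_Mapping.single a c * f) \<subseteq> (+) a ` Poly_Mapping.keys f"
    using keys_mult[of "Poly_Mapping.single a c" f] by (auto split: if_splits)
  show "(+) a ` Poly_Mapping.keys f \<subseteq> Poly_Mapping.keys (Poly_Mapping.single a c * f)"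
    using assms by (auto simp: in_keys_iff lookup_single_mult)
qed

lemma lm_single_mult:
  fixes f :: "('n::{finite,linorder}, 'k::field) mpoly"
  assumes "c \<noteq> 0" "f \<noteq> 0"
  shows "lm (Poly_Mapping.single a c * f) = a + lm f"
  unfolding lm_def keys_single_mult[OF assms(1)]
  using assms(2) by (intro mono_Max_commute[symmetric]) (auto simp: mono_def add_left_mono)

lemma lm_cancel:
  assumes "f \<noteq> 0" "g \<noteq> 0" "lm f = lm g"
  defines "c \<equiv> Poly_Mapping.lookup f (lm f) / Poly_Mapping.lookup g (lm g)"
  shows "f - const c * g = 0 \<or> lm (f - const c * g) < lm f"
proof (rule disjCI)
  let ?h = "f - const c * g"
  assume n: "\<not> lm ?h < lm f"
  show "?h = 0"
  proof (rule ccontr)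
    assume h: "?h \<noteq> 0"
    have l: "Poly_Mapping.lookup (const c * g) m = c * Poly_Mapping.lookup g m" for m
      using lookup_single_mult[of 0 c g m] by simp
    have "Poly_Mapping.lookup g (lm g) \<noteq> 0" using lm_in_keys[OF assms(2)] by (simp add: in_keys_iff)
    then have "Poly_Mapping.lookup ?h (lm f) = 0"
      using assms(3) by (simp add: lookup_minus l) (simp add: c_def)
    then have "lm ?h \<noteq> lm f" using lm_in_keys[OF h] by (auto simp: in_keys_iff)
    moreover have "lm ?h \<in> Poly_Mapping.keys f \<or> lm ?h \<in> Poly_Mapping.keys g"
      using lm_in_keys[OF h] by (auto simp: in_keys_iff lookup_minus l)
    then have "lm ?h \<le> lm f" using lm_ge assms(3) by metis
    ultimately show False using n by simp
  qed
qed

definition lms :: "('n::{finite,linorder}, 'k::field) mpoly set \<Rightarrow> ('n \<Rightarrow>\<^sub>0 nat) set" where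
  "lms I = lm ` (I - {0})"

lemma upclosed_lms: "is_ideal I \<Longrightarrow> upclosed (lms I)"
  for I :: "('n::{finite,linorder}, 'k::field) mpoly set"
  unfolding upclosed_def
proof (intro ballI allI)
  fix m a assume I: "is_ideal I" and "m \<in> lms I"
  then obtain f where f: "f \<in> I" "f \<noteq> 0" "m = lm f" by (auto simp: lms_def)
  then have "monom_of a * f \<in> I - {0}"
    using is_idealD(3)[OF I f(1)] single_eq_0_iff[of a "1 :: 'k"] by auto
  moreover have "lm (monom_of a * f) = m + a" using f lm_single_mult[of 1 f a] by (simp add: add.commute)
  ultimately show "m + a \<in> lms I"
    unfolding lms_def by (intro image_eqI[where x = "monom_of a * f"]) auto
qed

text \<open>0 has no meaningful leading monomial and counts as smaller than every nonzero
  polynomial.\<close>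

lemma lm_induct:
  fixes P :: "('n::{finite,linorder}, 'k::field) mpoly \<Rightarrow> bool"
  assumes "P 0" "\<And>f. f \<noteq> 0 \<Longrightarrow> (\<And>g. g = 0 \<or> lm g < lm f \<Longrightarrow> P g) \<Longrightarrow> P f"
  shows "P f"
proof (cases "f = 0")
  case False
  have "\<forall>f. f \<noteq> 0 \<longrightarrow> lm f = m \<longrightarrow> P f" for m
  proof (induction m rule: wf_induct_rule[OF wf_monomials])
    case (1 m)
    show ?case
    proof (intro allI impI)
      fix f :: "('n, 'k) mpoly" assume f: "f \<noteq> 0" "lm f = m"
      show "P f"
      proof (rule assms(2)[OF f(1)])
        fix g :: "('n, 'k) mpoly" assume g: "g = 0 \<or> lm g < lm f"
        show "P g"
          using 1[of "lm g"] f g assms(1) by (cases "g = 0") auto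
      qed
    qed
  qed
  then show ?thesis using False by simp
qed (simp add: assms(1))

global_interpretation mp: vector_space "\<lambda>(c :: 'k::field) f :: ('n::{finite,linorder}, 'k) mpoly. const c * f"
  by unfold_locales (simp_all add: distrib_left distrib_right single_add mult.assoc[symmetric] mult_single)

lemma subspace_ideal: "is_ideal I \<Longrightarrow> mp.subspace I"
  by (auto simp: mp.subspace_def is_ideal_def)

text \<open>Reduction: subtracting a multiple of an element of \<open>B\<close> with the same
  leading monomial lowers the leading monomial. Working with subspaces covers both whole ideals and
  their graded pieces.\<close>

lemma span_if_lms:
  fixes W :: "('n::{finite,linorder}, 'k::field) mpoly set"
  assumes W: "mp.subspace W" and B: "B \<subseteq> W" "0 \<notin> B" "lms W \<subseteq> lm ` B"
  shows "W \<subseteq> mp.span B"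
proof -
  have "f \<in> W \<longrightarrow> f \<in> mp.span B" for f
  proof (induction f rule: lm_induct)
    case (2 f)
    show ?case
    proof
      assume f: "f \<in> W"
      then have "lm f \<in> lms W" using 2(1) unfolding lms_def by simp
      then have "lm f \<in> lm ` B" using B(3) by (rule rev_subsetD)
      then obtain g where g: "lm f = lm g" "g \<in> B" by (rule imageE)
      have g0: "g \<noteq> 0" using g(2) B(2) by auto
      define c where "c = Poly_Mapping.lookup f (lm f) / Poly_Mapping.lookup g (lm g)"
      have gs: "const c * g \<in> mp.span B" using g(2) by (intro mp.span_scale mp.span_base)
      have "f - const c * g = 0 \<or> lm (f - const c * g) < lm f"
        using lm_cancel[OF 2(1) g0] g(1) by (simp add: c_def)
      then have "f - const c * g \<in> W \<longrightarrow> f - const c * g \<in> mp.span B" by (rule 2(2))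
      moreover have "f - const c * g \<in> W"
        using W f g(2) B(1) by (intro mp.subspace_diff mp.subspace_scale) auto
      ultimately have "f - const c * g + const c * g \<in> mp.span B" using gs by (intro mp.span_add) auto
      then show "f \<in> mp.span B" by simp
    qed
  qed (simp add: mp.span_zero)
  then show ?thesis by auto
qed

lemma ideal_eq_if_lms_eq:
  fixes I J :: "('n::{finite,linorder}, 'k::field) mpoly set"
  assumes I: "is_ideal I" and J: "is_ideal J" and sub: "I \<subseteq> J" "lms J \<subseteq> lms I"
  shows "I = J"
proof -
  have "J \<subseteq> mp.span (I - {0})"
    using sub by (intro span_if_lms[OF subspace_ideal[OF J]]) (auto simp: lms_def)
  also have "\<dots> \<subseteq> I" by (rule mp.span_minimal[OF _ subspace_ideal[OF I]]) auto
  finally show ?thesis using sub(1) by blast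
qed

text \<open>Hilbert's basis theorem as the ascending chain condition: along a strictly increasing
  chain of ideals the sets of leading monomials would increase strictly too, which Dickson's lemma
  forbids.\<close>

theorem wf_ideals:
  "wf {(J, I). is_ideal I \<and> is_ideal J \<and> I \<subset> (J :: ('n::{finite,linorder}, 'k::field) mpoly set)}"
  unfolding wf_iff_no_infinite_down_chain
proof
  assume "\<exists>C. \<forall>i. (C (Suc i), C i) \<in> {(J, I). is_ideal I \<and> is_ideal J \<and> I \<subset> (J :: ('n, 'k) mpoly set)}"
  then obtain C :: "nat \<Rightarrow> ('n, 'k) mpoly set" where
    C0: "\<forall>i. (C (Suc i), C i) \<in> {(J, I). is_ideal I \<and> is_ideal J \<and> I \<subset> J}" ..
  then have C: "\<And>i. is_ideal (C i)" "\<And>i. C i \<subset> C (Suc i)" by auto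
  have "\<And>i. lms (C i) \<subseteq> lms (C (Suc i))" using C(2) by (auto simp: lms_def)
  then have "\<exists>N. \<forall>i\<ge>N. lms (C i) = lms (C N)"
    by (intro upclosed_chain_stabilizes upclosed_lms C(1))
  then obtain N where N: "\<forall>i\<ge>N. lms (C i) = lms (C N)" ..
  have "lms (C (Suc N)) = lms (C N)" by (rule N[rule_format, OF le_SucI[OF order_refl]])
  then show False using ideal_eq_if_lms_eq[OF C(1) C(1), of N "Suc N"] C(2)[of N] by auto
qed

lemma maximal_ideal_exists:
  fixes \<I> :: "('n::{finite,linorder}, 'k::field) mpoly set set"
  assumes "I \<in> \<I>" "\<And>I. I \<in> \<I> \<Longrightarrow> is_ideal I"
  shows "\<exists>M\<in>\<I>. \<forall>J\<in>\<I>. M \<subseteq> J \<longrightarrow> J = M"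
proof -
  obtain M where M: "M \<in> \<I>" "\<forall>y. (y, M) \<in> {(J, I). is_ideal I \<and> is_ideal J \<and> I \<subset> J} \<longrightarrow> y \<notin> \<I>"
    using wf_ideals[unfolded wf_eq_minimal, rule_format, OF assms(1)] by (elim bexE)
  have "J = M" if J: "J \<in> \<I>" "M \<subseteq> J" for J
  proof (rule ccontr)
    assume "J \<noteq> M"
    then have "(J, M) \<in> {(J, I). is_ideal I \<and> is_ideal J \<and> I \<subset> J}"
      using J M(1) assms(2) by auto
    then show False using M(2) J(1) by simp
  qed
  then show ?thesis using M(1) by auto
qed

subsection \<open>Prime ideals\<close>

text \<open>An ideal maximal among those that contain \<open>I\<close> and avoid \<open>S\<close> is
  prime; it exists by the ascending chain condition.\<close>

lemma prime_disjoint_exists: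
  fixes I :: "('n::{finite,linorder}, 'k::field) mpoly set"
  assumes I: "is_ideal I" and S: "1 \<in> S" "\<And>a b. a \<in> S \<Longrightarrow> b \<in> S \<Longrightarrow> a * b \<in> S" and d: "I \<inter> S = {}"
  obtains P where "is_prime P" "I \<subseteq> P" "P \<inter> S = {}"
proof -
  define \<I> where "\<I> = {J. is_ideal J \<and> I \<subseteq> J \<and> J \<inter> S = {}}"
  have "I \<in> \<I>" "\<And>J. J \<in> \<I> \<Longrightarrow> is_ideal J" using I d by (simp_all add: \<I>_def)
  then have "\<exists>M\<in>\<I>. \<forall>J\<in>\<I>. M \<subseteq> J \<longrightarrow> J = M" by (rule maximal_ideal_exists)
  then obtain P where P: "P \<in> \<I>" "\<And>J. J \<in> \<I> \<Longrightarrow> P \<subseteq> J \<Longrightarrow> J = P" by metis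
  have iP: "is_ideal P" "I \<subseteq> P" "P \<inter> S = {}" using P(1) by (auto simp: \<I>_def)
  have meet: "\<exists>i r. i \<in> P \<and> i + r * a \<in> S" if "a \<notin> P" for a
  proof -
    define J where "J = {i + r * a | i r. i \<in> P}"
    have J: "is_ideal J" "P \<subseteq> J" "a \<in> J" unfolding J_def by (rule is_ideal_adjoin[OF iP(1)])+
    have "J \<notin> \<I>" using P(2)[OF _ J(2)] J(3) that by auto
    then have "J \<inter> S \<noteq> {}" using J(1,2) iP(2) by (simp add: \<I>_def)
    then show ?thesis unfolding J_def by auto
  qed
  have "a \<in> P \<or> b \<in> P" if ab: "a * b \<in> P" for a b
  proof (rule ccontr)
    assume "\<not> (a \<in> P \<or> b \<in> P)"
    then obtain i r j s where ir: "i \<in> P" "i + r * a \<in> S" "j \<in> P" "j + s * b \<in> S" using meet by metis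
    have "(i + r * a) * (j + s * b) = i * (j + s * b) + (r * a) * j + (r * s) * (a * b)"
      by (simp add: algebra_simps)
    also have "\<dots> \<in> P"
      by (rule is_idealD(2)[OF iP(1) is_idealD(2)[OF iP(1) is_idealD(4)[OF iP(1) ir(1)]
        is_idealD(3)[OF iP(1) ir(3)]] is_idealD(3)[OF iP(1) ab]])
    finally show False using S(2)[OF ir(2,4)] iP(3) by blast
  qed
  then have "is_prime P" using iP S(1) by (auto simp: is_prime_def)
  then show ?thesis by (rule that[OF _ iP(2,3)])
qed

text \<open>Noetherian induction: if a b lies in \<open>I\<close> with neither factor in
  \<open>I\<close>, every prime over \<open>I\<close> lies over I + (a) or over I + (b). The family
  may contain primes that are not minimal; it only has to offer one below each prime over
  \<open>I\<close>.\<close>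

lemma finitely_many_minimal_primes:
  fixes I :: "('n::{finite,linorder}, 'k::field) mpoly set"
  assumes "is_ideal I"
  shows "\<exists>\<F>. finite \<F> \<and> (\<forall>Q\<in>\<F>. is_prime Q \<and> I \<subseteq> Q) \<and> (\<forall>P. is_prime P \<and> I \<subseteq> P \<longrightarrow> (\<exists>Q\<in>\<F>. Q \<subseteq> P))"
  using assms
proof (induction I rule: wf_induct_rule[OF wf_ideals])
  case (1 I)
  consider "1 \<in> I" | "is_prime I" | a b where "a * b \<in> I" "a \<notin> I" "b \<notin> I"
    using 1(2) by (auto simp: is_prime_def)
  then show ?case
  proof cases
    case 1
    then have "\<not> (is_prime P \<and> I \<subseteq> P)" for P by (auto simp: is_prime_def)
    then show ?thesis by (rule_tac exI[of _ "{}"]) simp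
  next
    case 2
    then show ?thesis by (rule_tac exI[of _ "{I}"]) simp
  next
    case 3
    let ?J = "\<lambda>a. {i + r * a | i r. i \<in> I}"
    note J = is_ideal_adjoin[OF \<open>is_ideal I\<close>]
    have ex: "\<exists>\<F>. finite \<F> \<and> (\<forall>Q\<in>\<F>. is_prime Q \<and> ?J c \<subseteq> Q)
        \<and> (\<forall>P. is_prime P \<and> ?J c \<subseteq> P \<longrightarrow> (\<exists>Q\<in>\<F>. Q \<subseteq> P))" if "c \<notin> I" for c
    proof (rule "1.IH")
      show "(?J c, I) \<in> {(J, I). is_ideal I \<and> is_ideal J \<and> I \<subset> J}"
        using J(1)[of c] J(2)[of c] J(3)[of c] \<open>is_ideal I\<close> that by auto
    qed (rule J)
    from ex[OF 3(2)] obtain \<F>a where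
      a: "finite \<F>a" "\<forall>Q\<in>\<F>a. is_prime Q \<and> ?J a \<subseteq> Q" "\<forall>P. is_prime P \<and> ?J a \<subseteq> P \<longrightarrow> (\<exists>Q\<in>\<F>a. Q \<subseteq> P)"
      by (elim exE conjE)
    from ex[OF 3(3)] obtain \<F>b where
      b: "finite \<F>b" "\<forall>Q\<in>\<F>b. is_prime Q \<and> ?J b \<subseteq> Q" "\<forall>P. is_prime P \<and> ?J b \<subseteq> P \<longrightarrow> (\<exists>Q\<in>\<F>b. Q \<subseteq> P)"
      by (elim exE conjE)
    have "\<exists>Q\<in>\<F>a \<union> \<F>b. Q \<subseteq> P" if P: "is_prime P" "I \<subseteq> P" for P
    proof -
      have sub: "?J c \<subseteq> P" if "c \<in> P" for c
        using P(2) that is_idealD(2)[OF is_primeD(1)[OF P(1)]] is_idealD(3)[OF is_primeD(1)[OF P(1)]]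
        by auto
      have "a \<in> P \<or> b \<in> P" using P(2) 3(1) is_primeD(3)[OF P(1)] by auto
      then show ?thesis
      proof
        assume "a \<in> P"
        then have "\<exists>Q\<in>\<F>a. Q \<subseteq> P" using a(3) P(1) sub by simp
        then show ?thesis by auto
      next
        assume "b \<in> P"
        then have "\<exists>Q\<in>\<F>b. Q \<subseteq> P" using b(3) P(1) sub by simp
        then show ?thesis by auto
      qed
    qed
    moreover have "is_prime Q \<and> I \<subseteq> Q" if "Q \<in> \<F>a \<union> \<F>b" for Q
      using a(2) b(2) J(2)[of a] J(2)[of b] that by (auto dest!: bspec)
    moreover have "finite (\<F>a \<union> \<F>b)" using a(1) b(1) by simp
    ultimately show ?thesis by (rule_tac exI[of _ "\<F>a \<union> \<F>b"]) simp
  qed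
qed

text \<open>A maximal element among the annihilators \<open>(I : x)\<close> contained in \<open>P\<close> is \<open>P\<close> itself, because every
  element of \<open>P\<close> is nilpotent modulo \<open>I\<close> up to a factor outside \<open>P\<close>.\<close>

lemma minimal_prime_associated:
  fixes I :: "('n::{finite,linorder}, 'k::field) mpoly set"
  assumes I: "is_ideal I" and P: "is_prime P" "I \<subseteq> P"
    and min: "\<And>Q. is_prime Q \<Longrightarrow> I \<subseteq> Q \<Longrightarrow> Q \<subseteq> P \<Longrightarrow> Q = P"
  shows "\<exists>x. P = {r. r * x \<in> I}"
proof -
  let ?C = "\<lambda>x. {r. r * x \<in> I}"
  have nil: "\<exists>s k. s \<notin> P \<and> s * p ^ k \<in> I" if p: "p \<in> P" for p
  proof (rule ccontr)
    assume n: "\<not> ?thesis"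
    \<comment> \<open>A prime over \<open>I\<close> avoiding \<open>S\<close> would lie in
      \<open>P\<close> (exponent 0) and miss \<open>p\<close> (s = 1), against the minimality of
      \<open>P\<close>.\<close>
    define S where "S = {s * p ^ k | s k. s \<notin> P}"
    have "1 \<in> S" unfolding S_def
      by (rule CollectI, rule exI[of _ 1], rule exI[of _ 0]) (use P(1) in \<open>auto simp: is_prime_def\<close>)
    moreover have "a * b \<in> S" if ab: "a \<in> S" "b \<in> S" for a b
    proof -
      obtain s k where "a = s * p ^ k" "s \<notin> P" using ab(1) by (auto simp: S_def)
      moreover obtain t l where "b = t * p ^ l" "t \<notin> P" using ab(2) by (auto simp: S_def)
      ultimately have "a * b = (s * t) * p ^ (k + l)" "s * t \<notin> P"
        using P(1) by (auto simp: power_add is_prime_def)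
      then show ?thesis by (auto simp: S_def)
    qed
    moreover have "I \<inter> S = {}" using n by (auto simp: S_def)
    ultimately obtain Q where Q: "is_prime Q" "I \<subseteq> Q" "Q \<inter> S = {}"
      using prime_disjoint_exists[OF I, of S] by metis
    have inS: "s * p ^ k \<in> S" if "s \<notin> P" for s k using that by (auto simp: S_def)
    have "Q \<subseteq> P" using Q(3) inS[of _ 0] by auto
    then have "p \<in> Q" using min[OF Q(1,2)] p by simp
    moreover have "p \<in> S" using inS[of 1 1] P(1) by (simp add: is_prime_def)
    ultimately show False using Q(3) by blast
  qed
  define \<I> where "\<I> = {?C x | x. ?C x \<subseteq> P}"
  have "?C 1 \<in> \<I>" unfolding \<I>_def using P(2) by (intro CollectI exI[of _ 1]) auto
  moreover have "\<And>J. J \<in> \<I> \<Longrightarrow> is_ideal J" using is_ideal_colon[OF I] by (auto simp: \<I>_def)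
  ultimately have "\<exists>M\<in>\<I>. \<forall>J\<in>\<I>. M \<subseteq> J \<longrightarrow> J = M" by (rule maximal_ideal_exists)
  then obtain M where M: "M \<in> \<I>" "\<And>J. J \<in> \<I> \<Longrightarrow> M \<subseteq> J \<Longrightarrow> J = M" by metis
  obtain x where x: "M = ?C x" "?C x \<subseteq> P" using M(1) by (auto simp: \<I>_def)
  have "p \<in> ?C x" if p: "p \<in> P" for p
  proof -
    obtain s k where sk: "s \<notin> P" "s * p ^ k \<in> I" using nil[OF p] by blast
    have ex: "\<exists>k. \<not> ?C (p ^ k * x) \<subseteq> P"
    proof (intro exI notI)
      assume "?C (p ^ k * x) \<subseteq> P"
      moreover have "s \<in> ?C (p ^ k * x)"
        using is_idealD(4)[OF I sk(2), of x] by (simp add: mult.assoc)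
      ultimately show False using sk(1) by blast
    qed
    define k0 where "k0 = (LEAST k. \<not> ?C (p ^ k * x) \<subseteq> P)"
    have k0: "\<not> ?C (p ^ k0 * x) \<subseteq> P" "\<And>k. k < k0 \<Longrightarrow> ?C (p ^ k * x) \<subseteq> P"
      unfolding k0_def using LeastI_ex[OF ex] not_less_Least by blast+
    have "k0 \<noteq> 0" using k0(1) x(2) by (cases k0) auto
    then obtain j where j: "k0 = Suc j" using not0_implies_Suc by blast
    obtain t where t: "t * (p ^ k0 * x) \<in> I" "t \<notin> P" using k0(1) by blast
    \<comment> \<open>By the choice of \<open>k0\<close>, the annihilator of \<open>y\<close> modulo
      \<open>I\<close> is still inside \<open>P\<close>; it contains the maximal one, hence equals
      it, and \<open>p\<close> belongs to it because t p^k0 x lies in \<open>I\<close>.\<close>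
    define y where "y = t * (p ^ j * x)"
    have "?C y \<subseteq> P"
    proof
      fix r assume "r \<in> ?C y"
      then have "r * t \<in> ?C (p ^ j * x)" by (simp add: y_def mult.assoc)
      then show "r \<in> P" using k0(2)[of j] j t(2) P(1) by (auto simp: is_prime_def)
    qed
    then have "?C y \<in> \<I>" by (auto simp: \<I>_def)
    moreover have "M \<subseteq> ?C y"
    proof
      fix r assume "r \<in> M"
      then have "(t * p ^ j) * (r * x) \<in> I" using is_idealD(3)[OF I] x(1) by blast
      then show "r \<in> ?C y" by (simp add: y_def ac_simps)
    qed
    ultimately have "?C y = ?C x" using M(2) x(1) by metis
    moreover have "p \<in> ?C y" using t(1) j by (simp add: y_def ac_simps)
    ultimately show ?thesis by blast
  qed
  then show ?thesis using x(2) by blast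
qed

section \<open>Upper bounds for heights\<close>

definition prime_chain :: "(nat \<Rightarrow> 'a::comm_ring_1 set) \<Rightarrow> nat \<Rightarrow> bool" where
  "prime_chain C m \<longleftrightarrow> (\<forall>i\<le>m. is_prime (C i)) \<and> (\<forall>i<m. C i \<subset> C (Suc i))"

text \<open>An upper bound on heights without extended naturals; it holds vacuously when
  \<open>P\<close> is not prime.\<close>

definition height_le :: "'a::comm_ring_1 set \<Rightarrow> nat \<Rightarrow> bool" where
  "height_le P k \<longleftrightarrow> (\<forall>C m. prime_chain C m \<longrightarrow> C m = P \<longrightarrow> m \<le> k)"

text \<open>The growth of \<open>R/P\<close> is measured by ranks, with respect to the filtration by the largest
  exponent: its pieces are spanned by boxes of monomials, which are easily counted.\<close>

definition indep_mod :: "('n::{finite,linorder}, 'k::field) mpoly set \<Rightarrow> nat \<Rightarrow> nat \<Rightarrow> bool" where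
  "indep_mod P t N \<longleftrightarrow> (\<exists>B. finite B \<and> card B = N \<and> (\<forall>b\<in>B. \<forall>i. wdeg {i} b \<le> t) \<and>
     (\<forall>c. (\<Sum>b\<in>B. const (c b) * b) \<in> P \<longrightarrow> (\<forall>b\<in>B. c b = 0)))"

lemma indep_mod_0: "indep_mod P t 0"
  unfolding indep_mod_def by (rule exI[of _ "{}"]) simp

lemma indep_mod_mono: "indep_mod P t N \<Longrightarrow> t \<le> t' \<Longrightarrow> indep_mod P t' N"
  unfolding indep_mod_def
proof (elim exE conjE)
  fix B assume "finite B" "card B = N" "\<forall>b\<in>B. \<forall>i. wdeg {i} b \<le> t" "t \<le> t'"
    "\<forall>c. (\<Sum>b\<in>B. const (c b) * b) \<in> P \<longrightarrow> (\<forall>b\<in>B. c b = 0)"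
  then show "\<exists>B. finite B \<and> card B = N \<and> (\<forall>b\<in>B. \<forall>i. wdeg {i} b \<le> t')
      \<and> (\<forall>c. (\<Sum>b\<in>B. const (c b) * b) \<in> P \<longrightarrow> (\<forall>b\<in>B. c b = 0))"
    by (intro exI[of _ B]) (meson order_trans)
qed

text \<open>Multiplication by \<open>f\<close> embeds R/P into the kernel of R/P -> R/P', so ranks
  add. A relation is first read modulo \<open>P'\<close>, where the multiples of \<open>f\<close>
  vanish; what remains is \<open>f\<close> times a combination lying in \<open>P\<close>, and
  \<open>f\<close> cancels since \<open>P\<close> is prime.\<close>

lemma indep_mod_step:
  assumes P: "is_prime P" and P': "is_prime P'" "P \<subseteq> P'" and f: "f \<in> P'" "f \<notin> P" "\<And>i. wdeg {i} f \<le> D"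
    and N: "indep_mod P t N" and N': "indep_mod P' (t + D) N'"
  shows "indep_mod P (t + D) (N + N')"
proof -
  obtain B where B0: "finite B" "card B = N" "\<forall>b\<in>B. \<forall>i. wdeg {i} b \<le> t"
      "\<forall>c. (\<Sum>b\<in>B. const (c b) * b) \<in> P \<longrightarrow> (\<forall>b\<in>B. c b = 0)"
    using N unfolding indep_mod_def by (elim exE conjE)
  have B: "finite B" "card B = N" "\<And>b i. b \<in> B \<Longrightarrow> wdeg {i} b \<le> t"
      "\<And>c b. (\<Sum>b\<in>B. const (c b) * b) \<in> P \<Longrightarrow> b \<in> B \<Longrightarrow> c b = 0"
    using B0 by simp_all
  obtain B' where B'0: "finite B'" "card B' = N'" "\<forall>b\<in>B'. \<forall>i. wdeg {i} b \<le> t + D"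
      "\<forall>c. (\<Sum>b\<in>B'. const (c b) * b) \<in> P' \<longrightarrow> (\<forall>b\<in>B'. c b = 0)"
    using N' unfolding indep_mod_def by (elim exE conjE)
  have B': "finite B'" "card B' = N'" "\<And>b i. b \<in> B' \<Longrightarrow> wdeg {i} b \<le> t + D"
      "\<And>c b. (\<Sum>b\<in>B'. const (c b) * b) \<in> P' \<Longrightarrow> b \<in> B' \<Longrightarrow> c b = 0"
    using B'0 by simp_all
  note iP = is_primeD(1)[OF P] and iP' = is_primeD(1)[OF P'(1)]
  have f0: "f \<noteq> 0" using f(2) is_idealD(1)[OF iP] by auto
  have inj: "inj_on ((*) f) B" using f0 by (auto simp: inj_on_def)
  have disj: "B' \<inter> (*) f ` B = {}"
  proof (rule ccontr)
    assume "B' \<inter> (*) f ` B \<noteq> {}"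
    then obtain b where b: "f * b \<in> B'" by auto
    define c where "c = (\<lambda>x. if x = f * b then 1 else 0 :: 'b)"
    have "(\<Sum>x\<in>B'. const (c x) * x) = (\<Sum>x\<in>B'. if x = f * b then f * b else 0)"
      by (rule sum.cong) (auto simp: c_def)
    also have "\<dots> = f * b" using b B'(1) by simp
    also have "\<dots> \<in> P'" using f(1) iP' by (intro is_idealD(4))
    finally have "c (f * b) = 0" using b by (rule B'(4))
    then show False by (simp add: c_def)
  qed
  define U where "U = B' \<union> (*) f ` B"
  have "finite U" using B B' by (simp add: U_def)
  moreover have "card U = N + N'"
    using B(1,2) B'(1,2) disj card_image[OF inj] by (simp add: U_def card_Un_disjoint)
  moreover have "wdeg {i} b \<le> t + D" if "b \<in> U" for b i
  proof -
    have "wdeg {i} (f * x) \<le> t + D" if "x \<in> B" for x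
      using wdeg_mult_le[of "{i}" f x] B(3)[OF that, of i] f(3)[of i] by linarith
    then show ?thesis using that B'(3) by (auto simp: U_def)
  qed
  moreover have "c b = 0" if c: "(\<Sum>b\<in>U. const (c b) * b) \<in> P" and b: "b \<in> U" for c b
  proof -
    define S1 where "S1 = (\<Sum>b\<in>B'. const (c b) * b)"
    define S2 where "S2 = (\<Sum>b\<in>B. const (c (f * b)) * b)"
    have "(\<Sum>b\<in>U. const (c b) * b) = S1 + (\<Sum>b\<in>(*) f ` B. const (c b) * b)"
      unfolding U_def S1_def using B(1) B'(1) disj by (intro sum.union_disjoint) auto
    also have "(\<Sum>b\<in>(*) f ` B. const (c b) * b) = f * S2"
      unfolding S2_def by (subst sum.reindex[OF inj]) (simp add: sum_distrib_left ac_simps)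
    finally have S: "S1 + f * S2 \<in> P" using c by simp
    then have "S1 + f * S2 \<in> P'" using P'(2) by (rule rev_subsetD)
    then have "S1 + f * S2 - f * S2 \<in> P'" using f(1) iP' by (intro is_idealD(6)) (auto intro: is_idealD(4))
    then have c1: "c b = 0" if "b \<in> B'" for b using B'(4)[of c b] that by (simp add: S1_def)
    then have "S1 = 0" by (simp add: S1_def)
    then have "S2 \<in> P" using S P f(2) by (auto simp: is_prime_def)
    then have "c (f * b) = 0" if "b \<in> B" for b using B(4)[of "\<lambda>b. c (f * b)" b] that by (simp add: S2_def)
    then show ?thesis using c1 b by (auto simp: U_def)
  qed
  ultimately show ?thesis unfolding indep_mod_def by (intro exI[of _ U]) simp
qed

text \<open>The previous step is iterated t + 1 times. Each round costs a constant amount of degree,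
  that of some element of \<open>P'\<close> outside \<open>P\<close>, and adds (t + 1)^s independent
  elements; so the exponent rises by one.\<close>

lemma growth_step:
  fixes P P' :: "('n::{finite,linorder}, 'k::field) mpoly set"
  assumes P: "is_prime P" and P': "is_prime P'" "P \<subset> P'"
    and g: "\<And>t. indep_mod P' (a * (t + 1)) ((t + 1) ^ s)"
  shows "\<exists>a. \<forall>t. indep_mod P (a * (t + 1)) ((t + 1) ^ Suc s)"
proof -
  obtain f where f: "f \<in> P'" "f \<notin> P" using P'(2) by auto
  define D where "D = wdeg UNIV f"
  have D: "wdeg {i} f \<le> D" for i by (simp add: D_def wdeg_mono)
  have *: "indep_mod P (a * (t + 1) + j * D) (j * (t + 1) ^ s)" for t j
  proof (induction j)
    case (Suc j)
    have "indep_mod P' (a * (t + 1) + j * D + D) ((t + 1) ^ s)"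
      by (rule indep_mod_mono[OF g]) simp
    then have "indep_mod P (a * (t + 1) + j * D + D) (j * (t + 1) ^ s + (t + 1) ^ s)"
      using P'(2) by (intro indep_mod_step[OF P P'(1) _ f D Suc]) auto
    then show ?case by (simp add: algebra_simps)
  qed (simp add: indep_mod_0)
  have "indep_mod P ((a + D) * (t + 1)) ((t + 1) ^ Suc s)" for t
    using *[of t "t + 1"] by (simp add: algebra_simps)
  then show ?thesis by blast
qed

lemma growth_chain:
  fixes C :: "nat \<Rightarrow> ('n::{finite,linorder}, 'k::field) mpoly set"
  assumes C: "prime_chain C m" and g: "\<And>t. indep_mod (C m) (a * (t + 1)) ((t + 1) ^ s)" and "k \<le> m"
  shows "\<exists>a. \<forall>t. indep_mod (C (m - k)) (a * (t + 1)) ((t + 1) ^ (s + k))"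
  using \<open>k \<le> m\<close>
proof (induction k)
  case 0
  then show ?case using g by auto
next
  case (Suc k)
  then obtain a where a: "\<And>t. indep_mod (C (m - k)) (a * (t + 1)) ((t + 1) ^ (s + k))" by auto
  have e: "m - k = Suc (m - Suc k)" using Suc.prems by simp
  have p: "is_prime (C (m - Suc k))" "is_prime (C (m - k))" using C by (simp_all add: prime_chain_def)
  have "m - Suc k < m" using Suc.prems by simp
  then have "C (m - Suc k) \<subset> C (Suc (m - Suc k))" using C unfolding prime_chain_def by simp
  then have "C (m - Suc k) \<subset> C (m - k)" unfolding e .
  from growth_step[OF p this a] show ?case by (simp only: add_Suc_right)
qed

section \<open>Ranks of polynomial subrings and upper bounds for heights\<close>

lemma box_monomials:
  fixes A :: "'n::finite \<Rightarrow> nat set"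
  assumes "\<And>i. finite (A i)"
  shows "finite {m. \<forall>i. Poly_Mapping.lookup m i \<in> A i}"
    and "card {m. \<forall>i. Poly_Mapping.lookup m i \<in> A i} = (\<Prod>i\<in>UNIV. card (A i))"
proof -
  let ?M = "{m. \<forall>i. Poly_Mapping.lookup m i \<in> A i}"
  have "bij_betw Poly_Mapping.lookup ?M (PiE UNIV A)"
    by (rule bij_betwI[where g = Abs_poly_mapping]) (auto simp: poly_mapping_eqI)
  moreover have "finite (PiE UNIV A)" using assms by (intro finite_PiE) auto
  ultimately show "finite ?M" "card ?M = (\<Prod>i\<in>UNIV. card (A i))"
    by (simp_all add: bij_betw_finite bij_betw_same_card[of _ ?M] card_PiE)
qed

lemma mpoly_in_span_monomials: "Poly_Mapping.keys f \<subseteq> M \<Longrightarrow> f \<in> mp.span (monom_of ` M)"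
proof -
  assume M: "Poly_Mapping.keys f \<subseteq> M"
  have "(\<Sum>m\<in>Poly_Mapping.keys f. const (Poly_Mapping.lookup f m) * monom_of m) \<in> mp.span (monom_of ` M)"
    using M by (intro mp.span_sum mp.span_scale mp.span_base) auto
  then show ?thesis using poly_mapping_sum_single[of f] by (simp add: mult_single)
qed

lemma lookup_sum_monomials:
  assumes "finite M" "m \<in> M"
  shows "Poly_Mapping.lookup (\<Sum>m\<in>M. const (c m) * monom_of m) m = c m"
  using assms by (simp add: mult_single lookup_sum lookup_single when_def sum.delta')

lemma inj_monom_of: "inj_on (monom_of :: _ \<Rightarrow> ('n::{finite,linorder}, 'k::field) mpoly) M"
  by (rule inj_onI) (metis keys_single singleton_inject zero_neq_one)

lemma indep_mod_bound:
  fixes P :: "('n::{finite,linorder}, 'k::field) mpoly set"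
  assumes "indep_mod P t N" "0 \<in> P"
  shows "N \<le> (t + 1) ^ CARD('n)"
proof -
  obtain B where B0: "finite B" "card B = N" "\<forall>b\<in>B. \<forall>i. wdeg {i} b \<le> t"
      "\<forall>c. (\<Sum>b\<in>B. const (c b) * b) \<in> P \<longrightarrow> (\<forall>b\<in>B. c b = 0)"
    using assms(1) unfolding indep_mod_def by (elim exE conjE)
  have B: "finite B" "card B = N" "\<And>b i. b \<in> B \<Longrightarrow> wdeg {i} b \<le> t"
      "\<And>c b. (\<Sum>b\<in>B. const (c b) * b) \<in> P \<Longrightarrow> b \<in> B \<Longrightarrow> c b = 0"
    using B0 by simp_all
  define M where "M = {m :: 'n \<Rightarrow>\<^sub>0 nat. \<forall>i. Poly_Mapping.lookup m i \<in> {..t}}"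
  have M: "finite M" "card M = (t + 1) ^ CARD('n)"
    unfolding M_def using box_monomials[of "\<lambda>i :: 'n. {..t}"] by simp_all
  have "mp.independent B"
    using B(1) by (rule mp.independent_if_scalars_zero) (use B(4) assms(2) in auto)
  moreover have "B \<subseteq> mp.span (monom_of ` M)"
  proof
    fix b assume b: "b \<in> B"
    have "Poly_Mapping.keys b \<subseteq> M"
      using B(3)[OF b] by (auto simp: M_def wdeg_le_iff)
    then show "b \<in> mp.span (monom_of ` M)" by (rule mpoly_in_span_monomials)
  qed
  ultimately have "card B \<le> card (monom_of ` M :: ('n, 'k) mpoly set)"
    using mp.independent_span_bound[of "monom_of ` M" B] M(1) by simp
  also have "\<dots> \<le> card M" using M(1) by (rule card_image_le)
  finally show ?thesis using B(2) M(2) by simp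
qed

lemma indep_mod_polys_in:
  fixes P :: "('n::{finite,linorder}, 'k::field) mpoly set"
  assumes "P \<inter> polys_in T = {0}"
  shows "indep_mod P t ((t + 1) ^ card T)"
proof -
  define A where "A = (\<lambda>i. if i \<in> T then {..t} else {0})"
  define M where "M = {m :: 'n \<Rightarrow>\<^sub>0 nat. \<forall>i. Poly_Mapping.lookup m i \<in> A i}"
  have "card M = (\<Prod>i\<in>UNIV. card (A i))" "finite M"
    unfolding M_def by (rule box_monomials; simp add: A_def)+
  moreover have "(\<Prod>i\<in>UNIV. card (A i)) = (\<Prod>i\<in>T. t + 1)"
    by (rule prod.mono_neutral_cong_right) (auto simp: A_def)
  ultimately have M: "card M = (t + 1) ^ card T" "finite M" by simp_all
  define B where "B = (monom_of ` M :: ('n, 'k) mpoly set)"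
  have "finite B" "card B = (t + 1) ^ card T"
    using M card_image[OF inj_monom_of, of M] by (simp_all add: B_def)
  moreover have "wdeg {i} b \<le> t" if "b \<in> B" for b i
    using that by (auto simp: B_def M_def A_def wdeg_le_iff split: if_splits)
  moreover have "c b = 0" if c: "(\<Sum>b\<in>B. const (c b) * b) \<in> P" and b: "b \<in> B" for c b
  proof -
    have "(\<Sum>b\<in>B. const (c b) * b) = (\<Sum>m\<in>M. const (c (monom_of m)) * monom_of m)"
      unfolding B_def by (subst sum.reindex[OF inj_monom_of]) simp
    moreover have "\<dots> \<in> polys_in T"
      unfolding polys_in_def
    proof (rule whom_sum)
      fix m assume "m \<in> M"
      then have "wt (- T) m = 0" by (auto simp: wt_eq_0_iff M_def A_def split: if_splits)
      then show "const (c (monom_of m)) * monom_of m \<in> whom (- T) 0" by (simp add: mult_single)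
    qed
    ultimately have 0: "(\<Sum>m\<in>M. const (c (monom_of m)) * monom_of m) = 0" using c assms by auto
    obtain m where m: "m \<in> M" "b = monom_of m" using b by (auto simp: B_def)
    then show ?thesis
      using lookup_sum_monomials[OF M(2) m(1), of "\<lambda>m. c (monom_of m)"] unfolding 0 by simp
  qed
  ultimately show ?thesis unfolding indep_mod_def by (intro exI[of _ B]) simp
qed

text \<open>R/P grows at least with exponent |T|, and a chain of length m below \<open>P\<close>
  raises this to |T| + m at its bottom, while the whole ring grows with exponent n only.\<close>

theorem height_le_of_trivial_intersection:
  fixes P :: "('n::{finite,linorder}, 'k::field) mpoly set"
  assumes "P \<inter> polys_in T = {0}"
  shows "height_le P (CARD('n) - card T)"
  unfolding height_le_def
proof (intro allI impI)
  fix C m assume C: "prime_chain C m" "C m = P"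
  have "indep_mod (C m) (1 * (t + 1)) ((t + 1) ^ card T)" for t
    using indep_mod_mono[OF indep_mod_polys_in[OF assms, of t], of "1 * (t + 1)"] C(2) by simp
  from growth_chain[OF C(1) this, of m] obtain a where
    a: "\<And>t. indep_mod (C 0) (a * (t + 1)) ((t + 1) ^ (card T + m))" by auto
  have "0 \<in> C 0" using C(1) is_idealD(1) is_primeD(1) unfolding prime_chain_def by blast
  then have le: "(t + 1) ^ (card T + m) \<le> (a * (t + 1) + 1) ^ CARD('n)" for t
    using indep_mod_bound[OF a] by blast
  have "card T + m \<le> CARD('n)"
  proof (rule ccontr)
    assume n: "\<not> ?thesis"
    \<comment> \<open>With this value (t + 1)^(n + 1) exceeds (a + 1)^n (t + 1)^n, the bound that n
      variables allow.\<close>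
    define t where "t = (a + 1) ^ CARD('n)"
    have "(t + 1) ^ Suc CARD('n) \<le> (t + 1) ^ (card T + m)" using n by (intro power_increasing) auto
    also have "\<dots> \<le> (a * (t + 1) + 1) ^ CARD('n)" by (rule le)
    also have "\<dots> \<le> ((a + 1) * (t + 1)) ^ CARD('n)" by (intro power_mono) auto
    also have "\<dots> = t * (t + 1) ^ CARD('n)" by (simp only: power_mult_distrib t_def)
    finally show False by simp
  qed
  then show "m \<le> CARD('n) - card T" by simp
qed

text \<open>The nonzero elements of k[T] form a multiplicative set; a prime over \<open>I\<close>
  avoiding it again meets k[T] only in 0.\<close>

lemma prime_above_trivial_intersection:
  fixes I :: "('n::{finite,linorder}, 'k::field) mpoly set"
  assumes I: "is_ideal I" "I \<inter> polys_in T = {0}"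
  shows "\<exists>P. is_prime P \<and> I \<subseteq> P \<and> height_le P (CARD('n) - card T)"
proof -
  have "I \<inter> (polys_in T - {0}) = {}" using I(2) by auto
  moreover have "1 \<in> polys_in T - {0 :: ('n, 'k) mpoly}" by simp
  moreover have "a * b \<in> polys_in T - {0}" if "a \<in> polys_in T - {0}" "b \<in> polys_in T - {0}"
    for a b :: "('n, 'k) mpoly" using that polys_in_mult by auto
  ultimately obtain P where P: "is_prime P" "I \<subseteq> P" "P \<inter> (polys_in T - {0}) = {}"
    using prime_disjoint_exists[OF I(1), of "polys_in T - {0}"] by metis
  have "P \<inter> polys_in T = {0}" using P(3) is_idealD(1)[OF is_primeD(1)[OF P(1)]] by auto
  then have "height_le P (CARD('n) - card T)" by (rule height_le_of_trivial_intersection)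
  then show ?thesis using P by (intro exI[of _ P] conjI)
qed

lemma independent_monomials:
  assumes "finite M"
  shows "mp.independent (monom_of ` M :: ('n::{finite,linorder}, 'k::field) mpoly set)"
proof (rule mp.independent_if_scalars_zero)
  fix c :: "('n, 'k) mpoly \<Rightarrow> 'k" and x :: "('n, 'k) mpoly"
  assume 0: "(\<Sum>x\<in>monom_of ` M. const (c x) * x) = 0" and x: "x \<in> monom_of ` M"
  have "(\<Sum>x\<in>monom_of ` M. const (c x) * x) = (\<Sum>m\<in>M. const (c (monom_of m)) * monom_of m)"
    by (subst sum.reindex[OF inj_monom_of]) simp
  then have 1: "(\<Sum>m\<in>M. const (c (monom_of m)) * monom_of m) = 0" using 0 by simp
  obtain m where m: "m \<in> M" "x = monom_of m" using x by auto
  show "c x = 0"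
    using lookup_sum_monomials[OF assms m(1), of "\<lambda>m. c (monom_of m)"] m(2) unfolding 1 by simp
qed (use assms in simp)

lemma prime_chain_extend:
  assumes "prime_chain C m" "is_prime P" "C m \<subset> P"
  shows "prime_chain (C(Suc m := P)) (Suc m)" "(C(Suc m := P)) (Suc m) = P"
  using assms by (auto simp: prime_chain_def le_Suc_eq less_Suc_eq)

lemma height_le_transport:
  fixes \<phi> \<psi> :: "'a::comm_ring_1 \<Rightarrow> 'a"
  assumes hom: "\<And>a b. \<psi> (a + b) = \<psi> a + \<psi> b" "\<And>a b. \<psi> (a * b) = \<psi> a * \<psi> b" "\<psi> 1 = 1" "\<psi> 0 = 0"
    and inv: "\<And>a. \<psi> (\<phi> a) = a" "\<And>a. \<phi> (\<psi> a) = a" and P: "height_le P k"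
  shows "height_le (\<phi> -` P) k"
  unfolding height_le_def
proof (intro allI impI)
  fix C m assume C: "prime_chain C m" "C m = \<phi> -` P"
  have "is_prime (\<psi> -` Q)" if "is_prime Q" for Q
    using that hom by (auto simp: is_prime_def is_ideal_def)
  moreover have "\<psi> -` Q \<subset> \<psi> -` Q'" if QQ: "Q \<subset> Q'" for Q Q'
  proof -
    obtain x where x: "x \<in> Q'" "x \<notin> Q" using QQ by auto
    then have "\<phi> x \<in> \<psi> -` Q'" "\<phi> x \<notin> \<psi> -` Q" using inv by auto
    then show ?thesis using QQ by auto
  qed
  ultimately have "prime_chain (\<lambda>i. \<psi> -` C i) m" using C(1) by (simp add: prime_chain_def)
  moreover have "\<psi> -` C m = P" unfolding C(2) using inv by auto
  ultimately show "m \<le> k" using P unfolding height_le_def by blast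
qed

section \<open>Substitution and linear changes of coordinates\<close>

definition mev :: "('n \<Rightarrow> ('n::{finite,linorder}, 'k::field) mpoly) \<Rightarrow> ('n \<Rightarrow>\<^sub>0 nat) \<Rightarrow> ('n, 'k) mpoly" where
  "mev \<sigma> m = (\<Prod>i\<in>UNIV. \<sigma> i ^ Poly_Mapping.lookup m i)"

definition psubst :: "('n \<Rightarrow> ('n::{finite,linorder}, 'k::field) mpoly) \<Rightarrow> ('n, 'k) mpoly \<Rightarrow> ('n, 'k) mpoly" where
  "psubst \<sigma> f = (\<Sum>m\<in>Poly_Mapping.keys f. const (Poly_Mapping.lookup f m) * mev \<sigma> m)"

lemma mev_add: "mev \<sigma> (a + b) = mev \<sigma> a * mev \<sigma> b"
  by (simp add: mev_def lookup_add power_add prod.distrib)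

lemma mev_0 [simp]: "mev \<sigma> 0 = 1"
  by (simp add: mev_def)

lemma mev_single [simp]: "mev \<sigma> (Poly_Mapping.single i k) = \<sigma> i ^ k"
proof -
  have "mev \<sigma> (Poly_Mapping.single i k) = (\<Prod>j\<in>UNIV. if j = i then \<sigma> i ^ k else 1)"
    unfolding mev_def by (rule prod.cong) (auto simp: lookup_single)
  then show ?thesis by simp
qed

lemma psubst_superset:
  assumes "finite A" "Poly_Mapping.keys f \<subseteq> A"
  shows "psubst \<sigma> f = (\<Sum>m\<in>A. const (Poly_Mapping.lookup f m) * mev \<sigma> m)"
  unfolding psubst_def using assms by (intro sum.mono_neutral_left) (auto simp: in_keys_iff)

lemma psubst_add: "psubst \<sigma> (f + g) = psubst \<sigma> f + psubst \<sigma> g"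
proof -
  define A where "A = Poly_Mapping.keys f \<union> Poly_Mapping.keys g"
  have A: "finite A" "Poly_Mapping.keys f \<subseteq> A" "Poly_Mapping.keys g \<subseteq> A" "Poly_Mapping.keys (f + g) \<subseteq> A"
    using Poly_Mapping.keys_add[of f g] by (auto simp: A_def)
  show ?thesis
    unfolding psubst_superset[OF A(1,2)] psubst_superset[OF A(1,3)] psubst_superset[OF A(1,4)]
    by (simp add: lookup_add single_add distrib_right sum.distrib)
qed

lemma psubst_zero [simp]: "psubst \<sigma> 0 = 0"
  by (simp add: psubst_def)

lemma psubst_single: "psubst \<sigma> (Poly_Mapping.single m c) = const c * mev \<sigma> m"
  by (simp add: psubst_def)

lemma psubst_const [simp]: "psubst \<sigma> (const c) = const c"
  by (simp add: psubst_single)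

lemma psubst_one [simp]: "psubst \<sigma> 1 = 1"
  using psubst_const[of \<sigma> 1] by simp

lemma psubst_var [simp]: "psubst \<sigma> (var i) = \<sigma> i"
  by (simp add: var_def psubst_single)

lemma psubst_sum: "psubst \<sigma> (sum f A) = (\<Sum>x\<in>A. psubst \<sigma> (f x))"
  by (induction A rule: infinite_finite_induct) (auto simp: psubst_add)

lemma psubst_mult: "psubst \<sigma> (f * g) = psubst \<sigma> f * psubst \<sigma> g"
proof -
  have 1: "psubst \<sigma> (Poly_Mapping.single m c * Poly_Mapping.single m' c')
      = psubst \<sigma> (Poly_Mapping.single m c) * psubst \<sigma> (Poly_Mapping.single m' c')" for m m' c c'
    by (subst mult_single) (simp only: psubst_single mev_add const_mult[symmetric] ac_simps)
  have 2: "psubst \<sigma> (Poly_Mapping.single m c * g) = psubst \<sigma> (Poly_Mapping.single m c) * psubst \<sigma> g" for m c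
  proof -
    have "psubst \<sigma> (Poly_Mapping.single m c *
        (\<Sum>m\<in>Poly_Mapping.keys g. Poly_Mapping.single m (Poly_Mapping.lookup g m)))
      = psubst \<sigma> (Poly_Mapping.single m c) *
        psubst \<sigma> (\<Sum>m\<in>Poly_Mapping.keys g. Poly_Mapping.single m (Poly_Mapping.lookup g m))"
      by (simp only: sum_distrib_left psubst_sum 1)
    then show ?thesis by (simp only: poly_mapping_sum_single[symmetric])
  qed
  have "psubst \<sigma> ((\<Sum>m\<in>Poly_Mapping.keys f. Poly_Mapping.single m (Poly_Mapping.lookup f m)) * g)
      = psubst \<sigma> (\<Sum>m\<in>Poly_Mapping.keys f. Poly_Mapping.single m (Poly_Mapping.lookup f m)) * psubst \<sigma> g"
    by (simp only: sum_distrib_right psubst_sum 2)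
  then show ?thesis by (simp only: poly_mapping_sum_single[symmetric])
qed

lemma psubst_power: "psubst \<sigma> (f ^ k) = psubst \<sigma> f ^ k"
  by (induction k) (auto simp: psubst_mult)

lemma psubst_prod: "psubst \<sigma> (prod f A) = (\<Prod>x\<in>A. psubst \<sigma> (f x))"
  by (induction A rule: infinite_finite_induct) (auto simp: psubst_mult)

lemma psubst_uminus: "psubst \<sigma> (- f) = - psubst \<sigma> f"
  using psubst_add[of \<sigma> f "- f"] by (simp add: eq_neg_iff_add_eq_0 add.commute)

lemma psubst_diff: "psubst \<sigma> (f - g) = psubst \<sigma> f - psubst \<sigma> g"
  using psubst_add[of \<sigma> f "- g"] by (simp add: psubst_uminus)

lemma psubst_psubst: "psubst \<tau> (psubst \<sigma> f) = psubst (\<lambda>i. psubst \<tau> (\<sigma> i)) f"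
  unfolding psubst_def[of \<sigma> f] psubst_def[of "\<lambda>i. psubst \<tau> (\<sigma> i)" f]
  by (simp add: psubst_sum psubst_mult mev_def psubst_prod psubst_power)

lemma mev_var: "mev var m = (monom_of m :: ('n::{finite,linorder}, 'k::field) mpoly)"
proof -
  have 1: "(\<Prod>i\<in>A. monom_of (a i)) = (monom_of (\<Sum>i\<in>A. a i) :: ('n, 'k) mpoly)"
    for A :: "'n set" and a
    by (induction A rule: infinite_finite_induct) (auto simp: mult_single)
  have "(\<Sum>i\<in>UNIV. Poly_Mapping.single i (Poly_Mapping.lookup m i)) = m"
    by (rule poly_mapping_eqI) (simp add: lookup_sum lookup_single when_def)
  then show ?thesis by (simp add: mev_def var_power 1)
qed

lemma psubst_id: "psubst var f = f"
  unfolding psubst_def mev_var by (simp add: mult_single) (rule poly_mapping_sum_single[symmetric])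

lemma whom_prod: "(\<And>x. x \<in> A \<Longrightarrow> f x \<in> whom T (w x)) \<Longrightarrow> finite A \<Longrightarrow> prod f A \<in> whom T (sum w A)"
proof (induction A rule: infinite_finite_induct)
  case (insert x A)
  have "f x * prod f A \<in> whom T (w x + sum w A)" using insert by (intro whom_mult) auto
  then show ?case using insert by simp
qed auto

lemma psubst_forms:
  assumes "\<And>i. \<sigma> i \<in> whom UNIV 1" "f \<in> forms D"
  shows "psubst \<sigma> f \<in> forms D"
  unfolding forms_eq_whom psubst_def
proof (rule whom_sum)
  fix m assume m: "m \<in> Poly_Mapping.keys f"
  have "mev \<sigma> m \<in> whom UNIV (\<Sum>i\<in>UNIV. Poly_Mapping.lookup m i * 1)"
    unfolding mev_def by (intro whom_prod whom_power assms(1)) auto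
  then have "mev \<sigma> m \<in> whom UNIV D"
    using assms(2) m by (auto simp: forms_eq_whom whom_def wt_def)
  then show "const (Poly_Mapping.lookup f m) * mev \<sigma> m \<in> whom UNIV D"
    using whom_mult[of "const (Poly_Mapping.lookup f m)" UNIV 0 "mev \<sigma> m" D] by simp
qed

lemma psubst_cong_polys_in:
  assumes "f \<in> polys_in V" "\<And>i. i \<in> V \<Longrightarrow> \<sigma> i = \<tau> i"
  shows "psubst \<sigma> f = psubst \<tau> f"
  unfolding psubst_def mev_def
proof (intro sum.cong refl arg_cong2[of _ _ _ _ "(*)"] prod.cong)
  fix m i assume m: "m \<in> Poly_Mapping.keys f"
  show "\<sigma> i ^ Poly_Mapping.lookup m i = \<tau> i ^ Poly_Mapping.lookup m i"
    using assms(2) polys_in_keys[OF assms(1) m] by (cases "i \<in> V") auto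
qed

text \<open>Induction on the variables: at a point where the top coefficient in the new variable
  survives, \<open>f\<close> becomes a nonzero univariate polynomial, whose finitely many roots miss
  some scalar. Values are constant polynomials, so the roots are counted in the polynomial ring, a
  domain.\<close>

lemma exists_nonvanishing_point:
  fixes f :: "('n::{finite,linorder}, 'k::field_char_0) mpoly"
  assumes "f \<noteq> 0"
  shows "\<exists>q. psubst (\<lambda>i. const (q i)) f \<noteq> 0"
proof -
  have "finite V \<Longrightarrow> \<forall>f :: ('n, 'k) mpoly. f \<in> polys_in V \<longrightarrow> f \<noteq> 0 \<longrightarrow> (\<exists>q. psubst (\<lambda>i. const (q i)) f \<noteq> 0)" for V
  proof (induction V rule: finite_induct)
    case empty
    then show ?case by (auto simp: polys_in_empty)
  next
    case (insert x V)
    have "\<exists>q. psubst (\<lambda>i. const (q i)) f \<noteq> 0" if f: "f \<in> polys_in (insert x V)" "f \<noteq> 0" for f :: "('n, 'k) mpoly"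
    proof -
      obtain c where c: "\<And>i. c i \<in> polys_in V" "\<And>i. hcomp {x} i f = var x ^ i * c i"
        using hcomp_var_factor[OF f(1)] by metis
      define j where "j = wdeg {x} f"
      have "c j \<noteq> 0" using hcomp_wdeg_nonzero[OF f(2), of "{x}"] c(2)[of j] by (auto simp: j_def)
      then obtain q where q: "psubst (\<lambda>i. const (q i)) (c j) \<noteq> 0" using insert.IH c(1) by blast
      define e where "e = (\<lambda>i. psubst (\<lambda>i. const (q i)) (c i))"
      define p where "p = (\<Sum>i\<le>j. Polynomial.monom (e i) i)"
      have "Polynomial.coeff p j = e j"
        unfolding p_def by (simp add: Polynomial.coeff_sum)
      then have "p \<noteq> 0" using q by (auto simp: e_def)
      then have "finite {y. poly p y = 0}" by (rule poly_roots_finite)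
      moreover have "infinite (range (const :: 'k \<Rightarrow> ('n, 'k) mpoly))"
      proof -
        have "inj (const :: 'k \<Rightarrow> ('n, 'k) mpoly)" by (rule injI) (metis lookup_single_eq)
        then show ?thesis using infinite_UNIV_char_0 finite_imageD by blast
      qed
      ultimately have "\<not> range (const :: 'k \<Rightarrow> ('n, 'k) mpoly) \<subseteq> {y. poly p y = 0}"
        using finite_subset by metis
      then obtain t :: 'k where t: "poly p (const t) \<noteq> 0" by auto
      define q' where "q' = q(x := t)"
      have ec: "psubst (\<lambda>i. const (q' i)) (c i) = e i" for i
        unfolding e_def by (rule psubst_cong_polys_in[OF c(1)]) (use insert.hyps(2) in \<open>auto simp: q'_def\<close>)
      have "psubst (\<lambda>i. const (q' i)) f = psubst (\<lambda>i. const (q' i)) (\<Sum>i\<le>j. var x ^ i * c i)"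
        using sum_hcomp_atMost[of "{x}" f] by (simp add: c(2) j_def)
      also have "\<dots> = (\<Sum>i\<le>j. const t ^ i * e i)"
        by (simp add: psubst_sum psubst_mult psubst_power ec) (simp add: q'_def)
      also have "\<dots> = poly p (const t)" by (simp add: p_def poly_sum poly_monom mult.commute)
      finally show ?thesis using t by metis
    qed
    then show ?case by blast
  qed
  from this[of UNIV] show ?thesis using assms by simp
qed

text \<open>At a point q with f(q) nonzero, the change of coordinates moves the unit vector of
  \<open>x\<close> to q; the coefficient of x^D in the transformed form is then f(q).\<close>

lemma linear_change_monic:
  fixes f :: "('n::{finite,linorder}, 'k::field_char_0) mpoly"
  assumes f: "f \<in> forms D" "f \<noteq> 0" and D: "D > 0"
  shows "\<exists>x \<sigma> \<tau>. (\<forall>g. psubst \<sigma> (psubst \<tau> g) = g) \<and> (\<forall>g. psubst \<tau> (psubst \<sigma> g) = g)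
    \<and> psubst \<sigma> f \<in> forms D \<and> psubst \<sigma> f \<noteq> 0 \<and> wdeg {x} (psubst \<sigma> f) = D"
proof -
  obtain q where q: "psubst (\<lambda>i. const (q i)) f \<noteq> 0" using exists_nonvanishing_point[OF f(2)] by blast
  \<comment> \<open>Otherwise q is the origin, where a form of positive degree vanishes.\<close>
  have "\<exists>x. q x \<noteq> 0"
  proof (rule ccontr)
    assume "\<nexists>x. q x \<noteq> 0"
    then have q0: "(\<lambda>i. const (q i)) = (\<lambda>i. 0 :: ('n, 'k) mpoly)" by auto
    have "mev (\<lambda>i. 0 :: ('n, 'k) mpoly) m = 0" if "m \<in> Poly_Mapping.keys f" for m
    proof -
      have "wt UNIV m \<noteq> 0" using that f(1) D by (auto simp: forms_eq_whom whom_def)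
      then obtain i where "Poly_Mapping.lookup m i \<noteq> 0" by (auto simp: wt_eq_0_iff)
      then show ?thesis unfolding mev_def by (intro prod_zero) (auto intro: exI[of _ i])
    qed
    then show False using q unfolding q0 psubst_def by simp
  qed
  then obtain x where x: "q x \<noteq> 0" ..
  define \<sigma> where "\<sigma> = (\<lambda>i. if i = x then const (q x) * var x else var i + const (q i) * var x)"
  define \<tau> where "\<tau> = (\<lambda>i. if i = x then const (1 / q x) * var x else var i - const (q i / q x) * var x)"
  have "psubst \<sigma> (\<tau> i) = var i" for i
    using x by (simp add: \<sigma>_def \<tau>_def psubst_mult psubst_diff mult.assoc[symmetric] const_mult)
  moreover have "psubst \<tau> (\<sigma> i) = var i" for i
    using x by (simp add: \<sigma>_def \<tau>_def psubst_mult psubst_add mult.assoc[symmetric] const_mult)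
  ultimately have inv: "psubst \<sigma> (psubst \<tau> g) = g" "psubst \<tau> (psubst \<sigma> g) = g" for g
    by (simp_all add: psubst_psubst psubst_id)
  have v1: "(var i :: ('n, 'k) mpoly) \<in> whom UNIV 1" for i using var_whom[of i UNIV] by simp
  have c1: "const c * (var i :: ('n, 'k) mpoly) \<in> whom UNIV 1" for c i
    using whom_mult[OF whom_const v1, of c i] by simp
  have \<sigma>1: "\<sigma> i \<in> whom UNIV 1" for i
    using whom_add[OF v1 c1] c1 by (simp add: \<sigma>_def)
  have F: "psubst \<sigma> f \<in> forms D" using psubst_forms[OF \<sigma>1 f(1)] .
  have F0: "psubst \<sigma> f \<noteq> 0" using inv(2)[of f] f(2) by auto
  \<comment> \<open>Setting all variables except \<open>x\<close> to 0 isolates the term in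
    x^D.\<close>
  define \<rho> where "\<rho> = (\<lambda>i. if i = x then var x else (0 :: ('n, 'k) mpoly))"
  have "psubst \<rho> (\<sigma> i) = const (q i) * var x" for i
    by (simp add: \<sigma>_def \<rho>_def psubst_mult psubst_add)
  then have "psubst \<rho> (psubst \<sigma> f) = psubst (\<lambda>i. const (q i) * var x) f"
    by (simp add: psubst_psubst)
  also have "\<dots> = psubst (\<lambda>i. const (q i)) f * var x ^ D"
    unfolding psubst_def sum_distrib_right
  proof (rule sum.cong[OF refl])
    fix m assume m: "m \<in> Poly_Mapping.keys f"
    then have "(\<Sum>i\<in>UNIV. Poly_Mapping.lookup m i) = D" using f(1) by (auto simp: forms_eq_whom whom_def wt_def)
    then have "mev (\<lambda>i. const (q i) * var x) m = mev (\<lambda>i. const (q i)) m * var x ^ D"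
      by (simp add: mev_def power_mult_distrib prod.distrib power_sum[symmetric])
    then show "const (Poly_Mapping.lookup f m) * mev (\<lambda>i. const (q i) * var x) m
      = const (Poly_Mapping.lookup f m) * mev (\<lambda>i. const (q i)) m * var x ^ D" by (simp add: mult.assoc)
  qed
  finally have nz: "psubst \<rho> (psubst \<sigma> f) \<noteq> 0" using q by simp
  have "wdeg {x} (psubst \<sigma> f) = D"
  proof (rule ccontr)
    assume "wdeg {x} (psubst \<sigma> f) \<noteq> D"
    moreover have "wdeg {x} (psubst \<sigma> f) \<le> wdeg UNIV (psubst \<sigma> f)" by (rule wdeg_mono) simp
    moreover have "wdeg UNIV (psubst \<sigma> f) = D" using F F0 by (simp add: forms_eq_whom wdeg_whom)
    ultimately have lt: "wdeg {x} (psubst \<sigma> f) < D" by simp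
    have "mev \<rho> m = 0" if m: "m \<in> Poly_Mapping.keys (psubst \<sigma> f)" for m
    proof -
      have "wt {x} m < D" using wt_le_wdeg[OF m, of "{x}"] lt by linarith
      moreover have "wt UNIV m = D" using F m by (auto simp: forms_eq_whom whom_def)
      moreover have "wt UNIV m = wt {x} m + wt (- {x}) m"
        unfolding wt_def by (subst sum.union_disjoint[symmetric]) (auto intro: sum.cong)
      ultimately have "wt (- {x}) m \<noteq> 0" by linarith
      then obtain i where i: "i \<noteq> x" "Poly_Mapping.lookup m i \<noteq> 0" by (auto simp: wt_eq_0_iff)
      then have "\<rho> i ^ Poly_Mapping.lookup m i = 0" by (simp add: \<rho>_def)
      then show ?thesis unfolding mev_def by (intro prod_zero) auto
    qed
    then show False using nz by (simp add: psubst_def[of \<rho>])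
  qed
  then show ?thesis using inv F F0 by blast
qed

text \<open>The coefficient of x^D in a form of degree \<open>D\<close> has degree 0, hence is a
  unit, so division needs no denominators.\<close>

lemma monic_division:
  fixes f :: "('n::{finite,linorder}, 'k::field) mpoly"
  assumes f: "f \<in> forms D" "f \<noteq> 0" "wdeg {x} f = D"
  shows "\<exists>q s. r = q * f + s \<and> (s = 0 \<or> wdeg {x} s < D)"
proof -
  obtain c where c: "hcomp {x} D f = var x ^ D * c" "c \<in> whom {x} 0"
    using whom_var_factor[OF hcomp_whom] by blast
  have "hcomp {x} D f \<noteq> 0" using hcomp_wdeg_nonzero[OF f(2), of "{x}"] f(3) by simp
  then have c0: "c \<noteq> 0" using c(1) by auto
  have vD: "var x ^ D \<in> whom UNIV D" by (simp add: var_power wt_UNIV mdeg_def lookup_single when_def)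
  have "hcomp {x} D f \<in> whom UNIV D" using f(1) hcomp_whom_other by (simp add: forms_eq_whom)
  then have "c \<in> whom UNIV (D - D)" using whom_factor[OF _ vD, of c D] c(1) by simp
  then have "c dvd 1" using is_unit_whom_0 c0 by simp
  then obtain c' where c': "c * c' = 1" by (metis dvdE)
  have c'0: "c' \<in> whom {x} 0" using whom_factor[of c c' "{x}" 0 0] c' c(2) c0 by simp
  show ?thesis
  proof (induction "wdeg {x} r" arbitrary: r rule: less_induct)
    case less
    show ?case
    proof (cases "r = 0 \<or> wdeg {x} r < D")
      case True
      then show ?thesis by (intro exI[of _ 0] exI[of _ r]) simp
    next
      case False
      define e where "e = wdeg {x} r"
      have e: "r \<noteq> 0" "D \<le> e" using False by (auto simp: e_def)
      obtain b where b: "hcomp {x} e r = var x ^ e * b" "b \<in> whom {x} 0"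
        using whom_var_factor[OF hcomp_whom] by blast
      define q0 where "q0 = c' * var x ^ (e - D) * b"
      have q0: "q0 \<in> whom {x} (e - D)"
        using whom_mult[OF whom_mult[OF c'0, of "var x ^ (e - D)" "e - D"] b(2)]
        by (simp add: q0_def var_power)
      define r1 where "r1 = r - q0 * f"
      have deg: "wdeg {x} r1 < e" if r1: "r1 \<noteq> 0"
      proof -
        have "wdeg {x} q0 \<le> e - D" using wdeg_whom[OF q0] by (cases "q0 = 0") auto
        then have "wdeg {x} (q0 * f) \<le> e" using wdeg_mult_le[of "{x}" q0 f] f(3) e(2) by simp
        then have "wdeg {x} r1 \<le> e"
          using wdeg_diff_le[of "{x}" r "q0 * f"] by (simp add: r1_def e_def)
        moreover have "hcomp {x} e r1 = hcomp {x} e r - q0 * hcomp {x} D f"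
          using hcomp_mult_whom[OF q0, of e f] e(2) by (simp add: r1_def hcomp_diff)
        then have "hcomp {x} e r1 = var x ^ e * b - (c * c') * (var x ^ (e - D) * var x ^ D) * b"
          by (simp only: b(1) c(1) q0_def ac_simps)
        then have "hcomp {x} e r1 = 0" using e(2) c' by (simp flip: power_add)
        then have "wdeg {x} r1 \<noteq> e" using hcomp_wdeg_nonzero[OF r1, of "{x}"] by auto
        ultimately show ?thesis by simp
      qed
      have "\<exists>q s. r1 = q * f + s \<and> (s = 0 \<or> wdeg {x} s < D)"
      proof (cases "r1 = 0")
        case True
        then show ?thesis by (intro exI[of _ 0]) simp
      next
        case False
        then show ?thesis using less[of r1] deg by (simp add: e_def)
      qed
      then obtain q s where qs: "r1 = q * f + s" "s = 0 \<or> wdeg {x} s < D" by blast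
      have "r = (q + q0) * f + s" using qs(1) by (simp add: r1_def algebra_simps)
      then show ?thesis using qs(2) by blast
    qed
  qed
qed

section \<open>Unmixedness in codimension two\<close>

lemma irreducible_factor_pos_degree:
  fixes h :: "('n::{finite,linorder}, 'k::field) mpoly"
  assumes "wdeg {x} h > 0"
  shows "\<exists>p. irreducible p \<and> p dvd h \<and> wdeg {x} p > 0"
  using assms
proof (induction "wdeg UNIV h" arbitrary: h rule: less_induct)
  case less
  have h0: "h \<noteq> 0" using less.prems by auto
  have nu: "\<not> h dvd 1" using less.prems wdeg_mono[of "{x}" UNIV h] by (simp add: is_unit_iff)
  show ?case
  proof (cases "irreducible h")
    case True
    then show ?thesis using less.prems by auto
  next
    case False
    then obtain a b where ab: "h = a * b" "\<not> a dvd 1" "\<not> b dvd 1"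
      using h0 nu by (auto simp: irreducible_def)
    have nz: "a \<noteq> 0" "b \<noteq> 0" using ab h0 by auto
    have lt: "wdeg UNIV a < wdeg UNIV h" "wdeg UNIV b < wdeg UNIV h"
      using ab nz by (auto simp: wdeg_mult is_unit_iff)
    have "wdeg {x} a > 0 \<or> wdeg {x} b > 0" using less.prems ab nz by (auto simp: wdeg_mult)
    then show ?thesis
    proof
      assume "wdeg {x} a > 0"
      then obtain p where "irreducible p" "p dvd a" "wdeg {x} p > 0" using less.hyps[OF lt(1)] by blast
      then show ?thesis using ab(1) by auto
    next
      assume "wdeg {x} b > 0"
      then obtain p where "irreducible p" "p dvd b" "wdeg {x} p > 0" using less.hyps[OF lt(2)] by blast
      then show ?thesis using ab(1) by auto
    qed
  qed
qed

text \<open>The elements e with \<open>h\<close> dividing e w form the ideal generated by h / gcd(h,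
  w), a nonunit, and any irreducible factor of it serves. It is found by removing common irreducible
  factors until a factor of \<open>h\<close> does not divide \<open>w\<close>.\<close>

lemma irreducible_dvd_denominator:
  fixes h w :: "('n::{finite,linorder}, 'k::field) mpoly"
  assumes "h \<noteq> 0" "\<not> h dvd w"
  shows "\<exists>\<delta>. irreducible \<delta> \<and> \<delta> dvd h \<and> (\<forall>e. h dvd e * w \<longrightarrow> \<delta> dvd e)"
  using assms
proof (induction "wdeg UNIV h" arbitrary: h w rule: less_induct)
  case less
  have "\<not> h dvd 1" using less.prems(2) dvd_trans one_dvd by blast
  then obtain \<pi> where \<pi>: "irreducible \<pi>" "\<pi> dvd h" using irreducible_factor_exists less.prems(1) by blast
  then obtain h' where h': "h = \<pi> * h'" by (auto simp: dvd_def)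
  have nz: "\<pi> \<noteq> 0" "h' \<noteq> 0" using h' less.prems(1) by auto
  have pr: "prime_elem \<pi>" using irreducible_imp_prime_mpoly[OF \<pi>(1)] .
  show ?case
  proof (cases "\<pi> dvd w")
    case False
    have "\<pi> dvd e" if "h dvd e * w" for e
    proof -
      have "\<pi> dvd e * w" using \<pi>(2) that by (rule dvd_trans)
      then show ?thesis using pr False by (simp add: prime_elem_dvd_mult_iff)
    qed
    then show ?thesis using \<pi> by blast
  next
    case True
    then obtain w' where w': "w = \<pi> * w'" by (auto simp: dvd_def)
    have "\<not> h' dvd w'" using less.prems(2) h' w' nz by simp
    moreover have "wdeg UNIV h' < wdeg UNIV h"
      using h' nz \<pi>(1) by (simp add: wdeg_mult) (simp add: irreducible_def is_unit_iff)
    ultimately obtain \<delta> where \<delta>: "irreducible \<delta>" "\<delta> dvd h'" "\<And>e. h' dvd e * w' \<Longrightarrow> \<delta> dvd e"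
      using less.hyps nz by blast
    have "h' dvd e * w'" if "h dvd e * w" for e
    proof -
      have "\<pi> * h' dvd \<pi> * (e * w')" using that h' w' by (simp add: ac_simps)
      then show ?thesis using nz by simp
    qed
    then show ?thesis using \<delta> h' by auto
  qed
qed

text \<open>Let A be the ring of polynomials free of \<open>x\<close> and K its fraction field. As
  \<open>f1\<close> is monic in \<open>x\<close> up to a unit, R/(f1) is free over A, and
  coprimality makes \<open>f2\<close> invertible in K[x]/(f1): some nonzero h = u f1 + v f2 lies in
  A. Thus a / f2 is represented by w / h, where w is the remainder of a v modulo \<open>f1\<close>,
  and \<open>a\<close> lies in (f1, f2) exactly when h divides w. The elements of A that carry
  \<open>a\<close> into (f1, f2) are the denominators of w / h.\<close>

lemma unmixed_monic:
  fixes f1 f2 f3 a :: "('n::{finite,linorder}, 'k::field) mpoly"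
  assumes f1: "f1 \<in> forms D" "f1 \<noteq> 0" "wdeg {x} f1 = D"
    and cop: "\<And>p. p dvd f1 \<Longrightarrow> p dvd f2 \<Longrightarrow> p dvd 1"
    and rel: "f3 * a = \<alpha> * f1 + \<beta> * f2" and nrel: "\<And>\<alpha> \<beta>. a \<noteq> \<alpha> * f1 + \<beta> * f2"
  shows "\<exists>P. is_prime P \<and> f1 \<in> P \<and> f2 \<in> P \<and> f3 \<in> P \<and> height_le P 2"
proof -
  define A where "A = (polys_in (- {x}) :: ('n, 'k) mpoly set)"
  have U: "insert x (- {x}) = UNIV" by auto
  have A_iff: "g \<in> A \<longleftrightarrow> wdeg {x} g = 0" for g by (simp add: A_def polys_in_wdeg)
  have "x \<notin> - {x}" by simp
  then obtain u v h where h: "h = u * f1 + v * f2" "h \<noteq> 0"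
    "\<And>w. w \<in> {f1, f2} \<Longrightarrow> \<exists>c\<in>A - {0}. \<exists>q\<in>UNIV. c * w = q * h"
    using minimal_combination[of x "- {x}" f1 f2, unfolded U, OF _ polys_in_UNIV f1(2) polys_in_UNIV]
    unfolding A_def by (metis UNIV_I)
  \<comment> \<open>An irreducible factor of \<open>h\<close> of positive degree in \<open>x\<close>
    would divide \<open>f1\<close> and \<open>f2\<close>, since the denominators \<open>c\<close>
    are free of \<open>x\<close>.\<close>
  have hA: "h \<in> A"
  proof (rule ccontr)
    assume "h \<notin> A"
    then have "wdeg {x} h > 0" by (simp add: A_iff)
    then obtain p where p: "irreducible p" "p dvd h" "wdeg {x} p > 0"
      using irreducible_factor_pos_degree by blast
    have "p dvd w" if w: "w \<in> {f1, f2}" for w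
    proof -
      obtain c q where c: "c \<in> A - {0}" "c * w = q * h" using h(3)[OF w] by auto
      have "p dvd c * w" unfolding c(2) using p(2) by (rule dvd_mult)
      moreover have "\<not> p dvd c"
        using wdeg_dvd_le[of p c "{x}"] c(1) p(3) by (auto simp: A_iff)
      ultimately show ?thesis
        using irreducible_imp_prime_mpoly[OF p(1)] by (simp add: prime_elem_dvd_mult_iff)
    qed
    then have "p dvd 1" using cop by simp
    then show False using p(1) irreducible_not_unit by blast
  qed
  \<comment> \<open>A multiple of \<open>f1\<close> of degree below \<open>D\<close> in
    \<open>x\<close> is 0: remainders are unique.\<close>
  have small: "y = 0" if y: "f1 dvd y" "y = 0 \<or> wdeg {x} y < D" for y
    using wdeg_dvd_le[OF y(1), of "{x}"] y(2) f1(3) by (cases "y = 0") auto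
  have degh: "g * h = 0 \<or> wdeg {x} (g * h) < D" "h * g = 0 \<or> wdeg {x} (h * g) < D"
    if "g = 0 \<or> wdeg {x} g < D" "h \<in> A" for g h
    using that wdeg_mult_le[of "{x}" g h] wdeg_mult_le[of "{x}" h g] by (auto simp: A_iff)
  \<comment> \<open>Being free of \<open>x\<close>, the element \<open>h\<close> is not a zero
    divisor modulo \<open>f1\<close>.\<close>
  have cancel: "f1 dvd y" if y: "f1 dvd h * y" for y
  proof -
    obtain q s where qs: "y = q * f1 + s" "s = 0 \<or> wdeg {x} s < D" using monic_division[OF f1] by blast
    have "h * y = f1 * (h * q) + h * s" by (simp add: qs(1) algebra_simps)
    then have "f1 dvd h * s" using y by (metis dvd_add_right_iff dvd_triv_left)
    then have "h * s = 0" using small degh(2)[OF qs(2) hA] by blast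
    then show ?thesis using h(2) qs(1) by simp
  qed
  obtain q w where w: "a * v = q * f1 + w" "w = 0 \<or> wdeg {x} w < D" using monic_division[OF f1] by blast
  have "\<not> h dvd w"
  proof
    assume "h dvd w"
    then obtain b where b: "w = h * b" by (auto simp: dvd_def)
    have "h * a = a * u * f1 + (a * v) * f2" by (simp add: h(1) algebra_simps)
    also have "\<dots> = a * u * f1 + (q * f1 + h * b) * f2" by (simp only: w(1) b)
    finally have "h * (a - b * f2) = f1 * (a * u + q * f2)" by (simp add: algebra_simps)
    then have "f1 dvd h * (a - b * f2)" by simp
    then have "f1 dvd a - b * f2" by (rule cancel)
    then obtain e where "a - b * f2 = f1 * e" by (auto simp: dvd_def)
    then have "a = e * f1 + b * f2" by (simp add: algebra_simps)
    then show False using nrel by blast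
  qed
  then obtain \<delta> where \<delta>: "irreducible \<delta>" "\<delta> dvd h" "\<And>e. h dvd e * w \<Longrightarrow> \<delta> dvd e"
    using irreducible_dvd_denominator[OF h(2)] by blast
  have "wdeg UNIV \<delta> \<noteq> 0" using \<delta>(1) by (auto simp: irreducible_def is_unit_iff)
  \<comment> \<open>A variable occurring in \<open>\<delta>\<close>; leaving it out together with
    \<open>x\<close> gives a subring without nonzero multiples of \<open>\<delta>\<close>.\<close>
  then obtain y where y: "wdeg {y} \<delta> > 0" by (rule wdeg_pos_var)
  have \<delta>A: "\<delta> \<in> A" using polys_in_dvd[OF \<delta>(2)] hA h(2) by (simp add: A_def)
  then have "x \<noteq> y" using y by (auto simp: A_iff)
  define C where "C = {r. \<exists>\<alpha> \<beta>. r * a = \<alpha> * f1 + \<beta> * f2}"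
  have CI: "is_ideal C"
    unfolding is_ideal_def
  proof (intro conjI ballI allI)
    show "0 \<in> C" unfolding C_def by (intro CollectI exI[of _ 0]) simp
  next
    fix r s assume "r \<in> C" "s \<in> C"
    then obtain \<alpha> \<beta> \<alpha>' \<beta>' where "r * a = \<alpha> * f1 + \<beta> * f2" "s * a = \<alpha>' * f1 + \<beta>' * f2"
      unfolding C_def by blast
    then have "(r + s) * a = (\<alpha> + \<alpha>') * f1 + (\<beta> + \<beta>') * f2" by (simp add: algebra_simps)
    then show "r + s \<in> C" unfolding C_def by blast
  next
    fix r s assume "r \<in> C"
    then obtain \<alpha> \<beta> where "r * a = \<alpha> * f1 + \<beta> * f2" unfolding C_def by blast
    then have "(s * r) * a = (s * \<alpha>) * f1 + (s * \<beta>) * f2" by (simp add: mult.assoc distrib_left)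
    then show "s * r \<in> C" unfolding C_def by blast
  qed
  \<comment> \<open>Multiplying the relation for \<open>e * a\<close> by \<open>v\<close> makes e w
    - s h a multiple of \<open>f1\<close> of degree below \<open>D\<close>; so it vanishes and
    \<open>h\<close> divides e w.\<close>
  have C\<delta>: "\<delta> dvd e" if e: "e \<in> C" "e \<in> A" for e
  proof -
    obtain \<alpha> \<beta> where ab: "e * a = \<alpha> * f1 + \<beta> * f2" using e(1) unfolding C_def by blast
    obtain q' s where s: "\<beta> = q' * f1 + s" "s = 0 \<or> wdeg {x} s < D" using monic_division[OF f1] by blast
    have "e * (a * v) = (e * a) * v" by (simp only: mult.assoc)
    also have "\<dots> = \<alpha> * v * f1 + \<beta> * (v * f2)" unfolding ab by (simp add: algebra_simps)
    also have "v * f2 = h - u * f1" by (simp add: h(1))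
    finally have "e * (q * f1 + w) = \<alpha> * v * f1 + (q' * f1 + s) * (h - u * f1)" by (simp only: w(1) s(1))
    then have "e * w - s * h = f1 * (\<alpha> * v + q' * h - (q' * f1 + s) * u - e * q)" by (simp add: algebra_simps)
    then have "f1 dvd e * w - s * h" by simp
    moreover have "e * w - s * h = 0 \<or> wdeg {x} (e * w - s * h) < D"
      using degh(2)[OF w(2) e(2)] degh(1)[OF s(2) hA] wdeg_diff_le[of "{x}" "e * w" "s * h"] by auto
    ultimately have "e * w = s * h" using small by fastforce
    then show ?thesis using \<delta>(3) by simp
  qed
  define T where "T = - {x, y}"
  have "C \<inter> (polys_in T - {0}) = {}"
  proof (rule ccontr)
    assume "C \<inter> (polys_in T - {0}) \<noteq> {}"
    then obtain e where e: "e \<in> C" "e \<in> polys_in T" "e \<noteq> 0" by auto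
    have "e \<in> A" unfolding A_def using polys_in_mono[of T "- {x}" e] e(2) by (auto simp: T_def)
    then have "\<delta> dvd e" using C\<delta> e(1) by blast
    then have "wdeg {y} e > 0" using wdeg_dvd_le[of \<delta> e "{y}"] y e(3) by linarith
    moreover have "wdeg {y} e \<le> wdeg (- T) e" by (rule wdeg_mono) (simp add: T_def)
    ultimately show False using e(2) by (simp add: polys_in_wdeg)
  qed
  then have "C \<inter> polys_in T = {0}" using is_idealD(1)[OF CI] by auto
  then obtain P where P: "is_prime P" "C \<subseteq> P" "height_le P (CARD('n) - card T)"
    using prime_above_trivial_intersection[OF CI] by blast
  have "card T = CARD('n) - 2" unfolding T_def using \<open>x \<noteq> y\<close> by (simp add: Compl_eq_Diff_UNIV card_Diff_subset)
  moreover have "card {x, y} \<le> CARD('n)" by (rule card_mono) auto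
  ultimately have "height_le P 2" using \<open>x \<noteq> y\<close> P(3) by simp
  moreover have "f1 * a = a * f1 + 0 * f2" "f2 * a = 0 * f1 + a * f2" by simp_all
  then have "f1 \<in> C" "f2 \<in> C" "f3 \<in> C" unfolding C_def using rel by blast+
  ultimately show ?thesis using P by blast
qed

text \<open>Read contrapositively: if no prime of height at most two contains all three polynomials,
  then \<open>f3\<close> is not a zero divisor modulo (f1, f2). A linear change of coordinates makes
  \<open>f1\<close> monic, and the prime found there is pulled back with its height bound.\<close>

theorem unmixed_codim2:
  fixes f1 f2 f3 a :: "('n::{finite,linorder}, 'k::field_char_0) mpoly"
  assumes f1: "f1 \<in> forms D" "f1 \<noteq> 0" "D > 0"
    and cop: "\<And>p. p dvd f1 \<Longrightarrow> p dvd f2 \<Longrightarrow> p dvd 1"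
    and rel: "f3 * a = \<alpha> * f1 + \<beta> * f2" and nrel: "\<And>\<alpha> \<beta>. a \<noteq> \<alpha> * f1 + \<beta> * f2"
  shows "\<exists>P. is_prime P \<and> f1 \<in> P \<and> f2 \<in> P \<and> f3 \<in> P \<and> height_le P 2"
proof -
  obtain x \<sigma> \<tau> where st: "\<And>g. psubst \<sigma> (psubst \<tau> g) = g" "\<And>g. psubst \<tau> (psubst \<sigma> g) = g"
    "psubst \<sigma> f1 \<in> forms D" "psubst \<sigma> f1 \<noteq> 0" "wdeg {x} (psubst \<sigma> f1) = D"
    using linear_change_monic[OF f1] by blast
  define \<phi> where "\<phi> = psubst \<sigma>"
  define \<psi> where "\<psi> = psubst \<tau>"
  have inv: "\<phi> (\<psi> g) = g" "\<psi> (\<phi> g) = g" for g using st by (simp_all add: \<phi>_def \<psi>_def)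
  have hom: "\<phi> (g + h) = \<phi> g + \<phi> h" "\<phi> (g * h) = \<phi> g * \<phi> h" "\<phi> 1 = 1" "\<phi> 0 = 0"
    "\<psi> (g + h) = \<psi> g + \<psi> h" "\<psi> (g * h) = \<psi> g * \<psi> h" "\<psi> 1 = 1" "\<psi> 0 = 0" for g h
    by (simp_all add: \<phi>_def \<psi>_def psubst_add psubst_mult)
  have "\<exists>P. is_prime P \<and> \<phi> f1 \<in> P \<and> \<phi> f2 \<in> P \<and> \<phi> f3 \<in> P \<and> height_le P 2"
  proof (rule unmixed_monic)
    show "\<phi> f1 \<in> forms D" "\<phi> f1 \<noteq> 0" "wdeg {x} (\<phi> f1) = D" using st by (simp_all add: \<phi>_def)
    show "\<phi> f3 * \<phi> a = \<phi> \<alpha> * \<phi> f1 + \<phi> \<beta> * \<phi> f2" using rel by (simp flip: hom)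
    fix p assume p: "p dvd \<phi> f1" "p dvd \<phi> f2"
    have d: "\<psi> p dvd g" if "p dvd \<phi> g" for g
    proof -
      obtain r where "\<phi> g = p * r" using \<open>p dvd \<phi> g\<close> by (auto simp: dvd_def)
      then have "\<psi> (\<phi> g) = \<psi> p * \<psi> r" by (simp add: hom)
      then show ?thesis by (simp add: inv)
    qed
    have "\<psi> p dvd 1" using cop d p by blast
    then obtain r where "1 = \<psi> p * r" by (auto simp: dvd_def)
    then have "\<phi> 1 = \<phi> (\<psi> p) * \<phi> r" by (simp only: hom(2)[symmetric])
    then have "1 = p * \<phi> r" by (simp only: inv hom)
    then show "p dvd 1" by (rule dvdI)
  next
    fix \<alpha> \<beta>
    show "\<phi> a \<noteq> \<alpha> * \<phi> f1 + \<beta> * \<phi> f2"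
    proof
      assume "\<phi> a = \<alpha> * \<phi> f1 + \<beta> * \<phi> f2"
      then have "\<psi> (\<phi> a) = \<psi> \<alpha> * \<psi> (\<phi> f1) + \<psi> \<beta> * \<psi> (\<phi> f2)" by (simp add: hom)
      then show False using nrel by (simp add: inv)
    qed
  qed
  then obtain P where P: "is_prime P" "\<phi> f1 \<in> P" "\<phi> f2 \<in> P" "\<phi> f3 \<in> P" "height_le P 2" by blast
  have "is_prime (\<phi> -` P)" using P(1) by (auto simp: is_prime_def is_ideal_def hom)
  moreover have "height_le (\<phi> -` P) 2"
    by (rule height_le_transport[where \<psi> = \<psi>, OF hom(5-8) inv(2,1) P(5)])
  ultimately show ?thesis using P by blast
qed

section \<open>Ideals generated by three forms\<close>

text \<open>The generated ideal in explicit form; ideals with two generators are written by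
  repeating one of them.\<close>

definition gen3 :: "'a::comm_ring_1 \<Rightarrow> 'a \<Rightarrow> 'a \<Rightarrow> 'a set" where
  "gen3 a b c = {u * a + v * b + w * c | u v w. True}"

lemma gen3I: "u * a + v * b + w * c \<in> gen3 a b c"
  unfolding gen3_def by blast

lemma gen3E:
  assumes "x \<in> gen3 a b c"
  obtains u v w where "x = u * a + v * b + w * c"
  using assms unfolding gen3_def by blast

lemma gen3_mem: "a \<in> gen3 a b c" "b \<in> gen3 a b c" "c \<in> gen3 a b c"
  using gen3I[of 1 a 0 b 0 c] gen3I[of 0 a 1 b 0 c] gen3I[of 0 a 0 b 1 c] by simp_all

lemma is_ideal_gen3: "is_ideal (gen3 a b c)"
  unfolding is_ideal_def
proof (intro conjI ballI allI)
  show "0 \<in> gen3 a b c" using gen3I[of 0 a 0 b 0 c] by simp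
next
  fix x y assume "x \<in> gen3 a b c" "y \<in> gen3 a b c"
  obtain u v w where x: "x = u * a + v * b + w * c" using \<open>x \<in> gen3 a b c\<close> by (rule gen3E)
  obtain u' v' w' where y: "y = u' * a + v' * b + w' * c" using \<open>y \<in> gen3 a b c\<close> by (rule gen3E)
  have "x + y = (u + u') * a + (v + v') * b + (w + w') * c" by (simp add: x y algebra_simps)
  then show "x + y \<in> gen3 a b c" using gen3I[of "u + u'" a "v + v'" b "w + w'" c] by simp
next
  fix x r assume "x \<in> gen3 a b c"
  then obtain u v w where x: "x = u * a + v * b + w * c" by (rule gen3E)
  have "r * x = (r * u) * a + (r * v) * b + (r * w) * c" by (simp add: x algebra_simps)
  then show "r * x \<in> gen3 a b c" using gen3I[of "r * u" a "r * v" b "r * w" c] by simp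
qed

lemma gen3_least: "is_ideal I \<Longrightarrow> a \<in> I \<Longrightarrow> b \<in> I \<Longrightarrow> c \<in> I \<Longrightarrow> gen3 a b c \<subseteq> I"
  by (auto elim!: gen3E intro!: is_idealD(2) is_idealD(3))

lemma gen3_subset_iff: "is_ideal I \<Longrightarrow> gen3 a b c \<subseteq> I \<longleftrightarrow> a \<in> I \<and> b \<in> I \<and> c \<in> I"
  using gen3_least[of I a b c] gen3_mem[of a b c] gen3_mem[of b a c] gen3_mem[of c a b] by auto

lemma gen3_hcomp:
  assumes f: "f1 \<in> forms d1" "f2 \<in> forms d2" "f3 \<in> forms d3"
  shows "hcomp UNIV j (u * f1 + v * f2 + w * f3) =
    (if d1 \<le> j then hcomp UNIV (j - d1) u * f1 else 0) + (if d2 \<le> j then hcomp UNIV (j - d2) v * f2 else 0)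
    + (if d3 \<le> j then hcomp UNIV (j - d3) w * f3 else 0)"
  using assms unfolding forms_eq_whom
  by (simp add: hcomp_add hcomp_mult_whom mult.commute[of _ f1] mult.commute[of _ f2] mult.commute[of _ f3])

lemma gen3_hcomp_mem:
  assumes "f1 \<in> forms d1" "f2 \<in> forms d2" "f3 \<in> forms d3" "x \<in> gen3 f1 f2 f3"
  shows "hcomp UNIV j x \<in> gen3 f1 f2 f3"
proof -
  obtain u v w where x: "x = u * f1 + v * f2 + w * f3" using assms(4) by (rule gen3E)
  note I = is_ideal_gen3[of f1 f2 f3] and m = gen3_mem[where a = f1 and b = f2 and c = f3]
  show ?thesis
    unfolding x gen3_hcomp[OF assms(1-3)]
    by (intro is_idealD(2)[OF I]) (auto intro: is_idealD(3)[OF I] is_idealD(1)[OF I] m)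
qed

lemma subset_of_card:
  assumes "finite A" "k \<le> card A"
  shows "\<exists>T. T \<subseteq> A \<and> card T = k"
  using obtain_subset_with_card_n[OF assms(2)] by metis

text \<open>A monomial outside \<open>U\<close> has at most \<open>s\<close> large exponents.\<close>

lemma card_non_upclosed_le:
  fixes U :: "('n::finite \<Rightarrow>\<^sub>0 nat) set"
  assumes U: "upclosed U" and s: "\<And>T. card T = Suc s \<Longrightarrow> \<exists>u\<in>U. \<forall>i. i \<notin> T \<longrightarrow> Poly_Mapping.lookup u i = 0"
  shows "\<exists>K. \<forall>t. finite {m. m \<notin> U \<and> mdeg m \<le> t} \<and> card {m. m \<notin> U \<and> mdeg m \<le> t} \<le> K * (t + 1) ^ s"
proof -
  obtain u where u: "\<And>T. card T = Suc s \<Longrightarrow> u T \<in> U"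
      "\<And>T i. card T = Suc s \<Longrightarrow> i \<notin> T \<Longrightarrow> Poly_Mapping.lookup (u T) i = 0"
    using s by metis
  \<comment> \<open>Bounds every exponent of every chosen \<open>u T\<close>, so a monomial with s +
    1 exponents of size at least \<open>N\<close> is a multiple of some \<open>u T\<close> and lies
    in \<open>U\<close>.\<close>
  define N where "N = (\<Sum>T\<in>UNIV. mdeg (u T))"
  have N: "Poly_Mapping.lookup (u T) i \<le> N" for T i
  proof -
    have "Poly_Mapping.lookup (u T) i \<le> mdeg (u T)"
      unfolding mdeg_def by (rule member_le_sum) auto
    also have "\<dots> \<le> N" unfolding N_def by (rule member_le_sum) auto
    finally show ?thesis .
  qed
  define A where "A = (\<lambda>t (T :: 'n set) i. if i \<in> T then {..t} else {..<N})"
  define Bx where "Bx = (\<lambda>t (T :: 'n set). {m. \<forall>i. Poly_Mapping.lookup m i \<in> A t T i})"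
  have finB: "finite (Bx t T)" and cardB: "card (Bx t T) = (\<Prod>i\<in>UNIV. card (A t T i))" for t T
    unfolding Bx_def by (rule box_monomials; simp add: A_def)+
  have cB: "card (Bx t T) \<le> (N + 1) ^ CARD('n) * (t + 1) ^ s" if T: "card T \<le> s" for t T
  proof -
    have "(\<Prod>i\<in>UNIV. card (A t T i)) \<le> (\<Prod>i\<in>UNIV. (N + 1) * (if i \<in> T then t + 1 else 1))"
      by (rule prod_mono) (auto simp: A_def)
    also have "\<dots> = (N + 1) ^ CARD('n) * (\<Prod>i\<in>UNIV. if i \<in> T then t + 1 else 1)"
      by (subst prod.distrib) simp
    also have "(\<Prod>i\<in>UNIV. if i \<in> T then t + 1 else 1) = (t + 1) ^ card T"
      by (subst prod.inter_restrict[symmetric]) auto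
    also have "(N + 1) ^ CARD('n) * (t + 1) ^ card T \<le> (N + 1) ^ CARD('n) * (t + 1) ^ s"
      using T by (intro mult_left_mono power_increasing) auto
    finally show ?thesis unfolding cardB .
  qed
  define \<T> where "\<T> = {T :: 'n set. card T \<le> s}"
  have sub: "{m. m \<notin> U \<and> mdeg m \<le> t} \<subseteq> (\<Union>T\<in>\<T>. Bx t T)" for t
  proof
    fix m assume "m \<in> {m. m \<notin> U \<and> mdeg m \<le> t}"
    then have m: "m \<notin> U" "mdeg m \<le> t" by auto
    define T where "T = {i. N \<le> Poly_Mapping.lookup m i}"
    have "card T \<le> s"
    proof (rule ccontr)
      assume "\<not> card T \<le> s"
      then obtain T' where T': "T' \<subseteq> T" "card T' = Suc s"
        using subset_of_card[of T "Suc s"] by auto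
      have "Poly_Mapping.lookup (u T') i \<le> Poly_Mapping.lookup m i" for i
      proof (cases "i \<in> T'")
        case True
        then show ?thesis using T'(1) N[of T' i] by (auto simp: T_def)
      qed (simp add: u(2)[OF T'(2)])
      then show False using upclosed_le[OF U u(1)[OF T'(2)]] m(1) by blast
    qed
    moreover have "Poly_Mapping.lookup m i \<le> t" for i
    proof -
      have "Poly_Mapping.lookup m i \<le> mdeg m" unfolding mdeg_def by (rule member_le_sum) auto
      then show ?thesis using m(2) by simp
    qed
    then have "m \<in> Bx t T" by (auto simp: Bx_def A_def T_def not_le)
    ultimately show "m \<in> (\<Union>T\<in>\<T>. Bx t T)" by (auto simp: \<T>_def)
  qed
  have fin: "finite (\<Union>T\<in>\<T>. Bx t T)" for t using finB by simp
  have "card {m. m \<notin> U \<and> mdeg m \<le> t} \<le> (card \<T> * (N + 1) ^ CARD('n)) * (t + 1) ^ s" for t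
  proof -
    have "card {m. m \<notin> U \<and> mdeg m \<le> t} \<le> card (\<Union>T\<in>\<T>. Bx t T)" by (rule card_mono[OF fin sub])
    also have "\<dots> \<le> (\<Sum>T\<in>\<T>. card (Bx t T))" by (rule card_UN_le) simp
    also have "\<dots> \<le> (\<Sum>T\<in>\<T>. (N + 1) ^ CARD('n) * (t + 1) ^ s)"
      by (rule sum_mono, rule cB) (simp add: \<T>_def)
    finally show ?thesis by (simp add: mult.assoc)
  qed
  moreover have "finite {m. m \<notin> U \<and> mdeg m \<le> t}" for t by (rule finite_subset[OF sub fin])
  ultimately show ?thesis by blast
qed

text \<open>Only homogeneous elements are used, because the monomial order ignores the degree; in
  each degree t the set then consists of the leading monomials of the forms of degree t in
  \<open>P\<close>.\<close>

definition init :: "('n::{finite,linorder}, 'k::field) mpoly set \<Rightarrow> ('n \<Rightarrow>\<^sub>0 nat) set" where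
  "init P = {m. \<exists>g\<in>P. g \<noteq> 0 \<and> g \<in> forms (mdeg m) \<and> lm g = m}"

lemma upclosed_init:
  assumes "is_ideal P"
  shows "upclosed (init P)"
  unfolding upclosed_def
proof (intro ballI allI)
  fix m a assume "m \<in> init P"
  then obtain g where g: "g \<in> P" "g \<noteq> 0" "g \<in> forms (mdeg m)" "lm g = m" by (auto simp: init_def)
  have "monom_of a * g \<in> P" using assms g(1) by (rule is_idealD)
  moreover have "monom_of a * g \<noteq> 0" using g(2) by (simp add: single_eq_0_iff)
  moreover have "monom_of a * g \<in> forms (mdeg (m + a))"
    using whom_mult[of "monom_of a" UNIV "mdeg a" g "mdeg m"] g(3)
    by (simp add: forms_eq_whom wt_UNIV[symmetric] wt_add add.commute)
  moreover have "lm (monom_of a * g) = m + a"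
    using lm_single_mult[of 1 g a] g(2,4) by (simp add: add.commute)
  ultimately show "m + a \<in> init P" unfolding init_def by blast
qed

text \<open>Monomials outside the initial ideal together with products of powers of the generators span the
  polynomial ring, which bounds the growth of the ring by three more than that of the quotient.\<close>

lemma forms_spanned:
  fixes f1 f2 f3 :: "('n::{finite,linorder}, 'k::field) mpoly"
  assumes f: "f1 \<in> forms d1" "f2 \<in> forms d2" "f3 \<in> forms d3" and d: "d1 > 0" "d2 > 0" "d3 > 0"
  defines "U \<equiv> init (gen3 f1 f2 f3)"
  defines "G \<equiv> \<lambda>t. (\<lambda>(i, j, l, m). f1 ^ i * f2 ^ j * f3 ^ l * monom_of m) `
    ({..t} \<times> {..t} \<times> {..t} \<times> {m. m \<notin> U \<and> mdeg m \<le> t})"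
  shows "v \<in> forms t \<Longrightarrow> v \<in> mp.span (G t)"
proof -
  have GI: "f1 ^ i * f2 ^ j * f3 ^ l * monom_of m \<in> G t" if "i \<le> t" "j \<le> t" "l \<le> t" "m \<notin> U" "mdeg m \<le> t" for i j l m t
    unfolding G_def using that by (intro image_eqI[where x = "(i, j, l, m)"]) auto
  have GE: "\<exists>i j l m. x = f1 ^ i * f2 ^ j * f3 ^ l * monom_of m \<and> i \<le> t \<and> j \<le> t \<and> l \<le> t \<and> m \<notin> U \<and> mdeg m \<le> t"
    if "x \<in> G t" for x t using that unfolding G_def by auto
  have Gm: "f1 * x \<in> G t" "f2 * x \<in> G t" "f3 * x \<in> G t" if xs: "x \<in> G s" and st: "s < t" for x s t
  proof -
    obtain i j l m where x: "x = f1 ^ i * f2 ^ j * f3 ^ l * monom_of m" "i \<le> s" "j \<le> s" "l \<le> s" "m \<notin> U" "mdeg m \<le> s"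
      using GE[OF xs] by blast
    have eq: "f1 * x = f1 ^ Suc i * f2 ^ j * f3 ^ l * monom_of m" "f2 * x = f1 ^ i * f2 ^ Suc j * f3 ^ l * monom_of m"
      "f3 * x = f1 ^ i * f2 ^ j * f3 ^ Suc l * monom_of m" by (simp_all add: x(1) ac_simps)
    show "f1 * x \<in> G t" unfolding eq by (rule GI) (use x st in auto)
    show "f2 * x \<in> G t" unfolding eq by (rule GI) (use x st in auto)
    show "f3 * x \<in> G t" unfolding eq by (rule GI) (use x st in auto)
  qed
  have sp: "h * x \<in> mp.span (G t)" if x: "x \<in> mp.span (G s)" and st: "s < t" and h: "h \<in> {f1, f2, f3}" for h x s t
    using x
  proof (rule mp.span_induct)
    show "mp.subspace {x. h * x \<in> mp.span (G t)}"
      unfolding mp.subspace_def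
    proof (intro conjI ballI allI)
      show "0 \<in> {x. h * x \<in> mp.span (G t)}" by (simp add: mp.span_zero)
    next
      fix x y assume "x \<in> {x. h * x \<in> mp.span (G t)}" "y \<in> {x. h * x \<in> mp.span (G t)}"
      then show "x + y \<in> {x. h * x \<in> mp.span (G t)}" by (simp add: distrib_left mp.span_add)
    next
      fix c x assume "x \<in> {x. h * x \<in> mp.span (G t)}"
      then have "const c * (h * x) \<in> mp.span (G t)" by (intro mp.span_scale) simp
      then show "const c * x \<in> {x. h * x \<in> mp.span (G t)}" by (simp add: ac_simps)
    qed
    show "h * x \<in> mp.span (G t)" if "x \<in> G s" for x
      using Gm[OF that st] h by (intro mp.span_base) auto
  qed
  show "v \<in> forms t \<Longrightarrow> v \<in> mp.span (G t)"
  proof (induction t arbitrary: v rule: less_induct)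
    case (less t)
    \<comment> \<open>A form of degree \<open>t\<close> in the ideal has cofactors of degree below
      \<open>t\<close>, which the induction hypothesis covers; a further generator raises one
      exponent by 1, and the bound \<open>t\<close> allows that.\<close>
    have gen: "g \<in> mp.span (G t)" if g: "g \<in> gen3 f1 f2 f3" "g \<in> forms t" for g
    proof -
      obtain u v w where uvw: "g = u * f1 + v * f2 + w * f3" using g(1) by (rule gen3E)
      have one: "(if dd \<le> t then hcomp UNIV (t - dd) r * h else 0) \<in> mp.span (G t)"
        if "dd > 0" "h \<in> {f1, f2, f3}" for dd r h
      proof (cases "dd \<le> t")
        case True
        then have lt: "t - dd < t" using that(1) by simp
        have "hcomp UNIV (t - dd) r \<in> mp.span (G (t - dd))"
          by (rule less.IH[OF lt]) (simp add: forms_eq_whom)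
        from sp[OF this lt that(2)] show ?thesis using True by (simp add: mult.commute)
      qed (simp add: mp.span_zero)
      have "hcomp UNIV t g = g" using g(2) by (simp add: forms_eq_whom hcomp_id[where j = t])
      then have "g = (if d1 \<le> t then hcomp UNIV (t - d1) u * f1 else 0)
          + (if d2 \<le> t then hcomp UNIV (t - d2) v * f2 else 0)
          + (if d3 \<le> t then hcomp UNIV (t - d3) w * f3 else 0)"
        unfolding uvw gen3_hcomp[OF f] by simp
      also have "\<dots> \<in> mp.span (G t)"
        by (intro mp.span_add one d) auto
      finally show ?thesis .
    qed
    have "v \<in> forms t \<longrightarrow> v \<in> mp.span (G t)" for v
    proof (induction v rule: lm_induct)
      case 1
      then show ?case by (simp add: mp.span_zero)
    next
      case (2 v)
      show ?case
      proof
        assume v: "v \<in> forms t"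
        have md: "mdeg (lm v) = t" using lm_in_keys[OF 2(1)] v by (auto simp: forms_def)
        \<comment> \<open>The leading monomial of \<open>v\<close> is matched by a form in the ideal
          or, if it lies outside the initial ideal, by the monomial itself.\<close>
        have "\<exists>g. g \<in> mp.span (G t) \<and> g \<noteq> 0 \<and> g \<in> forms t \<and> lm g = lm v"
        proof (cases "lm v \<in> U")
          case True
          then obtain g where "g \<in> gen3 f1 f2 f3" "g \<noteq> 0" "g \<in> forms t" "lm g = lm v"
            unfolding U_def init_def using md by auto
          then show ?thesis using gen by blast
        next
          case False
          have "f1 ^ 0 * f2 ^ 0 * f3 ^ 0 * monom_of (lm v) \<in> G t"
            by (rule GI) (use False md in auto)
          then have "monom_of (lm v) \<in> mp.span (G t)" by (intro mp.span_base) simp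
          moreover have "(monom_of (lm v) :: ('n, 'k) mpoly) \<noteq> 0" by (simp add: single_eq_0_iff)
          moreover have "(monom_of (lm v) :: ('n, 'k) mpoly) \<in> forms t" using md by (simp add: forms_def)
          moreover have "lm (monom_of (lm v) :: ('n, 'k) mpoly) = lm v" by (simp add: lm_def)
          ultimately show ?thesis by blast
        qed
        then obtain g where g: "g \<in> mp.span (G t)" "g \<noteq> 0" "g \<in> forms t" "lm g = lm v" by blast
        define c where "c = Poly_Mapping.lookup v (lm v) / Poly_Mapping.lookup g (lm g)"
        have "v - const c * g = 0 \<or> lm (v - const c * g) < lm v"
          using lm_cancel[OF 2(1) g(2)] g(4) by (simp add: c_def)
        then have "v - const c * g \<in> forms t \<longrightarrow> v - const c * g \<in> mp.span (G t)" by (rule 2(2))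
        moreover have "const c * g \<in> whom UNIV (0 + t)"
          using g(3) by (intro whom_mult whom_const) (simp add: forms_eq_whom)
        then have "v - const c * g \<in> forms t" using v by (simp add: forms_eq_whom whom_diff)
        ultimately have "v - const c * g \<in> mp.span (G t)" by simp
        then have "v - const c * g + const c * g \<in> mp.span (G t)"
          using mp.span_scale[OF g(1)] by (rule mp.span_add)
        then show "v \<in> mp.span (G t)" by simp
      qed
    qed
    then show ?case using less.prems by simp
  qed
qed

text \<open>For n > 3 write n - 3 = s + 1. If the ideal met k[T] nontrivially for every T of this
  size, there would be O(t^s) standard monomials up to degree t, and together with powers of three
  generators only O(t^(n - 1)) elements to span the forms up to degree t, fewer than there are
  monomials.\<close>

theorem prime_height_le_3_exists:
  fixes f1 f2 f3 :: "('n::{finite,linorder}, 'k::field) mpoly"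
  assumes f: "f1 \<in> forms d1" "f2 \<in> forms d2" "f3 \<in> forms d3" and d: "d1 > 0" "d2 > 0" "d3 > 0"
    and n: "CARD('n) \<ge> 3"
  shows "\<exists>P. is_prime P \<and> gen3 f1 f2 f3 \<subseteq> P \<and> height_le P 3"
proof -
  define J where "J = gen3 f1 f2 f3"
  have J: "is_ideal J" unfolding J_def by (rule is_ideal_gen3)
  have Jh: "hcomp UNIV j x \<in> J" if "x \<in> J" for j x
    using gen3_hcomp_mem[OF f] that unfolding J_def by blast
  have "\<exists>T. card T = CARD('n) - 3 \<and> J \<inter> polys_in T = {0}"
  proof (cases "CARD('n) = 3")
    case True
    \<comment> \<open>For n = 3 the subring consists of the constants, and generators of positive
      degree yield no nonzero constant.\<close>
    have "x = 0" if x: "x \<in> J" "x \<in> polys_in {}" for x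
    proof -
      obtain u v w where "x = u * f1 + v * f2 + w * f3" using x(1) unfolding J_def by (rule gen3E)
      then have "hcomp UNIV 0 x = 0" using gen3_hcomp[OF f, of 0 u v w] d by simp
      moreover have "hcomp UNIV 0 x = x" using x(2) by (simp add: polys_in_def hcomp_id[where j = 0])
      ultimately show ?thesis by simp
    qed
    then have "J \<inter> polys_in {} = {0}" using is_idealD(1)[OF J] by auto
    then show ?thesis using True by (intro exI[of _ "{}"]) simp
  next
    case False
    then obtain s where s: "CARD('n) - 3 = Suc s" using n by (metis Suc_diff_le diff_is_0_eq le_antisym not0_implies_Suc)
    show ?thesis
    proof (rule ccontr)
      assume no: "\<not> ?thesis"
      define U where "U = init (gen3 f1 f2 f3)"
      have up: "upclosed U" unfolding U_def by (rule upclosed_init[OF is_ideal_gen3])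
      have "\<exists>u\<in>U. \<forall>i. i \<notin> T \<longrightarrow> Poly_Mapping.lookup u i = 0" if T: "card T = Suc s" for T
      proof -
        have "J \<inter> polys_in T \<noteq> {0}" using no T s by auto
        then obtain h where h: "h \<in> J" "h \<in> polys_in T" "h \<noteq> 0" using is_idealD(1)[OF J] by auto
        \<comment> \<open>The top-degree component of \<open>h\<close> is again in the ideal, as the
          generators are homogeneous, and still involves only the variables in
          \<open>T\<close>.\<close>
        define g where "g = hcomp UNIV (wdeg UNIV h) h"
        have g: "g \<in> J" "g \<in> polys_in T" "g \<noteq> 0" "g \<in> whom UNIV (wdeg UNIV h)"
          using h Jh polys_in_hcomp hcomp_wdeg_nonzero by (simp_all add: g_def)
        have "g \<in> forms (mdeg (lm g))"
          using g(4) lm_in_keys[OF g(3)] by (auto simp: forms_eq_whom whom_def wt_UNIV)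
        then have "lm g \<in> U" using g(1,3) unfolding U_def J_def init_def by blast
        moreover have "\<forall>i. i \<notin> T \<longrightarrow> Poly_Mapping.lookup (lm g) i = 0"
          using polys_in_keys[OF g(2) lm_in_keys[OF g(3)]] by blast
        ultimately show ?thesis by blast
      qed
      from card_non_upclosed_le[OF up this] obtain K where
        K: "\<And>t. finite {m. m \<notin> U \<and> mdeg m \<le> t}" "\<And>t. card {m. m \<notin> U \<and> mdeg m \<le> t} \<le> K * (t + 1) ^ s"
        by blast
      define G where "G = (\<lambda>t. (\<lambda>(i, j, l, m). f1 ^ i * f2 ^ j * f3 ^ l * monom_of m) `
        ({..t} \<times> {..t} \<times> {..t} \<times> {m. m \<notin> U \<and> mdeg m \<le> t}))"
      have span: "v \<in> mp.span (G t)" if "v \<in> forms t" for v t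
        using forms_spanned[OF f d that] unfolding G_def U_def .
      have Gmono: "G t \<subseteq> G t'" if "t \<le> t'" for t t'
        unfolding G_def by (intro image_mono Sigma_mono) (use that in auto)
      have finG: "finite (G t)" for t unfolding G_def using K(1) by simp
      have cardG: "card (G t) \<le> K * (t + 1) ^ (s + 3)" for t
      proof -
        have "card (G t) \<le> card ({..t} \<times> {..t} \<times> {..t} \<times> {m. m \<notin> U \<and> mdeg m \<le> t})"
          unfolding G_def using K(1) by (intro card_image_le) simp
        also have "\<dots> = (t + 1) ^ 3 * card {m. m \<notin> U \<and> mdeg m \<le> t}"
          by (simp add: card_cartesian_product power3_eq_cube algebra_simps)
        also have "\<dots> \<le> (t + 1) ^ 3 * (K * (t + 1) ^ s)" by (rule mult_left_mono[OF K(2)]) simp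
        also have "\<dots> = K * (t + 1) ^ (s + 3)" by (simp only: power_add ac_simps)
        finally show ?thesis .
      qed
      define n where "n = CARD('n)"
      have n_eq: "n = Suc (s + 3)" using s by (simp add: n_def)
      \<comment> \<open>The (u + 1)^n monomials with all exponents at most u have degree at most n
        u, so they lie in the span of \<open>G (n * u)\<close>.\<close>
      have bound: "(u + 1) ^ n \<le> K * (n * (u + 1)) ^ (s + 3)" for u
      proof -
        define M where "M = {m :: 'n \<Rightarrow>\<^sub>0 nat. \<forall>i. Poly_Mapping.lookup m i \<in> {..u}}"
        have M: "finite M" "card M = (u + 1) ^ n"
          unfolding M_def n_def using box_monomials[of "\<lambda>i :: 'n. {..u}"] by simp_all
        have "monom_of ` M \<subseteq> mp.span (G (n * u))"
        proof
          fix x :: "('n, 'k) mpoly" assume "x \<in> monom_of ` M"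
          then obtain m where m: "x = monom_of m" "m \<in> M" by blast
          have "mdeg m \<le> (\<Sum>i\<in>(UNIV :: 'n set). u)"
            unfolding mdeg_def using m(2) by (intro sum_mono) (simp add: M_def)
          then have le: "mdeg m \<le> n * u" by (simp add: n_def)
          have "x \<in> forms (mdeg m)" by (simp add: m(1) forms_def)
          then have "x \<in> mp.span (G (mdeg m))" by (rule span)
          then show "x \<in> mp.span (G (n * u))" using mp.span_mono[OF Gmono[OF le]] by blast
        qed
        then have "card (monom_of ` M :: ('n, 'k) mpoly set) \<le> card (G (n * u))"
          using mp.independent_span_bound[OF finG independent_monomials[OF M(1)]] by blast
        then have "(u + 1) ^ n \<le> card (G (n * u))"
          using card_image[OF inj_monom_of[where 'k = 'k], of M] M(2) by simp
        also have "\<dots> \<le> K * (n * u + 1) ^ (s + 3)" by (rule cardG)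
        also have "\<dots> \<le> K * (n * (u + 1)) ^ (s + 3)"
          using n_eq by (intro mult_left_mono power_mono) auto
        finally show ?thesis .
      qed
      \<comment> \<open>A value at which (u + 1)^n already exceeds K (n (u + 1))^(n - 1).\<close>
      define u where "u = K * n ^ (s + 3)"
      have "(u + 1) ^ n = (u + 1) * (u + 1) ^ (s + 3)" by (simp only: n_eq power_Suc)
      moreover have "K * (n * (u + 1)) ^ (s + 3) = u * (u + 1) ^ (s + 3)"
        by (simp only: power_mult_distrib u_def mult.assoc)
      ultimately have "(u + 1) * (u + 1) ^ (s + 3) \<le> u * (u + 1) ^ (s + 3)" using bound[of u] by (simp only:)
      then show False by simp
    qed
  qed
  then obtain T :: "'n set" where T: "card T = CARD('n) - 3" "J \<inter> polys_in T = {0}" by blast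
  have "CARD('n) - card T = 3" using T(1) n by simp
  then show ?thesis using prime_above_trivial_intersection[OF J T(2)] unfolding J_def by simp
qed

section \<open>Localization\<close>

locale localizable = cring A for A :: "('a, 'b) ring_scheme" (structure) +
  fixes S :: "'a set"
  assumes S_carrier: "S \<subseteq> carrier A" and S_one: "\<one> \<in> S"
    and S_mult: "\<And>s t. s \<in> S \<Longrightarrow> t \<in> S \<Longrightarrow> s \<otimes> t \<in> S"
begin

lemma S_closed [simp]: "s \<in> S \<Longrightarrow> s \<in> carrier A"
  using S_carrier by auto

definition frac :: "'a \<Rightarrow> 'a \<Rightarrow> ('a \<times> 'a) set" where
  "frac a s = frac_rel A S `` {(a, s)}"

lemma frac_relI:
  assumes "a \<in> carrier A" "b \<in> carrier A" "s \<in> S" "t \<in> S" "u \<in> S" "u \<otimes> (t \<otimes> a) = u \<otimes> (s \<otimes> b)"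
  shows "((a, s), (b, t)) \<in> frac_rel A S"
  unfolding frac_rel_def using assms by auto

lemma frac_relE:
  assumes "((a, s), (b, t)) \<in> frac_rel A S"
  obtains u where "a \<in> carrier A" "b \<in> carrier A" "s \<in> S" "t \<in> S" "u \<in> S" "u \<otimes> (t \<otimes> a) = u \<otimes> (s \<otimes> b)"
  using assms unfolding frac_rel_def by auto

lemma equiv_frac_rel: "equiv (carrier A \<times> S) (frac_rel A S)"
proof (rule equivI)
  show "frac_rel A S \<subseteq> (carrier A \<times> S) \<times> (carrier A \<times> S)" by (auto simp: frac_rel_def)
  show "refl_on (carrier A \<times> S) (frac_rel A S)"
    using S_one by (auto simp: refl_on_def frac_rel_def)
  show "sym (frac_rel A S)"
    unfolding sym_def frac_rel_def by (auto intro: sym)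
  show "trans (frac_rel A S)"
  proof (rule transI)
    fix x y z assume xy: "(x, y) \<in> frac_rel A S" and yz: "(y, z) \<in> frac_rel A S"
    obtain a s where x: "x = (a, s)" by (cases x)
    obtain b t where y: "y = (b, t)" by (cases y)
    obtain c r where z: "z = (c, r)" by (cases z)
    obtain u where u: "a \<in> carrier A" "b \<in> carrier A" "s \<in> S" "t \<in> S" "u \<in> S" "u \<otimes> (t \<otimes> a) = u \<otimes> (s \<otimes> b)"
      using xy unfolding x y by (rule frac_relE)
    obtain v where v: "c \<in> carrier A" "r \<in> S" "v \<in> S" "v \<otimes> (r \<otimes> b) = v \<otimes> (t \<otimes> c)"
      using yz unfolding y z by (rule frac_relE)
    note cl = u(1,2) v(1) u(3-5)[THEN S_closed] v(2,3)[THEN S_closed]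
    \<comment> \<open>The denominator \<open>t\<close> of the middle fraction has to enter the
      cancelling factor.\<close>
    have "(u \<otimes> (v \<otimes> t)) \<otimes> (r \<otimes> a) = (v \<otimes> r) \<otimes> (u \<otimes> (t \<otimes> a))" using cl by algebra
    also have "\<dots> = (u \<otimes> s) \<otimes> (v \<otimes> (r \<otimes> b))" unfolding u(6) using cl by algebra
    also have "\<dots> = (u \<otimes> (v \<otimes> t)) \<otimes> (s \<otimes> c)" unfolding v(4) using cl by algebra
    finally show "(x, z) \<in> frac_rel A S"
      unfolding x z using u v by (intro frac_relI[where u = "u \<otimes> (v \<otimes> t)"]) (auto intro: S_mult)
  qed
qed

lemma frac_eq_iff:
  assumes "a \<in> carrier A" "b \<in> carrier A" "s \<in> S" "t \<in> S"
  shows "frac a s = frac b t \<longleftrightarrow> (\<exists>u\<in>S. u \<otimes> (t \<otimes> a) = u \<otimes> (s \<otimes> b))"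
  unfolding frac_def using eq_equiv_class_iff[OF equiv_frac_rel, of "(a, s)" "(b, t)"] assms
  by (auto simp: frac_rel_def)

lemma frac_eqI:
  assumes "a \<in> carrier A" "b \<in> carrier A" "s \<in> S" "t \<in> S" "t \<otimes> a = s \<otimes> b"
  shows "frac a s = frac b t"
  using frac_eq_iff[OF assms(1-4)] assms(5) S_one by auto

lemma carrier_localization: "carrier (localization A S) = {frac a s | a s. a \<in> carrier A \<and> s \<in> S}"
  by (auto simp: localization_def quotient_def frac_def)

lemma frac_closed [simp]: "a \<in> carrier A \<Longrightarrow> s \<in> S \<Longrightarrow> frac a s \<in> carrier (localization A S)"
  by (auto simp: carrier_localization)

lemma in_frac_iff: "(b, t) \<in> frac a s \<longleftrightarrow> ((a, s), (b, t)) \<in> frac_rel A S"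
  by (simp add: frac_def)

lemma self_in_frac: "a \<in> carrier A \<Longrightarrow> s \<in> S \<Longrightarrow> (a, s) \<in> frac a s"
  unfolding in_frac_iff using S_one by (auto intro: frac_relI)

text \<open>Sums and products of fractions are defined as images of all pairs of representatives;
  well-definedness means that these pairs are all equivalent, and then the image is a single
  class.\<close>

lemma Image_related:
  assumes "(a, s) \<in> Y" "\<And>b t. (b, t) \<in> Y \<Longrightarrow> ((a, s), (b, t)) \<in> frac_rel A S"
  shows "frac_rel A S `` Y = frac a s"
proof
  have tr: "trans (frac_rel A S)" using equiv_frac_rel by (simp add: equiv_def)
  show "frac_rel A S `` Y \<subseteq> frac a s"
  proof
    fix z assume "z \<in> frac_rel A S `` Y"
    then obtain b t where "(b, t) \<in> Y" "((b, t), z) \<in> frac_rel A S" by auto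
    then have "((a, s), z) \<in> frac_rel A S" using transD[OF tr assms(2)] by blast
    then show "z \<in> frac a s" by (simp add: frac_def)
  qed
  show "frac a s \<subseteq> frac_rel A S `` Y" unfolding frac_def using assms(1) by auto
qed

lemma frac_mult:
  assumes "a \<in> carrier A" "b \<in> carrier A" "s \<in> S" "t \<in> S"
  shows "frac a s \<otimes>\<^bsub>localization A S\<^esub> frac b t = frac (a \<otimes> b) (s \<otimes> t)"
proof -
  let ?Y = "{(a' \<otimes> b', s' \<otimes> t') | a' s' b' t'. (a', s') \<in> frac a s \<and> (b', t') \<in> frac b t}"
  have "frac_rel A S `` ?Y = frac (a \<otimes> b) (s \<otimes> t)"
  proof (rule Image_related)
    show "(a \<otimes> b, s \<otimes> t) \<in> ?Y" using self_in_frac assms by blast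
  next
    fix c r assume "(c, r) \<in> ?Y"
    then obtain a' s' b' t' where c: "c = a' \<otimes> b'" "r = s' \<otimes> t'" "(a', s') \<in> frac a s" "(b', t') \<in> frac b t"
      by blast
    obtain u where u: "a' \<in> carrier A" "s' \<in> S" "u \<in> S" "u \<otimes> (s' \<otimes> a) = u \<otimes> (s \<otimes> a')"
      using c(3) unfolding in_frac_iff by (rule frac_relE)
    obtain v where v: "b' \<in> carrier A" "t' \<in> S" "v \<in> S" "v \<otimes> (t' \<otimes> b) = v \<otimes> (t \<otimes> b')"
      using c(4) unfolding in_frac_iff by (rule frac_relE)
    note cl = assms(1,2) assms(3,4)[THEN S_closed] u(1) v(1) u(2,3)[THEN S_closed] v(2,3)[THEN S_closed]
    have "(u \<otimes> v) \<otimes> ((s' \<otimes> t') \<otimes> (a \<otimes> b)) = (u \<otimes> (s' \<otimes> a)) \<otimes> (v \<otimes> (t' \<otimes> b))" using cl by algebra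
    also have "\<dots> = (u \<otimes> v) \<otimes> ((s \<otimes> t) \<otimes> (a' \<otimes> b'))" unfolding u(4) v(4) using cl by algebra
    finally show "((a \<otimes> b, s \<otimes> t), (c, r)) \<in> frac_rel A S"
      unfolding c using assms u v by (intro frac_relI[where u = "u \<otimes> v"]) (auto intro: S_mult)
  qed
  then show ?thesis by (simp add: localization_def)
qed

lemma frac_add:
  assumes "a \<in> carrier A" "b \<in> carrier A" "s \<in> S" "t \<in> S"
  shows "frac a s \<oplus>\<^bsub>localization A S\<^esub> frac b t = frac ((t \<otimes> a) \<oplus> (s \<otimes> b)) (s \<otimes> t)"
proof -
  let ?Y = "{((t' \<otimes> a') \<oplus> (s' \<otimes> b'), s' \<otimes> t') | a' s' b' t'. (a', s') \<in> frac a s \<and> (b', t') \<in> frac b t}"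
  have "frac_rel A S `` ?Y = frac ((t \<otimes> a) \<oplus> (s \<otimes> b)) (s \<otimes> t)"
  proof (rule Image_related)
    show "((t \<otimes> a) \<oplus> (s \<otimes> b), s \<otimes> t) \<in> ?Y" using self_in_frac assms by blast
  next
    fix c r assume "(c, r) \<in> ?Y"
    then obtain a' s' b' t' where c: "c = (t' \<otimes> a') \<oplus> (s' \<otimes> b')" "r = s' \<otimes> t'"
      "(a', s') \<in> frac a s" "(b', t') \<in> frac b t" by blast
    obtain u where u: "a' \<in> carrier A" "s' \<in> S" "u \<in> S" "u \<otimes> (s' \<otimes> a) = u \<otimes> (s \<otimes> a')"
      using c(3) unfolding in_frac_iff by (rule frac_relE)
    obtain v where v: "b' \<in> carrier A" "t' \<in> S" "v \<in> S" "v \<otimes> (t' \<otimes> b) = v \<otimes> (t \<otimes> b')"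
      using c(4) unfolding in_frac_iff by (rule frac_relE)
    note cl = assms(1,2) assms(3,4)[THEN S_closed] u(1) v(1) u(2,3)[THEN S_closed] v(2,3)[THEN S_closed]
    have "(u \<otimes> v) \<otimes> ((s' \<otimes> t') \<otimes> ((t \<otimes> a) \<oplus> (s \<otimes> b)))
      = (u \<otimes> (s' \<otimes> a)) \<otimes> (v \<otimes> (t' \<otimes> t)) \<oplus> (v \<otimes> (t' \<otimes> b)) \<otimes> (u \<otimes> (s' \<otimes> s))" using cl by algebra
    also have "\<dots> = (u \<otimes> v) \<otimes> ((s \<otimes> t) \<otimes> ((t' \<otimes> a') \<oplus> (s' \<otimes> b')))" unfolding u(4) v(4) using cl by algebra
    finally show "(((t \<otimes> a) \<oplus> (s \<otimes> b), s \<otimes> t), (c, r)) \<in> frac_rel A S"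
      unfolding c using assms u v cl by (intro frac_relI[where u = "u \<otimes> v"]) (auto intro: S_mult)
  qed
  then show ?thesis by (simp add: localization_def)
qed

lemma one_localization: "\<one>\<^bsub>localization A S\<^esub> = frac \<one> \<one>"
  and zero_localization: "\<zero>\<^bsub>localization A S\<^esub> = frac \<zero> \<one>"
  by (simp_all add: localization_def frac_def)

lemma carrier_localizationE:
  assumes "x \<in> carrier (localization A S)"
  obtains a s where "x = frac a s" "a \<in> carrier A" "s \<in> S"
  using assms unfolding carrier_localization by blast

lemma cring_localization: "cring (localization A S)"
proof (rule cringI)
  show "abelian_group (localization A S)"
  proof (rule abelian_groupI)
    fix x y assume "x \<in> carrier (localization A S)" "y \<in> carrier (localization A S)"
    then obtain a s b t where x: "x = frac a s" "a \<in> carrier A" "s \<in> S" and y: "y = frac b t" "b \<in> carrier A" "t \<in> S"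
      by (metis carrier_localizationE)
    show "x \<oplus>\<^bsub>localization A S\<^esub> y \<in> carrier (localization A S)"
      using x y S_mult by (simp add: frac_add)
    show "x \<oplus>\<^bsub>localization A S\<^esub> y = y \<oplus>\<^bsub>localization A S\<^esub> x"
      using x y S_mult by (simp add: frac_add a_comm m_comm)
  next
    fix x y z assume "x \<in> carrier (localization A S)" "y \<in> carrier (localization A S)" "z \<in> carrier (localization A S)"
    then obtain a s b t c r where x: "x = frac a s" "a \<in> carrier A" "s \<in> S" and y: "y = frac b t" "b \<in> carrier A" "t \<in> S"
      and z: "z = frac c r" "c \<in> carrier A" "r \<in> S"
      by (metis carrier_localizationE)
    note cl = x(2) y(2) z(2) x(3)[THEN S_closed] y(3)[THEN S_closed] z(3)[THEN S_closed]
    have "r \<otimes> (t \<otimes> a \<oplus> s \<otimes> b) \<oplus> s \<otimes> t \<otimes> c = t \<otimes> r \<otimes> a \<oplus> s \<otimes> (r \<otimes> b \<oplus> t \<otimes> c)"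
      "s \<otimes> t \<otimes> r = s \<otimes> (t \<otimes> r)" using cl by algebra+
    then show "x \<oplus>\<^bsub>localization A S\<^esub> y \<oplus>\<^bsub>localization A S\<^esub> z = x \<oplus>\<^bsub>localization A S\<^esub> (y \<oplus>\<^bsub>localization A S\<^esub> z)"
      using x y z S_mult by (simp add: frac_add)
  next
    show "\<zero>\<^bsub>localization A S\<^esub> \<in> carrier (localization A S)"
      using S_one by (simp add: zero_localization)
  next
    fix x assume "x \<in> carrier (localization A S)"
    then obtain a s where x: "x = frac a s" "a \<in> carrier A" "s \<in> S" by (rule carrier_localizationE)
    show "\<zero>\<^bsub>localization A S\<^esub> \<oplus>\<^bsub>localization A S\<^esub> x = x"
      using x S_one by (simp add: zero_localization frac_add)
    have "\<ominus> a \<oplus> a = \<zero>" using x(2) by (rule l_neg)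
    have "frac (\<ominus> a) s \<oplus>\<^bsub>localization A S\<^esub> x = frac (s \<otimes> (\<ominus> a) \<oplus> s \<otimes> a) (s \<otimes> s)"
      using x by (simp add: frac_add)
    also have "\<dots> = frac \<zero> \<one>"
    proof (rule frac_eqI)
      have "s \<in> carrier A" using x by simp
      then show "\<one> \<otimes> (s \<otimes> (\<ominus> a) \<oplus> s \<otimes> a) = s \<otimes> s \<otimes> \<zero>" using x(2) by algebra
    qed (use x S_one S_mult in auto)
    finally show "\<exists>y\<in>carrier (localization A S). y \<oplus>\<^bsub>localization A S\<^esub> x = \<zero>\<^bsub>localization A S\<^esub>"
      unfolding zero_localization using x by (intro bexI[of _ "frac (\<ominus> a) s"]) auto
  qed
next
  show "comm_monoid (localization A S)"
  proof (rule comm_monoidI)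
    fix x y assume "x \<in> carrier (localization A S)" "y \<in> carrier (localization A S)"
    then obtain a s b t where x: "x = frac a s" "a \<in> carrier A" "s \<in> S" and y: "y = frac b t" "b \<in> carrier A" "t \<in> S"
      by (metis carrier_localizationE)
    show "x \<otimes>\<^bsub>localization A S\<^esub> y \<in> carrier (localization A S)"
      using x y S_mult by (simp add: frac_mult)
    show "x \<otimes>\<^bsub>localization A S\<^esub> y = y \<otimes>\<^bsub>localization A S\<^esub> x"
      using x y by (simp add: frac_mult m_comm)
  next
    fix x y z assume "x \<in> carrier (localization A S)" "y \<in> carrier (localization A S)" "z \<in> carrier (localization A S)"
    then obtain a s b t c r where x: "x = frac a s" "a \<in> carrier A" "s \<in> S" and y: "y = frac b t" "b \<in> carrier A" "t \<in> S"
      and z: "z = frac c r" "c \<in> carrier A" "r \<in> S"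
      by (metis carrier_localizationE)
    show "x \<otimes>\<^bsub>localization A S\<^esub> y \<otimes>\<^bsub>localization A S\<^esub> z = x \<otimes>\<^bsub>localization A S\<^esub> (y \<otimes>\<^bsub>localization A S\<^esub> z)"
      using x y z S_mult by (simp add: frac_mult m_assoc)
  next
    show "\<one>\<^bsub>localization A S\<^esub> \<in> carrier (localization A S)"
      using S_one by (simp add: one_localization)
  next
    fix x assume "x \<in> carrier (localization A S)"
    then obtain a s where x: "x = frac a s" "a \<in> carrier A" "s \<in> S" by (rule carrier_localizationE)
    show "\<one>\<^bsub>localization A S\<^esub> \<otimes>\<^bsub>localization A S\<^esub> x = x"
      using x S_one by (simp add: one_localization frac_mult)
  qed
next
  fix x y z assume "x \<in> carrier (localization A S)" "y \<in> carrier (localization A S)" "z \<in> carrier (localization A S)"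
  then obtain a s b t c r where x: "x = frac a s" "a \<in> carrier A" "s \<in> S" and y: "y = frac b t" "b \<in> carrier A" "t \<in> S"
    and z: "z = frac c r" "c \<in> carrier A" "r \<in> S"
    by (metis carrier_localizationE)
  note cl = x(2) y(2) z(2) x(3)[THEN S_closed] y(3)[THEN S_closed] z(3)[THEN S_closed]
  have "frac ((t \<otimes> a \<oplus> s \<otimes> b) \<otimes> c) (s \<otimes> t \<otimes> r)
      = frac (t \<otimes> r \<otimes> (a \<otimes> c) \<oplus> s \<otimes> r \<otimes> (b \<otimes> c)) (s \<otimes> r \<otimes> (t \<otimes> r))"
  proof (rule frac_eqI)
    show "s \<otimes> r \<otimes> (t \<otimes> r) \<otimes> ((t \<otimes> a \<oplus> s \<otimes> b) \<otimes> c)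
      = s \<otimes> t \<otimes> r \<otimes> (t \<otimes> r \<otimes> (a \<otimes> c) \<oplus> s \<otimes> r \<otimes> (b \<otimes> c))" using cl by algebra
  qed (use x y z S_mult in auto)
  then show "(x \<oplus>\<^bsub>localization A S\<^esub> y) \<otimes>\<^bsub>localization A S\<^esub> z
      = x \<otimes>\<^bsub>localization A S\<^esub> z \<oplus>\<^bsub>localization A S\<^esub> y \<otimes>\<^bsub>localization A S\<^esub> z"
    using x y z S_mult by (simp add: frac_add frac_mult)
qed

text \<open>\<open>ring_length\<close> counts strict inclusions, so {0} inside a nonzero ring
  already gives 1; the localization is nonzero because 0 is not a denominator.\<close>

lemma ring_length_localization_ge_1:
  assumes "\<zero> \<notin> S"
  shows "1 \<le> ring_length (localization A S)"
proof -
  interpret L: cring "localization A S" by (rule cring_localization)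
  have "\<one>\<^bsub>localization A S\<^esub> \<noteq> \<zero>\<^bsub>localization A S\<^esub>"
  proof
    assume "\<one>\<^bsub>localization A S\<^esub> = \<zero>\<^bsub>localization A S\<^esub>"
    then obtain u where "u \<in> S" "u \<otimes> (\<one> \<otimes> \<one>) = u \<otimes> (\<one> \<otimes> \<zero>)"
      unfolding one_localization zero_localization using frac_eq_iff[of \<one> \<zero> \<one> \<one>] S_one by auto
    then show False using assms by simp
  qed
  then have sub: "{\<zero>\<^bsub>localization A S\<^esub>} \<subset> carrier (localization A S)"
    using L.zero_closed L.one_closed by blast
  define C where "C = (\<lambda>i::nat. if i = 0 then {\<zero>\<^bsub>localization A S\<^esub>} else carrier (localization A S))"
  have "\<forall>i\<le>1. ideal (C i) (localization A S)" "\<forall>i<1. C i \<subset> C (Suc i)"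
    using sub L.zeroideal L.oneideal by (auto simp: C_def)
  then have "enat 1 \<le> ring_length (localization A S)"
    unfolding ring_length_def by (intro Sup_upper) blast
  then show ?thesis by (simp add: one_enat_def)
qed

text \<open>The assumption \<open>field\<close> kills every fraction whose numerator is outside
  \<open>S\<close>, while numerators in \<open>S\<close> are invertible; so the localization is a
  field and has only two ideals.\<close>

lemma ring_length_localization_eq_1:
  assumes "\<zero> \<notin> S" and field: "\<And>a. a \<in> carrier A \<Longrightarrow> a \<notin> S \<Longrightarrow> \<exists>u\<in>S. u \<otimes> a = \<zero>"
  shows "ring_length (localization A S) = 1"
proof (rule antisym)
  interpret L: cring "localization A S" by (rule cring_localization)
  have dich: "I = {\<zero>\<^bsub>localization A S\<^esub>} \<or> I = carrier (localization A S)" if I: "ideal I (localization A S)" for I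
  proof (cases "I \<subseteq> {\<zero>\<^bsub>localization A S\<^esub>}")
    case True
    then show ?thesis using additive_subgroup.zero_closed[OF ideal.axioms(1)[OF I]] by auto
  next
    case False
    then obtain x where x: "x \<in> I" "x \<noteq> \<zero>\<^bsub>localization A S\<^esub>" by auto
    then have "x \<in> carrier (localization A S)" using ideal.Icarr[OF I] by blast
    then obtain a s where a: "x = frac a s" "a \<in> carrier A" "s \<in> S" by (rule carrier_localizationE)
    have "a \<in> S"
    proof (rule ccontr)
      assume "a \<notin> S"
      then obtain u where "u \<in> S" "u \<otimes> a = \<zero>" using field a(2) by blast
      then have "\<exists>u\<in>S. u \<otimes> (\<one> \<otimes> a) = u \<otimes> (s \<otimes> \<zero>)" using a by (intro bexI[of _ u]) auto
      then have "x = \<zero>\<^bsub>localization A S\<^esub>"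
        unfolding a(1) zero_localization using frac_eq_iff[of a \<zero> s \<one>] a S_one by simp
      then show False using x(2) by simp
    qed
    have "frac s a \<otimes>\<^bsub>localization A S\<^esub> x \<in> I"
      using ideal.I_l_closed[OF I x(1)] \<open>a \<in> S\<close> a(3) by simp
    moreover have "frac s a \<otimes>\<^bsub>localization A S\<^esub> x = frac (s \<otimes> a) (a \<otimes> s)"
      using a \<open>a \<in> S\<close> by (simp add: frac_mult)
    moreover have "frac (s \<otimes> a) (a \<otimes> s) = frac \<one> \<one>"
      using a \<open>a \<in> S\<close> S_one S_mult by (intro frac_eqI) (auto simp: m_comm)
    ultimately have "\<one>\<^bsub>localization A S\<^esub> \<in> I" by (simp add: one_localization)
    then show ?thesis using ideal.one_imp_carrier[OF I] by blast
  qed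
  show "ring_length (localization A S) \<le> 1"
    unfolding ring_length_def
  proof (rule Sup_least)
    fix l assume "l \<in> {enat m | m C. (\<forall>i\<le>m. ideal (C i) (localization A S)) \<and> (\<forall>i<m. C i \<subset> C (Suc i))}"
    then obtain m C where m: "l = enat m" "\<forall>i\<le>m. ideal (C i) (localization A S)" "\<forall>i<m. C i \<subset> C (Suc i)" by blast
    have "m \<le> 1"
    proof (rule ccontr)
      assume "\<not> m \<le> 1"
      then have i: "ideal (C 0) (localization A S)" "ideal (C 1) (localization A S)" "ideal (C 2) (localization A S)"
        and s: "C 0 \<subset> C 1" "C 1 \<subset> C 2"
        using m(2) m(3)[rule_format, of 0] m(3)[rule_format, of 1] by (auto simp: numeral_2_eq_2)
      have "C 2 \<subseteq> carrier (localization A S)" using ideal.Icarr[OF i(3)] by blast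
      then show False using dich[OF i(1)] dich[OF i(2)] s additive_subgroup.zero_closed[OF ideal.axioms(1)[OF i(1)]] by auto
    qed
    then show "l \<le> 1" unfolding m(1) by (simp add: one_enat_def)
  qed
qed (rule ring_length_localization_ge_1[OF assms(1)])

end

section \<open>Class-based ideals and their locale-based counterparts\<close>

text \<open>The same ring structure as \<open>polyring\<close>, but over an arbitrary commutative
  ring, so that the dictionary below is not tied to polynomials.\<close>

abbreviation Rg :: "'a::comm_ring_1 ring" where "Rg \<equiv> ring_of_type_algebra"

lemma Rg_simps [simp]:
  "carrier (Rg :: 'a::comm_ring_1 ring) = UNIV" "x \<otimes>\<^bsub>Rg\<^esub> y = x * y" "x \<oplus>\<^bsub>Rg\<^esub> y = x + y"
  "\<one>\<^bsub>Rg\<^esub> = (1 :: 'a)" "\<zero>\<^bsub>Rg\<^esub> = (0 :: 'a)"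
  by (simp_all add: ring_of_type_algebra_def)

lemma ideal_Rg_iff: "ideal I (Rg :: 'a::comm_ring_1 ring) \<longleftrightarrow> is_ideal I"
proof
  assume I: "ideal I (Rg :: 'a ring)"
  interpret ideal I Rg by (rule I)
  show "is_ideal I"
    using additive_subgroup.zero_closed[OF ideal.axioms(1)[OF I]]
      additive_subgroup.a_closed[OF ideal.axioms(1)[OF I]] I_l_closed by (auto simp: is_ideal_def)
next
  assume I: "is_ideal I"
  interpret R: cring "Rg :: 'a ring" by (rule cring_from_type_algebra)
  show "ideal I (Rg :: 'a ring)"
  proof (rule idealI)
    show "subgroup I (add_monoid (Rg :: 'a ring))"
    proof (rule R.add.subgroupI)
      fix a assume "a \<in> I"
      have "\<ominus>\<^bsub>Rg\<^esub> a = - a" by (rule R.minus_equality) simp_all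
      then show "\<ominus>\<^bsub>Rg\<^esub> a \<in> I" using is_idealD(5)[OF I \<open>a \<in> I\<close>] by simp
    qed (use is_idealD[OF I] in auto)
  qed (use is_idealD[OF I] R.ring_axioms in auto)
qed

lemma primeideal_Rg_iff: "primeideal P (Rg :: 'a::comm_ring_1 ring) \<longleftrightarrow> is_prime P"
proof
  assume P: "primeideal P (Rg :: 'a ring)"
  interpret primeideal P Rg by (rule P)
  have "is_ideal P" using is_ideal by (simp add: ideal_Rg_iff)
  moreover have "1 \<notin> P" using I_notcarr one_imp_carrier by auto
  ultimately show "is_prime P" using I_prime by (auto simp: is_prime_def)
next
  assume P: "is_prime P"
  show "primeideal P (Rg :: 'a ring)"
  proof (rule primeidealI)
    show "ideal P (Rg :: 'a ring)" using P by (simp add: ideal_Rg_iff is_prime_def)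
    show "carrier (Rg :: 'a ring) \<noteq> P" using P by (auto simp: is_prime_def)
    show "a \<in> P \<or> b \<in> P" if "a \<otimes>\<^bsub>Rg\<^esub> b \<in> P" for a b
      using that is_primeD(3)[OF P] by simp
  qed (rule cring_from_type_algebra)
qed

lemma genideal_Rg: "Idl\<^bsub>Rg\<^esub> {a, b, c} = gen3 a b (c :: 'a::comm_ring_1)"
proof
  interpret R: cring "Rg :: 'a ring" by (rule cring_from_type_algebra)
  have "ideal (gen3 a b c) Rg" by (simp add: ideal_Rg_iff is_ideal_gen3)
  moreover have "{a, b, c} \<subseteq> gen3 a b c" using gen3_mem[of a b c] gen3_mem[of b a c] gen3_mem[of c a b] by auto
  ultimately show "Idl\<^bsub>Rg\<^esub> {a, b, c} \<subseteq> gen3 a b c" by (rule R.genideal_minimal)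
  have "is_ideal (Idl\<^bsub>Rg\<^esub> {a, b, c})" using R.genideal_ideal[of "{a, b, c}"] by (simp add: ideal_Rg_iff)
  moreover have "{a, b, c} \<subseteq> Idl\<^bsub>Rg\<^esub> {a, b, c}" by (rule R.genideal_self) simp
  ultimately show "gen3 a b c \<subseteq> Idl\<^bsub>Rg\<^esub> {a, b, c}" by (intro gen3_least) auto
qed

lemma prime_height_Rg:
  "prime_height (Rg :: 'a::comm_ring_1 ring) P = Sup {enat m | m C. prime_chain C m \<and> C m = P}"
  unfolding prime_height_def primeideal_Rg_iff prime_chain_def by (simp only: conj_assoc)

lemma prime_height_le_iff: "prime_height (Rg :: 'a::comm_ring_1 ring) P \<le> enat k \<longleftrightarrow> height_le P k"
proof
  assume le: "prime_height (Rg :: 'a ring) P \<le> enat k"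
  show "height_le P k"
    unfolding height_le_def
  proof (intro allI impI)
    fix C m assume "prime_chain C m" "C m = P"
    then have "enat m \<le> prime_height (Rg :: 'a ring) P"
      unfolding prime_height_Rg by (intro Sup_upper) blast
    then show "m \<le> k" using le by (metis enat_ord_simps(1) order_trans)
  qed
next
  assume "height_le P k"
  then show "prime_height (Rg :: 'a ring) P \<le> enat k"
    unfolding prime_height_Rg height_le_def by (intro Sup_least) auto
qed

lemma prime_height_ge: "prime_chain C m \<Longrightarrow> C m = P \<Longrightarrow> enat m \<le> prime_height (Rg :: 'a::comm_ring_1 ring) P"
  unfolding prime_height_Rg by (intro Sup_upper) blast

section \<open>Cosets, associated primes and local rings of a quotient\<close>

lemma coset_Rg: "J +>\<^bsub>Rg\<^esub> x = (\<lambda>h. h + x) ` J" for x :: "'a::comm_ring_1"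
  by (auto simp: a_r_coset_def r_coset_def)

lemma coset_eq_iff:
  assumes "is_ideal (J :: 'a::comm_ring_1 set)"
  shows "J +>\<^bsub>Rg\<^esub> x = J +>\<^bsub>Rg\<^esub> y \<longleftrightarrow> x - y \<in> J"
proof
  assume eq: "J +>\<^bsub>Rg\<^esub> x = J +>\<^bsub>Rg\<^esub> y"
  have "x \<in> (\<lambda>h. h + x) ` J" using is_idealD(1)[OF assms] by force
  then obtain h where "x = h + y" "h \<in> J" using eq unfolding coset_Rg by auto
  then show "x - y \<in> J" by simp
next
  assume d: "x - y \<in> J"
  have "h + x \<in> (\<lambda>h. h + y) ` J" if "h \<in> J" for h
    by (rule image_eqI[of _ _ "h + (x - y)"]) (use is_idealD(2)[OF assms that d] in auto)
  moreover have "h + y \<in> (\<lambda>h. h + x) ` J" if "h \<in> J" for h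
    by (rule image_eqI[of _ _ "h - (x - y)"]) (use is_idealD(6)[OF assms that d] in auto)
  ultimately show "J +>\<^bsub>Rg\<^esub> x = J +>\<^bsub>Rg\<^esub> y" unfolding coset_Rg by blast
qed

lemma coset_zero: "J +>\<^bsub>Rg\<^esub> (0 :: 'a::comm_ring_1) = J"
  by (simp add: coset_Rg)

lemma quot_Rg:
  assumes "is_ideal (J :: 'a::comm_ring_1 set)"
  shows "cring (Rg Quot J)" "carrier (Rg Quot J) = range (\<lambda>x. J +>\<^bsub>Rg\<^esub> x)"
    "(J +>\<^bsub>Rg\<^esub> x) \<otimes>\<^bsub>Rg Quot J\<^esub> (J +>\<^bsub>Rg\<^esub> y) = J +>\<^bsub>Rg\<^esub> (x * y)"
    "\<zero>\<^bsub>Rg Quot J\<^esub> = J" "\<one>\<^bsub>Rg Quot J\<^esub> = J +>\<^bsub>Rg\<^esub> 1"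
proof -
  interpret ideal J "Rg :: 'a ring" using assms by (simp add: ideal_Rg_iff)
  show "cring (Rg Quot J)" by (rule quotient_is_cring[OF cring_from_type_algebra])
  show "carrier (Rg Quot J) = range (\<lambda>x. J +>\<^bsub>Rg\<^esub> x)"
    by (auto simp: FactRing_def A_RCOSETS_def')
  show "(J +>\<^bsub>Rg\<^esub> x) \<otimes>\<^bsub>Rg Quot J\<^esub> (J +>\<^bsub>Rg\<^esub> y) = J +>\<^bsub>Rg\<^esub> (x * y)"
    using rcoset_mult_add[of x y] by (simp add: FactRing_def)
  show "\<zero>\<^bsub>Rg Quot J\<^esub> = J" "\<one>\<^bsub>Rg Quot J\<^esub> = J +>\<^bsub>Rg\<^esub> 1" by (simp_all add: FactRing_def)
qed

lemma assoc_primes_Rg: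
  assumes J: "is_ideal (J :: 'a::comm_ring_1 set)"
  shows "assoc_primes Rg J = {P. is_prime P \<and> (\<exists>x. P = {r. r * x \<in> J})}"
proof -
  have "{r \<in> carrier Rg. (J +>\<^bsub>Rg\<^esub> r) \<otimes>\<^bsub>Rg Quot J\<^esub> (J +>\<^bsub>Rg\<^esub> x) = \<zero>\<^bsub>Rg Quot J\<^esub>} = {r. r * x \<in> J}" for x
    using coset_eq_iff[OF J, of _ 0] by (simp add: quot_Rg[OF J] coset_zero)
  then show ?thesis
    unfolding assoc_primes_def primeideal_Rg_iff quot_Rg(2)[OF J] by simp
qed

lemma localizable_quot:
  assumes J: "is_ideal (J :: 'a::comm_ring_1 set)" and P: "is_prime P" "J \<subseteq> P"
  defines "S \<equiv> carrier (Rg Quot J) - (\<lambda>r. J +>\<^bsub>Rg\<^esub> r) ` P"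
  shows "localizable (Rg Quot J) S" "\<zero>\<^bsub>Rg Quot J\<^esub> \<notin> S" "J +>\<^bsub>Rg\<^esub> r \<in> S \<longleftrightarrow> r \<notin> P"
proof -
  note iP = is_primeD(1)[OF P(1)]
  have mem: "J +>\<^bsub>Rg\<^esub> r \<in> S \<longleftrightarrow> r \<notin> P" for r
  proof -
    have "r \<in> P" if "J +>\<^bsub>Rg\<^esub> r = J +>\<^bsub>Rg\<^esub> p" "p \<in> P" for p
    proof -
      have "r - p \<in> P" using that(1) P(2) by (auto simp: coset_eq_iff[OF J])
      then show ?thesis using is_idealD(2)[OF iP _ that(2), of "r - p"] by simp
    qed
    then show ?thesis by (auto simp: S_def quot_Rg(2)[OF J])
  qed
  then show "J +>\<^bsub>Rg\<^esub> r \<in> S \<longleftrightarrow> r \<notin> P" .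
  show "\<zero>\<^bsub>Rg Quot J\<^esub> \<notin> S" using mem[of 0] is_idealD(1)[OF iP] by (simp add: quot_Rg[OF J] coset_zero)
  show "localizable (Rg Quot J) S"
  proof (intro localizable.intro localizable_axioms.intro)
    show "cring (Rg Quot J)" by (rule quot_Rg[OF J])
    show "S \<subseteq> carrier (Rg Quot J)" by (auto simp: S_def)
    show "\<one>\<^bsub>Rg Quot J\<^esub> \<in> S" using mem[of 1] P(1) by (simp add: quot_Rg[OF J] is_prime_def)
    fix s t assume st: "s \<in> S" "t \<in> S"
    then obtain a b where ab: "s = J +>\<^bsub>Rg\<^esub> a" "t = J +>\<^bsub>Rg\<^esub> b" by (auto simp: S_def quot_Rg(2)[OF J])
    then have "a * b \<notin> P" using st mem is_primeD(3)[OF P(1)] by auto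
    then show "s \<otimes>\<^bsub>Rg Quot J\<^esub> t \<in> S" unfolding ab using mem by (simp add: quot_Rg(3)[OF J])
  qed
qed

lemma ring_length_quot_local_ge_1:
  assumes J: "is_ideal (J :: 'a::comm_ring_1 set)" and P: "is_prime P" "J \<subseteq> P"
  shows "1 \<le> ring_length (quot_local Rg J P)"
  unfolding quot_local_def
  by (rule localizable.ring_length_localization_ge_1[OF localizable_quot(1,2)[OF assms]])

text \<open>A single multiplier \<open>u\<close> outside \<open>P\<close> that carries
  \<open>P\<close> into \<open>J\<close> makes P/J vanish in the localization, leaving the residue
  field of \<open>P\<close>.\<close>

lemma ring_length_quot_local_eq_1:
  assumes J: "is_ideal (J :: 'a::comm_ring_1 set)" and P: "is_prime P" "J \<subseteq> P"
    and u: "u \<notin> P" "\<And>a. a \<in> P \<Longrightarrow> u * a \<in> J"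
  shows "ring_length (quot_local Rg J P) = 1"
  unfolding quot_local_def
proof (rule localizable.ring_length_localization_eq_1[OF localizable_quot(1,2)[OF J P]])
  fix a assume a: "a \<in> carrier (Rg Quot J)" "a \<notin> carrier (Rg Quot J) - (\<lambda>r. J +>\<^bsub>Rg\<^esub> r) ` P"
  then obtain r where r: "a = J +>\<^bsub>Rg\<^esub> r" "r \<in> P" by auto
  have "(J +>\<^bsub>Rg\<^esub> u) \<otimes>\<^bsub>Rg Quot J\<^esub> a = \<zero>\<^bsub>Rg Quot J\<^esub>"
    using u(2)[OF r(2)] coset_eq_iff[OF J, of "u * r" 0] by (simp add: r(1) quot_Rg[OF J] coset_zero)
  moreover have "J +>\<^bsub>Rg\<^esub> u \<in> carrier (Rg Quot J) - (\<lambda>r. J +>\<^bsub>Rg\<^esub> r) ` P"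
    using localizable_quot(3)[OF J P] u(1) by blast
  ultimately show "\<exists>u\<in>carrier (Rg Quot J) - (\<lambda>r. J +>\<^bsub>Rg\<^esub> r) ` P. u \<otimes>\<^bsub>Rg Quot J\<^esub> a = \<zero>\<^bsub>Rg Quot J\<^esub>" ..
qed

section \<open>Hilbert polynomials\<close>

text \<open>One element for each leading monomial gives a basis: it spans by reduction, and in a
  vanishing combination the largest leading monomial with nonzero coefficient could not
  cancel.\<close>

lemma dim_eq_card_lms:
  fixes W :: "('n::{finite,linorder}, 'k::field) mpoly set"
  assumes W: "mp.subspace W" and fin: "finite (lms W)"
  shows "mp.dim W = card (lms W)"
proof -
  have "\<forall>m\<in>lms W. \<exists>f. f \<in> W \<and> f \<noteq> 0 \<and> lm f = m" by (auto simp: lms_def)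
  then obtain b where b: "\<And>m. m \<in> lms W \<Longrightarrow> b m \<in> W \<and> b m \<noteq> 0 \<and> lm (b m) = m" by metis
  have inj: "inj_on b (lms W)" by (rule inj_onI) (metis b)
  define B where "B = b ` lms W"
  have BW: "B \<subseteq> W" using b by (auto simp: B_def)
  have "0 \<notin> B" using b by (force simp: B_def)
  moreover have "lms W \<subseteq> lm ` B"
  proof
    fix m assume m: "m \<in> lms W"
    show "m \<in> lm ` B" by (rule image_eqI[of _ _ "b m"]) (use b[OF m] m in \<open>auto simp: B_def\<close>)
  qed
  ultimately have span: "W \<subseteq> mp.span B" using span_if_lms[OF W BW] by blast
  have "mp.independent B"
  proof (rule mp.independent_if_scalars_zero)
    show "finite B" using fin by (simp add: B_def)
    fix c :: "('n, 'k) mpoly \<Rightarrow> 'k" and x :: "('n, 'k) mpoly"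
    assume 0: "(\<Sum>x\<in>B. const (c x) * x) = 0" and x: "x \<in> B"
    have 1: "(\<Sum>m\<in>lms W. const (c (b m)) * b m) = 0"
      using 0 unfolding B_def by (subst (asm) sum.reindex[OF inj]) simp
    define M where "M = {m \<in> lms W. c (b m) \<noteq> 0}"
    have "M = {}"
    proof (rule ccontr)
      assume ne: "M \<noteq> {}"
      have finM: "finite M" using fin by (simp add: M_def)
      define m where "m = Max M"
      have m: "m \<in> lms W" "c (b m) \<noteq> 0" using Max_in[OF finM ne] by (auto simp: m_def M_def)
      have "Poly_Mapping.lookup (const (c (b m')) * b m') m = 0" if m': "m' \<in> lms W - {m}" for m'
      proof (cases "m' \<in> M")
        case True
        then have "m' < m" using Max_ge[OF finM True] m' by (simp add: m_def less_le)
        then have "m \<notin> Poly_Mapping.keys (b m')" using lm_ge[of m "b m'"] b[of m'] m' by auto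
        then show ?thesis using lookup_single_mult[of 0 "c (b m')" "b m'" m] by (simp add: in_keys_iff)
      next
        case False
        then show ?thesis using m' by (simp add: M_def)
      qed
      then have "Poly_Mapping.lookup (\<Sum>m\<in>lms W. const (c (b m)) * b m) m
          = Poly_Mapping.lookup (const (c (b m)) * b m) m"
        unfolding lookup_sum using m(1) fin by (subst sum.remove[of _ m]) auto
      also have "\<dots> = c (b m) * Poly_Mapping.lookup (b m) m"
        using lookup_single_mult[of 0 "c (b m)" "b m" m] by simp
      also have "\<dots> \<noteq> 0" using m(2) lm_in_keys[of "b m"] b[OF m(1)] by (simp add: in_keys_iff)
      finally show False unfolding 1 by simp
    qed
    then show "c x = 0" using x by (auto simp: M_def B_def)
  qed
  moreover have "card B = card (lms W)" unfolding B_def by (rule card_image[OF inj])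
  ultimately show ?thesis using mp.dim_unique[OF BW span] by simp
qed

lemma finite_mdeg: "finite {m :: 'n::finite \<Rightarrow>\<^sub>0 nat. mdeg m = t}"
proof -
  have "Poly_Mapping.lookup m i \<le> mdeg m" for m :: "'n \<Rightarrow>\<^sub>0 nat" and i
    unfolding mdeg_def by (rule member_le_sum) auto
  then have "{m :: 'n \<Rightarrow>\<^sub>0 nat. mdeg m = t} \<subseteq> {m. \<forall>i. Poly_Mapping.lookup m i \<in> {..t}}" by auto
  then show ?thesis using box_monomials(1)[of "\<lambda>i :: 'n. {..t}"] finite_subset by auto
qed

lemma subspace_forms: "mp.subspace (forms t)"
  unfolding mp.subspace_def forms_eq_whom
proof (intro conjI ballI allI)
  fix c f assume "f \<in> whom UNIV t"
  then show "const c * f \<in> whom UNIV t" using whom_mult[OF whom_const, of f UNIV t c] by simp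
qed (auto intro: whom_add)

lemma mdeg_lm: "g \<in> forms t \<Longrightarrow> g \<noteq> 0 \<Longrightarrow> mdeg (lm g) = t"
  using lm_in_keys[of g] by (auto simp: forms_def)

lemma lms_inter_forms: "lms (P \<inter> forms t) = {m \<in> init P. mdeg m = t}"
proof
  show "lms (P \<inter> forms t) \<subseteq> {m \<in> init P. mdeg m = t}"
    using mdeg_lm by (auto simp: lms_def init_def)
  show "{m \<in> init P. mdeg m = t} \<subseteq> lms (P \<inter> forms t)"
    by (auto simp: lms_def init_def)
qed

lemma lms_forms: "lms (forms t :: ('n::{finite,linorder}, 'k::field) mpoly set) = {m. mdeg m = t}"
proof
  show "lms (forms t :: ('n, 'k) mpoly set) \<subseteq> {m. mdeg m = t}"
    using mdeg_lm by (auto simp: lms_def)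
  show "{m. mdeg m = t} \<subseteq> lms (forms t :: ('n, 'k) mpoly set)"
  proof
    fix m :: "'n \<Rightarrow>\<^sub>0 nat" assume "m \<in> {m. mdeg m = t}"
    then show "m \<in> lms (forms t :: ('n, 'k) mpoly set)"
      unfolding lms_def by (intro image_eqI[of _ _ "monom_of m"]) (auto simp: lm_def forms_def single_eq_0_iff)
  qed
qed

text \<open>Macaulay: forms in \<open>P\<close> and monomials of its initial ideal have the same
  dimension in each degree, which reduces Hilbert functions to counting monomials.\<close>

lemma hilbert_fun_eq:
  fixes P :: "('n::{finite,linorder}, 'k::field) mpoly set"
  assumes "is_ideal P"
  shows "hilbert_fun P t = real (card {m. m \<notin> init P \<and> mdeg m = t})"
proof -
  have "kdim (forms t :: ('n, 'k) mpoly set) = card {m :: 'n \<Rightarrow>\<^sub>0 nat. mdeg m = t}"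
    unfolding kdim_def using dim_eq_card_lms[OF subspace_forms] by (simp add: lms_forms finite_mdeg)
  moreover have "kdim (P \<inter> forms t) = card {m \<in> init P. mdeg m = t}"
  proof -
    have "finite {m \<in> init P. mdeg m = t}" by (rule finite_subset[OF _ finite_mdeg[of t]]) auto
    then show ?thesis
      unfolding kdim_def
      using dim_eq_card_lms[OF mp.subspace_inter[OF subspace_ideal[OF assms] subspace_forms]]
      by (simp add: lms_inter_forms)
  qed
  moreover have "card {m :: 'n \<Rightarrow>\<^sub>0 nat. mdeg m = t} = card {m \<in> init P. mdeg m = t} + card {m. m \<notin> init P \<and> mdeg m = t}"
  proof -
    have eq: "{m :: 'n \<Rightarrow>\<^sub>0 nat. mdeg m = t} = {m \<in> init P. mdeg m = t} \<union> {m. m \<notin> init P \<and> mdeg m = t}" by auto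
    have fin: "finite {m \<in> init P. mdeg m = t}" "finite {m. m \<notin> init P \<and> mdeg m = t}"
      by (rule finite_subset[OF _ finite_mdeg[of t]], blast)+
    have "{m \<in> init P. mdeg m = t} \<inter> {m. m \<notin> init P \<and> mdeg m = t} = {}" by auto
    from card_Un_disjoint[OF fin this] show ?thesis unfolding eq[symmetric] .
  qed
  ultimately show ?thesis by (simp add: hilbert_fun_def)
qed

text \<open>Otherwise \<open>P\<close> would contain all forms of degree \<open>t\<close>, among
  them a power of a variable outside \<open>P\<close>.\<close>

lemma hilbert_fun_pos:
  fixes P :: "('n::{finite,linorder}, 'k::field) mpoly set"
  assumes P: "is_prime P" and x: "var x \<notin> P"
  shows "hilbert_fun P t \<ge> 1"
proof -
  note iP = is_primeD(1)[OF P]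
  have "{m. m \<notin> init P \<and> mdeg m = t} \<noteq> {}"
  proof
    assume "{m. m \<notin> init P \<and> mdeg m = t} = {}"
    then have sub: "lms (forms t :: ('n, 'k) mpoly set) \<subseteq> lms (P \<inter> forms t)"
      unfolding lms_forms lms_inter_forms by blast
    have "forms t \<subseteq> mp.span (P \<inter> forms t - {0})"
      using sub by (intro span_if_lms[OF subspace_forms]) (auto simp: lms_def)
    also have "\<dots> \<subseteq> P" by (rule mp.span_minimal[OF _ subspace_ideal[OF iP]]) auto
    finally have "forms t \<subseteq> P" .
    moreover have "var x ^ t \<in> forms t"
      by (simp add: forms_eq_whom var_power wt_UNIV mdeg_def lookup_single when_def)
    ultimately show False using is_prime_power[OF P] x by blast
  qed
  moreover have "finite {m. m \<notin> init P \<and> mdeg m = t}" by (rule finite_subset[OF _ finite_mdeg[of t]]) auto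
  ultimately have "card {m. m \<notin> init P \<and> mdeg m = t} \<ge> 1" by (simp add: Suc_le_eq card_gt_0_iff)
  then show ?thesis unfolding hilbert_fun_eq[OF iP] by simp
qed

subsection \<open>Counting monomials\<close>

text \<open>The standard monomials of degree \<open>t\<close>, restricted to the variables in
  \<open>V\<close> for the sake of induction on their number.\<close>

definition std :: "'n set \<Rightarrow> ('n::finite \<Rightarrow>\<^sub>0 nat) set \<Rightarrow> nat \<Rightarrow> ('n \<Rightarrow>\<^sub>0 nat) set" where
  "std V U t = {m. (\<forall>i. i \<notin> V \<longrightarrow> Poly_Mapping.lookup m i = 0) \<and> m \<notin> U \<and> mdeg m = t}"

lemma mdeg_add: "mdeg (a + b) = mdeg a + mdeg b"
  by (simp add: mdeg_def lookup_add sum.distrib)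

lemma mdeg_single [simp]: "mdeg (Poly_Mapping.single x j) = j"
  by (simp add: mdeg_def lookup_single when_def)

lemma finite_std: "finite (std V U t)"
  by (rule finite_subset[OF _ finite_mdeg[of t]]) (auto simp: std_def)

text \<open>The monomials are sliced by the exponent j of \<open>x\<close>; dividing a slice by x^j
  leaves the standard monomials in one variable fewer for a shifted \<open>U\<close>.\<close>

lemma card_std_insert:
  assumes x: "x \<notin> V"
  shows "card (std (insert x V) U t) = (\<Sum>j\<le>t. card (std V {m. m + Poly_Mapping.single x j \<in> U} (t - j)))"
proof -
  define F where "F = (\<lambda>j. (\<lambda>m. m + Poly_Mapping.single x j) ` std V {m. m + Poly_Mapping.single x j \<in> U} (t - j))"
  have look: "Poly_Mapping.lookup m x = j" if "m \<in> F j" for m j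
    using that x by (auto simp: F_def std_def lookup_add)
  have "std (insert x V) U t = (\<Union>j\<in>{..t}. F j)"
  proof
    show "(\<Union>j\<in>{..t}. F j) \<subseteq> std (insert x V) U t"
      using x by (auto simp: F_def std_def mdeg_add lookup_add lookup_single when_def)
    show "std (insert x V) U t \<subseteq> (\<Union>j\<in>{..t}. F j)"
    proof
      fix m assume m: "m \<in> std (insert x V) U t"
      define j where "j = Poly_Mapping.lookup m x"
      define m' where "m' = m - Poly_Mapping.single x j"
      have e: "m = m' + Poly_Mapping.single x j"
        by (rule poly_mapping_eqI) (auto simp: m'_def j_def lookup_add lookup_minus lookup_single when_def)
      have d: "mdeg m = mdeg m' + j" using e mdeg_add by (metis mdeg_single)
      have "Poly_Mapping.lookup m' i = 0" if "i \<notin> V" for i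
        using m that by (cases "i = x") (auto simp: std_def m'_def j_def lookup_minus lookup_single when_def)
      moreover have "m' + Poly_Mapping.single x j \<notin> U" using m e by (auto simp: std_def)
      moreover have "mdeg m' = t - j" "j \<le> t" using d m by (auto simp: std_def)
      ultimately have "m' \<in> std V {m. m + Poly_Mapping.single x j \<in> U} (t - j)" "j \<le> t" by (auto simp: std_def)
      then have "m \<in> F j" unfolding F_def e by blast
      then show "m \<in> (\<Union>j\<in>{..t}. F j)" using \<open>j \<le> t\<close> by auto
    qed
  qed
  also have "card \<dots> = (\<Sum>j\<le>t. card (F j))"
  proof (rule card_UN_disjoint)
    show "\<forall>i\<in>{..t}. \<forall>j\<in>{..t}. i \<noteq> j \<longrightarrow> F i \<inter> F j = {}"
    proof (intro ballI impI)
      fix i j :: nat assume "i \<noteq> j"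
      then show "F i \<inter> F j = {}" using look[of _ i] look[of _ j] by auto
    qed
  qed (simp_all add: F_def finite_std)
  also have "\<dots> = (\<Sum>j\<le>t. card (std V {m. m + Poly_Mapping.single x j \<in> U} (t - j)))"
    unfolding F_def by (intro sum.cong card_image inj_onI) auto
  finally show ?thesis .
qed

section \<open>Functions that are eventually polynomial\<close>

definition eventually_poly :: "(nat \<Rightarrow> real) \<Rightarrow> bool" where
  "eventually_poly g \<longleftrightarrow> (\<exists>p. \<forall>\<^sub>F t in sequentially. poly p (real t) = g t)"

lemma eventually_poly_add:
  assumes "eventually_poly g" "eventually_poly h"
  shows "eventually_poly (\<lambda>t. g t + h t)"
proof -
  obtain p q where "\<forall>\<^sub>F t in sequentially. poly p (real t) = g t" "\<forall>\<^sub>F t in sequentially. poly q (real t) = h t"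
    using assms unfolding eventually_poly_def by blast
  then have "\<forall>\<^sub>F t in sequentially. poly (p + q) (real t) = g t + h t"
    by eventually_elim simp
  then show ?thesis unfolding eventually_poly_def by blast
qed

lemma eventually_poly_0: "eventually_poly (\<lambda>t. 0)"
  unfolding eventually_poly_def by (rule exI[of _ 0]) simp

lemma eventually_poly_sum: "(\<And>j. j \<in> A \<Longrightarrow> eventually_poly (g j)) \<Longrightarrow> eventually_poly (\<lambda>t. \<Sum>j\<in>A. g j t)"
  by (induction A rule: infinite_finite_induct) (auto intro: eventually_poly_add eventually_poly_0)

lemma eventually_poly_shift:
  assumes "eventually_poly g"
  shows "eventually_poly (\<lambda>t. g (t - j))"
proof -
  obtain p where "\<forall>\<^sub>F t in sequentially. poly p (real t) = g t" using assms unfolding eventually_poly_def by blast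
  then obtain N where N: "\<And>t. t \<ge> N \<Longrightarrow> poly p (real t) = g t" by (auto simp: eventually_sequentially)
  have "poly (pcompose p [:- real j, 1:]) (real t) = g (t - j)" if "t \<ge> N + j" for t
    using N[of "t - j"] that by (simp add: poly_pcompose of_nat_diff)
  then show ?thesis unfolding eventually_poly_def eventually_sequentially by blast
qed

lemma eventually_poly_cong:
  assumes "\<And>t. t \<ge> N \<Longrightarrow> g t = h t" "eventually_poly g"
  shows "eventually_poly h"
proof -
  obtain p where "\<forall>\<^sub>F t in sequentially. poly p (real t) = g t" using assms(2) unfolding eventually_poly_def by blast
  moreover have "\<forall>\<^sub>F t in sequentially. g t = h t" using assms(1) by (auto simp: eventually_sequentially)
  ultimately have "\<forall>\<^sub>F t in sequentially. poly p (real t) = h t" by eventually_elim simp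
  then show ?thesis unfolding eventually_poly_def by blast
qed

text \<open>The differences (i + 1)^(k + 1) - i^(k + 1) telescope; expanding them binomially
  expresses the sum of k-th powers through sums of lower powers.\<close>

lemma power_sum_poly: "\<exists>q. \<forall>n. poly q (real n) = (\<Sum>i\<le>n. real i ^ k)"
proof (induction k rule: less_induct)
  case (less k)
  then obtain q where q: "\<And>l n. l < k \<Longrightarrow> poly (q l) (real n) = (\<Sum>i\<le>n. real i ^ l)" by metis
  define r where "r = smult (1 / real (Suc k)) ([:1, 1:] ^ Suc k - (\<Sum>l<k. smult (real (Suc k choose l)) (q l)))"
  have "poly r (real n) = (\<Sum>i\<le>n. real i ^ k)" for n
  proof -
    have "(\<Sum>i\<le>n. (real i + 1) ^ Suc k - real i ^ Suc k) = (real n + 1) ^ Suc k"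
      by (induction n) (simp_all add: add.commute)
    moreover have "(real i + 1) ^ Suc k - real i ^ Suc k
        = (\<Sum>l<k. real (Suc k choose l) * real i ^ l) + real (Suc k) * real i ^ k" for i
    proof -
      have "(real i + 1) ^ Suc k = (\<Sum>l\<le>Suc k. real (Suc k choose l) * real i ^ l)"
        using binomial_ring[of "real i" 1 "Suc k"] by simp
      also have "\<dots> = (\<Sum>l\<le>k. real (Suc k choose l) * real i ^ l) + real i ^ Suc k"
        by (simp del: power_Suc)
      also have "(\<Sum>l\<le>k. real (Suc k choose l) * real i ^ l)
          = (\<Sum>l<k. real (Suc k choose l) * real i ^ l) + real (Suc k) * real i ^ k"
        by (simp add: lessThan_Suc_atMost[symmetric])
      finally show ?thesis by simp
    qed
    ultimately have "(real n + 1) ^ Suc k = (\<Sum>i\<le>n. (\<Sum>l<k. real (Suc k choose l) * real i ^ l) + real (Suc k) * real i ^ k)"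
      by simp
    also have "\<dots> = (\<Sum>l<k. real (Suc k choose l) * (\<Sum>i\<le>n. real i ^ l)) + real (Suc k) * (\<Sum>i\<le>n. real i ^ k)"
      by (subst sum.distrib, subst sum.swap) (simp only: sum_distrib_left)
    finally have "real (Suc k) * (\<Sum>i\<le>n. real i ^ k)
        = (real n + 1) ^ Suc k - (\<Sum>l<k. real (Suc k choose l) * (\<Sum>i\<le>n. real i ^ l))" by simp
    also have "\<dots> = real (Suc k) * poly r (real n)"
      by (simp add: r_def poly_sum q poly_power add.commute del: power_Suc)
    finally show ?thesis by simp
  qed
  then show ?case by blast
qed

lemma sum_poly: "\<exists>q. \<forall>n. poly q (real n) = (\<Sum>i\<le>n. poly p (real i))"
proof -
  obtain s where s: "\<And>k n. poly (s k) (real n) = (\<Sum>i\<le>n. real i ^ k)" using power_sum_poly by metis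
  have "poly (\<Sum>k\<le>Polynomial.degree p. smult (Polynomial.coeff p k) (s k)) (real n) = (\<Sum>i\<le>n. poly p (real i))" for n
    by (simp add: poly_sum s poly_altdef[of p] sum_distrib_left) (rule sum.swap)
  then show ?thesis by blast
qed

lemma eventually_poly_partial_sums:
  assumes "eventually_poly g"
  shows "eventually_poly (\<lambda>t. \<Sum>i\<le>t. g i)"
proof -
  obtain p where "\<forall>\<^sub>F t in sequentially. poly p (real t) = g t" using assms unfolding eventually_poly_def by blast
  then obtain N where N: "\<And>t. t \<ge> N \<Longrightarrow> poly p (real t) = g t" by (auto simp: eventually_sequentially)
  obtain q where q: "\<And>n. poly q (real n) = (\<Sum>i\<le>n. poly p (real i))" using sum_poly by metis
  \<comment> \<open>The finitely many places where \<open>g\<close> may differ from the polynomial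
    contribute a constant.\<close>
  define c where "c = (\<Sum>i<N. g i - poly p (real i))"
  have "poly (q + [:c:]) (real t) = (\<Sum>i\<le>t. g i)" if t: "t \<ge> N" for t
  proof -
    have "(\<Sum>i\<le>t. g i - poly p (real i)) = c"
      unfolding c_def using t N by (intro sum.mono_neutral_right) auto
    then show ?thesis by (simp add: q sum_subtractf)
  qed
  then show ?thesis unfolding eventually_poly_def eventually_sequentially by blast
qed

text \<open>Slicing by the exponent of one variable gives an increasing chain of monomial ideals in
  the others, which stabilizes at some N: there remain finitely many shifted functions and the
  partial sums of the stable one.\<close>

lemma eventually_poly_card_std:
  fixes V :: "'n::finite set"
  assumes "upclosed U"
  shows "eventually_poly (\<lambda>t. real (card (std V U t)))"
proof -
  have "finite V" by simp
  then have "\<forall>U. upclosed U \<longrightarrow> eventually_poly (\<lambda>t. real (card (std V U t)))"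
  proof (induction V rule: finite_induct)
    case empty
    have "std {} U t = {}" if "t \<ge> 1" for U :: "('n \<Rightarrow>\<^sub>0 nat) set" and t
    proof -
      have "mdeg m = 0" if "\<forall>i. Poly_Mapping.lookup m i = 0" for m :: "'n \<Rightarrow>\<^sub>0 nat"
        using that by (simp add: mdeg_def)
      then show ?thesis using that by (auto simp: std_def)
    qed
    then have "eventually_poly (\<lambda>t. real (card (std {} U t)))" for U :: "('n \<Rightarrow>\<^sub>0 nat) set"
      by (intro eventually_poly_cong[OF _ eventually_poly_0, of 1]) simp
    then show ?case by blast
  next
    case (insert x V)
    have "eventually_poly (\<lambda>t. real (card (std (insert x V) U t)))" if U: "upclosed U" for U
    proof -
      define W where "W = (\<lambda>j. {m. m + Poly_Mapping.single x j \<in> U})"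
      have up: "upclosed (W j)" for j
        unfolding upclosed_def W_def
      proof (intro ballI allI)
        fix m a assume "m \<in> {m. m + Poly_Mapping.single x j \<in> U}"
        then have "m + Poly_Mapping.single x j + a \<in> U" using U by (simp add: upclosed_def)
        then show "m + a \<in> {m. m + Poly_Mapping.single x j \<in> U}" by (simp add: ac_simps)
      qed
      have "W j \<subseteq> W (Suc j)" for j
      proof
        fix m assume "m \<in> W j"
        then have "m + Poly_Mapping.single x j + Poly_Mapping.single x 1 \<in> U"
          using U by (simp add: upclosed_def W_def)
        then show "m \<in> W (Suc j)" by (simp add: W_def add.assoc flip: single_add)
      qed
      then have "\<exists>N. \<forall>i\<ge>N. W i = W N" by (intro upclosed_chain_stabilizes up)
      then obtain N where N: "\<And>i. i \<ge> N \<Longrightarrow> W i = W N" by metis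
      define g where "g = (\<lambda>j t. real (card (std V (W j) t)))"
      have g: "eventually_poly (g j)" for j unfolding g_def using insert.IH up by blast
      have "eventually_poly (\<lambda>t. (\<Sum>j<N. g j (t - j)) + (\<Sum>i\<le>t - N. g N i))"
        by (intro eventually_poly_add eventually_poly_sum eventually_poly_shift g)
          (rule eventually_poly_partial_sums[OF g])
      then show ?thesis
      proof (rule eventually_poly_cong[rotated])
        fix t assume t: "N \<le> t"
        have "real (card (std (insert x V) U t)) = (\<Sum>j\<le>t. g j (t - j))"
          by (simp add: card_std_insert[OF insert.hyps(2)] g_def W_def)
        also have "\<dots> = (\<Sum>j<N. g j (t - j)) + (\<Sum>j\<in>{N..t}. g j (t - j))"
          using t by (subst sum.union_disjoint[symmetric]) (auto intro: sum.cong)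
        also have "(\<Sum>j\<in>{N..t}. g j (t - j)) = (\<Sum>j\<in>{N..t}. g N (t - j))"
        proof (rule sum.cong[OF refl])
          fix j assume "j \<in> {N..t}"
          then have "W j = W N" by (intro N) simp
          then show "g j (t - j) = g N (t - j)" unfolding g_def by (rule arg_cong)
        qed
        also have "\<dots> = (\<Sum>i\<le>t - N. g N i)"
          by (rule sum.reindex_bij_witness[of _ "\<lambda>i. t - i" "\<lambda>j. t - j"]) (use t in auto)
        finally show "(\<Sum>j<N. g j (t - j)) + (\<Sum>i\<le>t - N. g N i) = real (card (std (insert x V) U t))" by simp
      qed
    qed
    then show ?case by blast
  qed
  then show ?thesis using assms by blast
qed

text \<open>Stars and bars, since nothing is excluded; the slicing by one exponent turns it into the
  hockey-stick identity.\<close>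

lemma card_std_empty:
  fixes V :: "'n::finite set"
  assumes "V \<noteq> {}"
  shows "card (std V {} t) = (t + (card V - 1)) choose (card V - 1)"
proof -
  have "finite V" by simp
  then have "\<forall>t. card (std V {} t) = (t + (card V - 1)) choose (card V - 1)"
    using assms
  proof (induction V rule: finite_ne_induct)
    case (singleton x)
    have "std {x} {} t = {Poly_Mapping.single x t}" for t
    proof
      show "{Poly_Mapping.single x t} \<subseteq> std {x} {} t"
        by (auto simp: std_def lookup_single when_def)
      show "std {x} {} t \<subseteq> {Poly_Mapping.single x t}"
      proof
        fix m assume m: "m \<in> std {x} {} t"
        have "m = Poly_Mapping.single x (Poly_Mapping.lookup m x)"
          using m by (intro poly_mapping_eqI) (auto simp: std_def lookup_single when_def)
        then show "m \<in> {Poly_Mapping.single x t}" using m unfolding std_def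
          by (metis (mono_tags, lifting) insertI1 mdeg_single mem_Collect_eq)
      qed
    qed
    then show ?case by simp
  next
    case (insert x V)
    define k where "k = card V - 1"
    have cV: "card V = Suc k" using insert.hyps by (simp add: k_def card_gt_0_iff)
    have "card (std (insert x V) {} t) = (t + Suc k) choose Suc k" for t
    proof -
      have "card (std (insert x V) {} t) = (\<Sum>j\<le>t. card (std V {} (t - j)))"
        using card_std_insert[OF insert.hyps(3), of "{}" t] by simp
      also have "\<dots> = (\<Sum>j\<le>t. (t - j + k) choose k)" using insert.IH by (simp add: k_def)
      also have "\<dots> = (\<Sum>j\<le>t. (j + k) choose k)"
        by (rule sum.reindex_bij_witness[of _ "\<lambda>i. t - i" "\<lambda>j. t - j"]) auto
      also have "\<dots> = (t + Suc k) choose Suc k"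
        by (induction t) (simp_all add: add.commute)
      finally show ?thesis .
    qed
    moreover have "card (insert x V) - 1 = Suc k" using insert.hyps cV by simp
    ultimately show ?case by simp
  qed
  then show ?thesis by blast
qed

subsection \<open>The degree of a prime ideal\<close>

lemma hilbert_poly_eqI:
  assumes "\<forall>\<^sub>F t in sequentially. poly H (real t) = hilbert_fun P t"
  shows "hilbert_poly P = H"
  unfolding hilbert_poly_def
proof (rule the_equality)
  show "\<forall>\<^sub>F t in sequentially. poly H (real t) = hilbert_fun P t" by (rule assms)
  fix G assume G: "\<forall>\<^sub>F t in sequentially. poly G (real t) = hilbert_fun P t"
  have "\<forall>\<^sub>F t in sequentially. poly (G - H) (real t) = 0"
    using assms G by eventually_elim simp
  then obtain N where N: "\<And>t. t \<ge> N \<Longrightarrow> poly (G - H) (real t) = 0" by (auto simp: eventually_sequentially)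
  have "infinite (real ` {N..})" by (simp add: finite_image_iff infinite_Ici)
  moreover have "real ` {N..} \<subseteq> {x. poly (G - H) x = 0}" using N by auto
  ultimately have "infinite {x. poly (G - H) x = 0}" using finite_subset by blast
  then have "G - H = 0" using poly_roots_finite by blast
  then show "G = H" by simp
qed

lemma hilbert_poly_exists:
  assumes "is_ideal P"
  shows "\<forall>\<^sub>F t in sequentially. poly (hilbert_poly P) (real t) = hilbert_fun P t"
proof -
  have "std UNIV (init P) t = {m. m \<notin> init P \<and> mdeg m = t}" for t by (auto simp: std_def)
  then have "eventually_poly (hilbert_fun P)"
    using eventually_poly_card_std[OF upclosed_init[OF assms], of UNIV]
    by (simp add: hilbert_fun_eq[OF assms, abs_def])
  then obtain H where H: "\<forall>\<^sub>F t in sequentially. poly H (real t) = hilbert_fun P t"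
    unfolding eventually_poly_def by blast
  show ?thesis using H unfolding hilbert_poly_eqI[OF H] .
qed

lemma lead_coeff_nonneg:
  fixes p :: "real poly"
  assumes "\<forall>\<^sub>F t in sequentially. poly p (real t) \<ge> 0"
  shows "lead_coeff p \<ge> 0"
proof (rule ccontr)
  assume "\<not> lead_coeff p \<ge> 0"
  then have "lead_coeff (- p) > 0" by (simp add: lead_coeff_minus)
  then obtain n where n: "\<And>x. x \<ge> n \<Longrightarrow> poly (- p) x \<ge> lead_coeff (- p)"
    using poly_pinfty_gt_lc by blast
  obtain N where N: "\<And>t. t \<ge> N \<Longrightarrow> poly p (real t) \<ge> 0" using assms by (auto simp: eventually_sequentially)
  define t where "t = max N (nat \<lceil>n\<rceil>)"
  have "real t \<ge> n" "t \<ge> N" by (auto simp: t_def) linarith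
  then show False using n[of "real t"] N[of t] \<open>lead_coeff (- p) > 0\<close> by simp
qed

lemma quot_degree_nonneg:
  assumes "is_ideal P"
  shows "quot_degree P \<ge> 0"
proof -
  have "\<forall>\<^sub>F t in sequentially. poly (hilbert_poly P) (real t) \<ge> 0"
    using hilbert_poly_exists[OF assms] by eventually_elim (simp add: hilbert_fun_eq[OF assms])
  then show ?thesis unfolding quot_degree_def using lead_coeff_nonneg by simp
qed

text \<open>A variable outside \<open>P\<close> keeps the Hilbert function at least 1, so the
  Hilbert polynomial is not zero.\<close>

lemma quot_degree_pos:
  assumes "is_prime P" "var x \<notin> P"
  shows "quot_degree P > 0"
proof -
  note iP = is_primeD(1)[OF assms(1)]
  have "hilbert_poly P \<noteq> 0"
  proof
    assume "hilbert_poly P = 0"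
    then have "\<forall>\<^sub>F t in sequentially. 0 = hilbert_fun P t" using hilbert_poly_exists[OF iP] by simp
    then obtain N where N: "\<forall>t\<ge>N. 0 = hilbert_fun P t" unfolding eventually_sequentially ..
    have "0 = hilbert_fun P N" by (rule N[rule_format, OF order_refl])
    then show False using hilbert_fun_pos[OF assms, of N] by simp
  qed
  then show ?thesis using quot_degree_nonneg[OF iP] by (simp add: quot_degree_def less_le)
qed

text \<open>The polynomial (t + 1)...(t + k) / k!, whose values count the monomials of degree t in k
  + 1 variables.\<close>

definition binomial_poly :: "nat \<Rightarrow> real poly" where
  "binomial_poly k = smult (1 / fact k) (\<Prod>i\<in>{1..k}. [:real i, 1:])"

lemma poly_binomial_poly: "poly (binomial_poly k) (real t) = real ((t + k) choose k)"
proof -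
  have "(\<Prod>i\<in>{1..k}. real i + real t) = fact (t + k) / fact t"
  proof (induction k)
    case (Suc k)
    have "(\<Prod>i\<in>{1..Suc k}. real i + real t) = (real (Suc k) + real t) * (\<Prod>i\<in>{1..k}. real i + real t)"
      by (simp add: prod.nat_ivl_Suc')
    moreover have "fact (t + Suc k) = (real (Suc k) + real t) * fact (t + k)"
      by (simp add: algebra_simps)
    ultimately show ?case using Suc by simp
  qed simp
  moreover have "real ((t + k) choose k) = fact (t + k) / (fact k * fact t)"
    using binomial_fact[of k "t + k"] by simp
  ultimately show ?thesis by (simp add: binomial_poly_def poly_prod)
qed

lemma degree_binomial_poly: "Polynomial.degree (binomial_poly k) = k"
  and lead_coeff_binomial_poly: "lead_coeff (binomial_poly k) = 1 / fact k"
proof -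
  have "Polynomial.degree (\<Prod>i\<in>{1..k}. [:real i, 1:]) = k"
    by (subst degree_prod_eq_sum_degree) auto
  then show d: "Polynomial.degree (binomial_poly k) = k" by (simp add: binomial_poly_def)
  have "lead_coeff (\<Prod>i\<in>{1..k}. [:real i, 1:]) = 1" by (simp add: lead_coeff_prod)
  then show "lead_coeff (binomial_poly k) = 1 / fact k" by (simp add: binomial_poly_def lead_coeff_smult)
qed

section \<open>Ideals generated by variables\<close>

text \<open>The ideal generated by the variables in \<open>T\<close>, defined as the kernel of
  setting them to 0; this is multiplicative with values in a domain, so primality is
  immediate.\<close>

definition var_ideal :: "'n set \<Rightarrow> ('n::{finite,linorder}, 'k::field) mpoly set" where
  "var_ideal T = {f. hcomp T 0 f = 0}"

lemma var_ideal_iff: "f \<in> var_ideal T \<longleftrightarrow> (\<forall>m\<in>Poly_Mapping.keys f. wt T m \<noteq> 0)"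
proof -
  have "f \<in> var_ideal T \<longleftrightarrow> Poly_Mapping.keys (hcomp T 0 f) = {}" by (simp add: var_ideal_def)
  then show ?thesis unfolding keys_hcomp by auto
qed

lemma is_prime_var_ideal: "is_prime (var_ideal T)"
  unfolding is_prime_def is_ideal_def var_ideal_def by (auto simp: hcomp_add hcomp_mult_0)

lemma var_in_var_ideal_iff: "var i \<in> var_ideal T \<longleftrightarrow> i \<in> T"
  by (simp add: var_ideal_iff var_def wt_def lookup_single when_def sum.delta)

lemma var_ideal_subset:
  fixes I :: "('n::{finite,linorder}, 'k::field) mpoly set"
  assumes I: "is_ideal I" and v: "\<And>i. i \<in> T \<Longrightarrow> var i \<in> I"
  shows "var_ideal T \<subseteq> I"
proof
  fix f :: "('n, 'k) mpoly" assume f: "f \<in> var_ideal T"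
  have "(\<Sum>m\<in>Poly_Mapping.keys f. Poly_Mapping.single m (Poly_Mapping.lookup f m)) \<in> I"
  proof (rule is_ideal_sum[OF I])
    fix m assume "m \<in> Poly_Mapping.keys f"
    then have "wt T m \<noteq> 0" using f by (simp add: var_ideal_iff)
    then obtain i where i: "i \<in> T" "Poly_Mapping.lookup m i \<noteq> 0" by (auto simp: wt_eq_0_iff)
    have "m - Poly_Mapping.single i 1 + Poly_Mapping.single i 1 = m"
      using i(2) by (intro poly_mapping_eqI) (auto simp: lookup_add lookup_minus lookup_single when_def)
    then have "Poly_Mapping.single (m - Poly_Mapping.single i 1) (Poly_Mapping.lookup f m) * var i
        = Poly_Mapping.single m (Poly_Mapping.lookup f m)"
      by (simp add: var_def mult_single)
    then show "Poly_Mapping.single m (Poly_Mapping.lookup f m) \<in> I"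
      using is_idealD(3)[OF I v[OF i(1)]] by metis
  qed
  then show "f \<in> I" by (simp only: poly_mapping_sum_single[symmetric])
qed

lemma var_ideal_psubset:
  assumes "T \<subset> T'"
  shows "(var_ideal T :: ('n::{finite,linorder}, 'k::field) mpoly set) \<subset> var_ideal T'"
proof -
  obtain i where "i \<in> T'" "i \<notin> T" using assms by auto
  then have "(var i :: ('n, 'k) mpoly) \<in> var_ideal T' - var_ideal T" by (simp add: var_in_var_ideal_iff)
  moreover have "(var_ideal T :: ('n, 'k) mpoly set) \<subseteq> var_ideal T'"
    using assms by (intro var_ideal_subset is_primeD(1)[OF is_prime_var_ideal]) (auto simp: var_in_var_ideal_iff)
  ultimately show ?thesis by blast
qed

lemma var_ideal_inter_polys_in: "var_ideal T \<inter> polys_in (- T) = {0}"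
proof
  show "var_ideal T \<inter> polys_in (- T) \<subseteq> {0}"
    by (auto simp: polys_in_def var_ideal_def hcomp_id[where j = 0])
qed (simp add: var_ideal_def)

lemma prime_chain_2:
  assumes "is_prime P" "is_prime Q" "is_prime R" "P \<subset> Q" "Q \<subset> R"
  shows "\<exists>C. prime_chain C 2 \<and> C 2 = R"
proof -
  define C where "C = (\<lambda>i::nat. if i = 0 then P else if i = 1 then Q else R)"
  have "prime_chain C 2" "C 2 = R"
    using assms by (auto simp: prime_chain_def less_2_cases_iff C_def)
  then show ?thesis by blast
qed

lemma chain_var_ideal_2:
  assumes "x \<noteq> y"
  shows "\<exists>C. prime_chain C 2 \<and> C 2 = (var_ideal {x, y} :: ('n::{finite,linorder}, 'k::field) mpoly set)"
proof (rule prime_chain_2[of "var_ideal {}" "var_ideal {x}"])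
  show "(var_ideal {} :: ('n, 'k) mpoly set) \<subset> var_ideal {x}" by (rule var_ideal_psubset) auto
  show "(var_ideal {x} :: ('n, 'k) mpoly set) \<subset> var_ideal {x, y}" by (rule var_ideal_psubset) (use assms in auto)
qed (rule is_prime_var_ideal)+

lemma height_le_no_larger_chain:
  assumes "height_le P 2" "prime_chain C 2" "C 2 \<subset> P" "is_prime P"
  shows False
proof -
  have "prime_chain (C(Suc 2 := P)) (Suc 2)" "(C(Suc 2 := P)) (Suc 2) = P"
    using prime_chain_extend[OF assms(2,4,3)] by auto
  then have "Suc 2 \<le> 2" using assms(1) unfolding height_le_def by blast
  then show False by simp
qed

text \<open>A prime containing all variables would properly contain (x, y), which tops a chain of
  length two, and so have height at least three.\<close>

lemma var_not_in_small_prime: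
  fixes P :: "('n::{finite,linorder}, 'k::field) mpoly set"
  assumes n: "CARD('n) \<ge> 3" and P: "is_prime P" "height_le P 2"
  shows "\<exists>x. var x \<notin> P"
proof (rule ccontr)
  assume "\<not> ?thesis"
  then have v: "\<And>x. var x \<in> P" by blast
  obtain T :: "'n set" where "card T = 3" using subset_of_card[of "UNIV :: 'n set" 3] n by auto
  then obtain x y z :: 'n where xyz: "x \<noteq> y" "y \<noteq> z" "x \<noteq> z" by (auto simp: card_3_iff)
  obtain C where C: "prime_chain C 2" "C 2 = (var_ideal {x, y} :: ('n, 'k) mpoly set)"
    using chain_var_ideal_2[OF xyz(1)] by blast
  have "var_ideal {x, y} \<subseteq> P" by (intro var_ideal_subset is_primeD(1)[OF P(1)] v)
  moreover have "var z \<notin> (var_ideal {x, y} :: ('n, 'k) mpoly set)" using xyz by (simp add: var_in_var_ideal_iff)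
  ultimately have "C 2 \<subset> P" using v[of z] C(2) by blast
  then show False by (rule height_le_no_larger_chain[OF P(2) C(1) _ P(1)])
qed

section \<open>Ideals with coprime generators\<close>

definition coprime3 :: "'a::comm_ring_1 \<Rightarrow> 'a \<Rightarrow> 'a \<Rightarrow> bool" where
  "coprime3 a b c \<longleftrightarrow> (\<forall>g. g dvd a \<and> g dvd b \<and> g dvd c \<longrightarrow> g dvd 1)"

lemma irreducible_factor_in_prime:
  fixes f :: "('n::{finite,linorder}, 'k::field) mpoly"
  assumes P: "is_prime P" and f: "f \<in> P" "f \<noteq> 0"
  shows "\<exists>p\<in>P. irreducible p \<and> p dvd f"
  using f
proof (induction "wdeg UNIV f" arbitrary: f rule: less_induct)
  case less
  have "\<not> f dvd 1" using is_prime_unit[OF P] less.prems(1) by blast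
  then obtain p where p: "irreducible p" "p dvd f" using irreducible_factor_exists less.prems(2) by blast
  then obtain r where r: "f = p * r" by (auto simp: dvd_def)
  have nz: "p \<noteq> 0" "r \<noteq> 0" using r less.prems(2) by auto
  show ?case
  proof (cases "p \<in> P")
    case True
    then show ?thesis using p by blast
  next
    case False
    then have "r \<in> P" using is_primeD(3)[OF P] r less.prems(1) by blast
    moreover have "wdeg UNIV r < wdeg UNIV f"
      using r nz p(1) by (simp add: wdeg_mult) (simp add: irreducible_def is_unit_iff)
    ultimately obtain q where "q \<in> P" "irreducible q" "q dvd r" using less.hyps nz by blast
    then show ?thesis using r by auto
  qed
qed

text \<open>The middle member is generated by an irreducible factor p of \<open>f1\<close> in
  \<open>P\<close>; it differs from \<open>P\<close> because p does not divide all three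
  generators.\<close>

lemma prime_over_coprime3_chain:
  fixes f1 f2 f3 :: "('n::{finite,linorder}, 'k::field) mpoly"
  assumes f: "f1 \<noteq> 0" "coprime3 f1 f2 f3" and P: "is_prime P" "gen3 f1 f2 f3 \<subseteq> P"
  shows "\<exists>C. prime_chain C 2 \<and> C 2 = P"
proof -
  note iP = is_primeD(1)[OF P(1)]
  have fP: "f1 \<in> P" "f2 \<in> P" "f3 \<in> P" using P(2) gen3_subset_iff[OF iP] by auto
  obtain p where p: "p \<in> P" "irreducible p" "p dvd f1"
    using irreducible_factor_in_prime[OF P(1) fP(1) f(1)] by blast
  have p0: "p \<noteq> 0" using p(2) by auto
  show ?thesis
  proof (rule prime_chain_2[OF is_prime_zero _ P(1)])
    show "is_prime {r. p dvd r}" using p(2) by (intro is_prime_multiples irreducible_imp_prime_mpoly)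
    have "p \<in> {r. p dvd r}" "p \<notin> {0}" using p0 by simp_all
    moreover have "{0} \<subseteq> {r. p dvd r}" by simp
    ultimately show "{0} \<subset> {r. p dvd r}" by blast
    have "{r. p dvd r} \<subseteq> P"
    proof
      fix r assume "r \<in> {r. p dvd r}"
      then obtain k where "r = p * k" by (auto simp: dvd_def)
      then show "r \<in> P" using is_idealD(4)[OF iP p(1)] by simp
    qed
    moreover have "{r. p dvd r} \<noteq> P"
    proof
      assume "{r. p dvd r} = P"
      then have "p dvd f1" "p dvd f2" "p dvd f3" using fP by auto
      then have "p dvd 1" using f(2) by (simp add: coprime3_def)
      then show False using p(2) irreducible_not_unit by blast
    qed
    ultimately show "{r. p dvd r} \<subset> P" by blast
  qed
qed

lemma coprime_dvd_cancel:
  fixes f :: "('n::{finite,linorder}, 'k::field) mpoly"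
  assumes "f \<noteq> 0" "\<And>p. p dvd f \<Longrightarrow> p dvd g \<Longrightarrow> p dvd 1" "f dvd a * g"
  shows "f dvd a"
  using assms
proof (induction "wdeg UNIV f" arbitrary: f a rule: less_induct)
  case less
  show ?case
  proof (cases "f dvd 1")
    case False
    then obtain p where p: "irreducible p" "p dvd f" using irreducible_factor_exists less.prems(1) by blast
    then obtain r where r: "f = p * r" by (auto simp: dvd_def)
    have nz: "p \<noteq> 0" "r \<noteq> 0" using r less.prems(1) by auto
    have "p dvd a * g" using p(2) less.prems(3) by (rule dvd_trans)
    moreover have "\<not> p dvd g" using less.prems(2)[OF p(2)] p(1) irreducible_not_unit by blast
    ultimately have "p dvd a"
      using irreducible_imp_prime_mpoly[OF p(1)] by (simp add: prime_elem_dvd_mult_iff)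
    then obtain a' where a': "a = p * a'" by (auto simp: dvd_def)
    have "p * r dvd p * (a' * g)" using less.prems(3) r a' by (simp add: mult.assoc)
    then have "r dvd a' * g" using nz by simp
    moreover have "wdeg UNIV r < wdeg UNIV f"
      using r nz p(1) by (simp add: wdeg_mult) (simp add: irreducible_def is_unit_iff)
    moreover have "q dvd 1" if "q dvd r" "q dvd g" for q using less.prems(2)[of q] that r by simp
    ultimately have "r dvd a'" using less.hyps nz by blast
    then show ?thesis using r a' by (simp add: mult_dvd_mono)
  qed (rule dvd_trans[OF _ one_dvd])
qed

text \<open>An irreducible p dividing \<open>f1\<close> divides f2 + c f3 for at most one c: two
  values would make it divide \<open>f3\<close> and then \<open>f2\<close>. As \<open>f1\<close> has
  finitely many irreducible factors up to units, some c avoids all bad values.\<close>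

lemma coprime_linear_combination:
  fixes f1 f2 f3 :: "('n::{finite,linorder}, 'k::field_char_0) mpoly"
  assumes f1: "f1 \<noteq> 0" and cop: "coprime3 f1 f2 f3"
  shows "\<exists>c. \<forall>p. p dvd f1 \<longrightarrow> p dvd f2 + const c * f3 \<longrightarrow> p dvd 1"
proof -
  have one: "finite {c. p dvd f2 + const c * f3}" if p: "irreducible p" "\<not> (p dvd f2 \<and> p dvd f3)" for p
  proof (cases "\<exists>c. p dvd f2 + const c * f3")
    case True
    then obtain c where c: "p dvd f2 + const c * f3" by blast
    have "c' = c" if c': "p dvd f2 + const c' * f3" for c'
    proof (rule ccontr)
      assume ne: "c' \<noteq> c"
      have "p dvd (f2 + const c' * f3) - (f2 + const c * f3)" using c c' by (rule dvd_diff[rotated])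
      also have "(f2 + const c' * f3) - (f2 + const c * f3) = const (c' - c) * f3"
        by (simp add: single_diff algebra_simps)
      finally have "p dvd const (inverse (c' - c)) * (const (c' - c) * f3)" by (rule dvd_mult)
      also have "\<dots> = f3" using ne by (simp add: mult.assoc[symmetric] const_mult)
      finally have 3: "p dvd f3" .
      then have "p dvd (f2 + const c * f3) - const c * f3" using c by (intro dvd_diff) simp_all
      then show False using p(2) 3 by simp
    qed
    then have "{c. p dvd f2 + const c * f3} \<subseteq> {c}" by blast
    then show ?thesis using finite_subset by blast
  qed simp
  \<comment> \<open>Splitting off one irreducible factor at a time bounds the bad scalars without
    listing factors up to units.\<close>
  have "finite {c. \<exists>p. irreducible p \<and> p dvd f \<and> p dvd f2 + const c * f3}"
    if "f \<noteq> 0" "\<And>p. irreducible p \<Longrightarrow> p dvd f \<Longrightarrow> \<not> (p dvd f2 \<and> p dvd f3)" for f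
    using that
  proof (induction "wdeg UNIV f" arbitrary: f rule: less_induct)
    case less
    show ?case
    proof (cases "f dvd 1")
      case True
      then have "\<not> (irreducible p \<and> p dvd f)" for p :: "('n, 'k) mpoly"
        using dvd_trans irreducible_not_unit by blast
      then have "{c. \<exists>p. irreducible p \<and> p dvd f \<and> p dvd f2 + const c * f3} = {}" by blast
      then show ?thesis by (simp only: finite.emptyI)
    next
      case False
      then obtain p0 where p0: "irreducible p0" "p0 dvd f" using irreducible_factor_exists less.prems(1) by blast
      then obtain r where r: "f = p0 * r" by (auto simp: dvd_def)
      have nz: "p0 \<noteq> 0" "r \<noteq> 0" using r less.prems(1) by auto
      have "wdeg UNIV r < wdeg UNIV f"
        using r nz p0(1) by (simp add: wdeg_mult) (simp add: irreducible_def is_unit_iff)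
      then have fin: "finite {c. \<exists>p. irreducible p \<and> p dvd r \<and> p dvd f2 + const c * f3}"
        using less.hyps less.prems(2) nz(2) r by simp
      have "{c. \<exists>p. irreducible p \<and> p dvd f \<and> p dvd f2 + const c * f3}
          \<subseteq> {c. p0 dvd f2 + const c * f3} \<union> {c. \<exists>p. irreducible p \<and> p dvd r \<and> p dvd f2 + const c * f3}"
      proof
        fix c assume "c \<in> {c. \<exists>p. irreducible p \<and> p dvd f \<and> p dvd f2 + const c * f3}"
        then obtain p where p: "irreducible p" "p dvd f" "p dvd f2 + const c * f3" by blast
        have "p dvd p0 \<or> p dvd r"
          using irreducible_imp_prime_mpoly[OF p(1)] p(2) r by (simp add: prime_elem_dvd_mult_iff)
        then show "c \<in> {c. p0 dvd f2 + const c * f3} \<union> {c. \<exists>p. irreducible p \<and> p dvd r \<and> p dvd f2 + const c * f3}"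
        proof
          assume "p dvd p0"
          then obtain u where u: "p0 = p * u" by (auto simp: dvd_def)
          then have "u dvd 1" using p0(1) p(1) by (auto simp: irreducible_def)
          then obtain v where v: "u * v = 1" by (metis dvdE)
          have "p0 * v = p * (u * v)" by (simp add: u mult.assoc)
          then have "p0 dvd p" using v by (metis dvd_triv_left mult_1_right)
          then show ?thesis using p(3) dvd_trans by blast
        qed (use p in blast)
      qed
      moreover have "finite {c. p0 dvd f2 + const c * f3}" by (rule one[OF p0(1) less.prems(2)[OF p0]])
      ultimately show ?thesis using fin by (simp add: finite_subset)
    qed
  qed
  moreover have "\<not> (p dvd f2 \<and> p dvd f3)" if "irreducible p" "p dvd f1" for p
    using that cop irreducible_not_unit by (auto simp: coprime3_def)
  ultimately have "finite {c. \<exists>p. irreducible p \<and> p dvd f1 \<and> p dvd f2 + const c * f3}" using f1 by blast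
  then have "\<exists>c. c \<notin> {c. \<exists>p. irreducible p \<and> p dvd f1 \<and> p dvd f2 + const c * f3}"
    by (rule ex_new_if_finite[OF infinite_UNIV_char_0])
  then obtain c where c: "\<And>p. irreducible p \<Longrightarrow> p dvd f1 \<Longrightarrow> \<not> p dvd f2 + const c * f3" by blast
  have "p dvd 1" if p: "p dvd f1" "p dvd f2 + const c * f3" for p
  proof (rule ccontr)
    assume "\<not> p dvd 1"
    moreover have "p \<noteq> 0" using p(1) f1 by auto
    ultimately obtain q where q: "irreducible q" "q dvd p" using irreducible_factor_exists by blast
    then show False using c[OF q(1)] p dvd_trans by blast
  qed
  then show ?thesis by blast
qed

section \<open>Syzygies\<close>

text \<open>The Koszul syzygy (f2, -f1, 0) lives in degree d1 + d. In a smaller shifted degree q the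
  last two entries, where nonzero, have degree q - d < d1, the situation covered by
  \<open>zero\<close>.\<close>

lemma indeg_syz_eq:
  fixes f1 f2 f3 :: "('n::{finite,linorder}, 'k::field) mpoly"
  assumes f: "f1 \<in> forms d1" "f2 \<in> forms d" "f2 \<noteq> 0" and d: "1 \<le> d1" "d1 \<le> d"
    and zero: "\<And>a1 a2 a3. a1 * f1 + a2 * f2 + a3 * f3 = 0 \<Longrightarrow> wdeg UNIV a2 < d1 \<Longrightarrow> wdeg UNIV a3 < d1
      \<Longrightarrow> a1 = 0 \<and> a2 = 0 \<and> a3 = 0"
  shows "indeg_syz (d1, d, d) (f1, f2, f3) = d1 + d"
  unfolding indeg_syz_def
proof (rule Least_equality)
  have "(f2, - f1, 0) \<in> syz (f1, f2, f3) \<inter> shifted_piece (d1, d, d) (d1 + d)"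
    using f whom_uminus[of f1 UNIV d1] by (simp add: forms_eq_whom)
  then show "\<exists>a\<in>syz (f1, f2, f3) \<inter> shifted_piece (d1, d, d) (d1 + d). a \<noteq> (0, 0, 0)"
    using f(3) by (intro bexI[of _ "(f2, - f1, 0)"]) auto
next
  fix q assume "\<exists>a\<in>syz (f1, f2, f3) \<inter> shifted_piece (d1, d, d) q. a \<noteq> (0, 0, 0)"
  then obtain a1 a2 a3 where a: "a1 * f1 + a2 * f2 + a3 * f3 = 0" "(a1, a2, a3) \<noteq> (0, 0, 0)"
    "a2 \<noteq> 0 \<Longrightarrow> d \<le> q \<and> a2 \<in> forms (q - d)" "a3 \<noteq> 0 \<Longrightarrow> d \<le> q \<and> a3 \<in> forms (q - d)" by auto
  show "d1 + d \<le> q"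
  proof (rule ccontr)
    assume n: "\<not> d1 + d \<le> q"
    have "wdeg UNIV a < d1" if "a \<noteq> 0 \<Longrightarrow> d \<le> q \<and> a \<in> forms (q - d)" for a :: "('n, 'k) mpoly"
    proof (cases "a = 0")
      case False
      then have "d \<le> q" "wdeg UNIV a = q - d" using that wdeg_whom by (auto simp: forms_eq_whom)
      then show ?thesis using n by simp
    qed (use d in simp)
    then have "a1 = 0 \<and> a2 = 0 \<and> a3 = 0" using zero[OF a(1)] a(3,4) by blast
    then show False using a(2) by simp
  qed
qed

text \<open>With g = f2 + c f3 and b = a3 - c a2 the syzygy reads f3 b = -a1 f1 - a2 g. Since
  \<open>f3\<close> is regular modulo (f1, g), b lies in an ideal generated in degrees at least
  \<open>d1\<close>; having degree below \<open>d1\<close>, it is 0. Then \<open>f1\<close> divides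
  a2 g, hence \<open>a2\<close>, whose degree is again too small.\<close>

lemma no_small_syzygy:
  fixes f1 f2 f3 :: "('n::{finite,linorder}, 'k::field_char_0) mpoly"
  assumes f: "f1 \<in> forms d1" "f2 \<in> forms d" "f3 \<in> forms d" "f1 \<noteq> 0" and d: "1 \<le> d1" "d1 \<le> d"
    and cop: "coprime3 f1 f2 f3"
    and ht: "\<And>P. is_prime P \<Longrightarrow> gen3 f1 f2 f3 \<subseteq> P \<Longrightarrow> \<not> height_le P 2"
    and syz: "a1 * f1 + a2 * f2 + a3 * f3 = 0" "wdeg UNIV a2 < d1" "wdeg UNIV a3 < d1"
  shows "a1 = 0 \<and> a2 = 0 \<and> a3 = 0"
proof -
  obtain c where c: "\<And>p. p dvd f1 \<Longrightarrow> p dvd f2 + const c * f3 \<Longrightarrow> p dvd 1"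
    using coprime_linear_combination[OF f(4) cop] by blast
  define g where "g = f2 + const c * f3"
  define b where "b = a3 - const c * a2"
  have cop': "p dvd 1" if "p dvd f1" "p dvd g" for p using c that by (simp add: g_def)
  have "const c * f3 \<in> whom UNIV (0 + d)" using f(3) by (intro whom_mult) (auto simp: forms_eq_whom)
  then have g: "g \<in> whom UNIV d" using f(2) by (auto simp: g_def forms_eq_whom intro: whom_add)
  have rel: "f3 * b = (- a1) * f1 + (- a2) * g"
  proof -
    have "f3 * b - ((- a1) * f1 + (- a2) * g) = a1 * f1 + a2 * f2 + a3 * f3"
      by (simp add: b_def g_def algebra_simps)
    then show ?thesis using syz(1) by simp
  qed
  have "\<exists>\<alpha> \<beta>. b = \<alpha> * f1 + \<beta> * g"
  proof (rule ccontr)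
    assume "\<not> ?thesis"
    then obtain P where P: "is_prime P" "f1 \<in> P" "g \<in> P" "f3 \<in> P" "height_le P 2"
      using unmixed_codim2[OF f(1,4) _ cop' rel] d by auto
    note iP = is_primeD(1)[OF P(1)]
    have "g - const c * f3 \<in> P" using P(3,4) iP by (intro is_idealD(6)[OF iP] is_idealD(3)[OF iP])
    then have "f2 \<in> P" by (simp add: g_def)
    then show False using ht[OF P(1)] P gen3_least[OF iP] by blast
  qed
  then obtain \<alpha> \<beta> where ab: "b = \<alpha> * f1 + \<beta> * g" by blast
  have "wdeg UNIV (const c :: ('n, 'k) mpoly) = 0" by (simp add: wdeg_eq_0_iff)
  then have "wdeg UNIV b < d1"
    using wdeg_diff_le[of UNIV a3 "const c * a2"] wdeg_mult_le[of UNIV "const c" a2] syz(2,3)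
    unfolding b_def by linarith
  moreover have "hcomp UNIV j b = 0" if "j < d1" for j
    using that d f(1) g unfolding ab
    by (simp add: hcomp_add mult.commute[of _ f1] mult.commute[of _ g] hcomp_mult_whom forms_eq_whom)
  ultimately have b0: "b = 0" using hcomp_wdeg_nonzero[of b UNIV] by auto
  have "a1 * f1 + a2 * g = - (f3 * b)" by (simp add: rel)
  then have "a1 * f1 = - (a2 * g)" using b0 by (simp add: eq_neg_iff_add_eq_0)
  then have "f1 dvd a2 * g" by (metis dvd_minus_iff dvd_triv_right)
  then have "f1 dvd a2" using coprime_dvd_cancel[of f1 g a2] f(4) cop' by blast
  moreover have "wdeg UNIV f1 = d1" using f(1,4) by (simp add: forms_eq_whom wdeg_whom)
  ultimately have a2: "a2 = 0" using wdeg_dvd_le[of f1 a2 UNIV] syz(2) by auto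
  moreover have "a3 = 0" using a2 b0 by (simp add: b_def)
  ultimately show ?thesis using syz(1) f(4) by simp
qed

section \<open>The codimension-two degree\<close>

lemma prime_height_eq_2_iff:
  "prime_height (Rg :: 'a::comm_ring_1 ring) P = 2 \<longleftrightarrow> height_le P 2 \<and> (\<exists>C. prime_chain C 2 \<and> C 2 = P)"
proof
  assume h: "prime_height (Rg :: 'a ring) P = 2"
  then have le: "height_le P 2" using prime_height_le_iff[of P 2] by (simp add: numeral_eq_enat)
  have "\<exists>m C. 2 \<le> m \<and> prime_chain C m \<and> C m = P"
  proof (rule ccontr)
    assume "\<not> ?thesis"
    then have "height_le P 1" unfolding height_le_def by (metis not_less_eq_eq numeral_2_eq_2 One_nat_def)
    then show False using h prime_height_le_iff[of P 1] by (simp add: numeral_eq_enat)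
  qed
  then obtain m C where m: "2 \<le> m" "prime_chain C m" "C m = P" by blast
  then have "m \<le> 2" using le by (auto simp: height_le_def)
  then have "m = 2" using m(1) by simp
  then show "height_le P 2 \<and> (\<exists>C. prime_chain C 2 \<and> C 2 = P)" using le m by auto
next
  assume "height_le P 2 \<and> (\<exists>C. prime_chain C 2 \<and> C 2 = P)"
  then show "prime_height (Rg :: 'a ring) P = 2"
    using prime_height_le_iff[of P 2] prime_height_ge[of _ 2 P]
    by (auto simp: numeral_eq_enat intro: antisym)
qed

lemma subset_assoc_prime: "is_ideal J \<Longrightarrow> P \<in> assoc_primes Rg J \<Longrightarrow> is_prime P \<and> J \<subseteq> P"
  using is_idealD(4)[of J] by (auto simp: assoc_primes_Rg)

lemma codim2_degree_pos:
  fixes f1 f2 f3 :: "('n::{finite,linorder}, 'k::field) mpoly"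
  assumes n: "CARD('n) \<ge> 3" and f: "f1 \<noteq> 0" "coprime3 f1 f2 f3"
    and P: "is_prime P" "gen3 f1 f2 f3 \<subseteq> P" "height_le P 2"
  shows "codim2_degree (gen3 f1 f2 f3) > 0"
proof -
  define J where "J = gen3 f1 f2 f3"
  have J: "is_ideal J" unfolding J_def by (rule is_ideal_gen3)
  have chain: "\<exists>C. prime_chain C 2 \<and> C 2 = Q" if "is_prime Q" "J \<subseteq> Q" for Q
    using prime_over_coprime3_chain[OF f] that unfolding J_def by blast
  \<comment> \<open>Even the smaller prime tops a chain of length two; if it were properly contained
    in \<open>Q\<close>, the height of \<open>Q\<close> would be at least three.\<close>
  have min: "Q' = Q" if Q: "is_prime Q" "J \<subseteq> Q" "height_le Q 2" and Q': "is_prime Q'" "J \<subseteq> Q'" "Q' \<subseteq> Q" for Q Q'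
  proof (rule ccontr)
    assume "Q' \<noteq> Q"
    obtain C where "prime_chain C 2" "C 2 = Q'" using chain[OF Q'(1,2)] by blast
    then show False using height_le_no_larger_chain[OF Q(3) _ _ Q(1), of C] Q'(3) \<open>Q' \<noteq> Q\<close> by blast
  qed
  define \<P> where "\<P> = {P \<in> assoc_primes (Rg :: ('n, 'k) mpoly ring) J. prime_height Rg P = 2}"
  have \<P>: "is_prime Q \<and> J \<subseteq> Q \<and> height_le Q 2" if "Q \<in> \<P>" for Q
    using that subset_assoc_prime[OF J] by (auto simp: \<P>_def prime_height_eq_2_iff)
  \<comment> \<open>Finiteness is essential, because a sum over an infinite index set is 0 by
    convention.\<close>
  have fin: "finite \<P>"
  proof -
    obtain \<F> where \<F>: "finite \<F>" "\<forall>Q\<in>\<F>. is_prime Q \<and> J \<subseteq> Q" "\<forall>P. is_prime P \<and> J \<subseteq> P \<longrightarrow> (\<exists>Q\<in>\<F>. Q \<subseteq> P)"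
      using finitely_many_minimal_primes[OF J] by (elim exE conjE)
    have "\<P> \<subseteq> \<F>"
    proof
      fix Q assume "Q \<in> \<P>"
      then have Q: "is_prime Q" "J \<subseteq> Q" "height_le Q 2" using \<P> by auto
      then obtain Q' where Q': "Q' \<in> \<F>" "Q' \<subseteq> Q" using \<F>(3) by auto
      then have "Q' = Q" using min[OF Q] \<F>(2) by auto
      then show "Q \<in> \<F>" using Q'(1) by simp
    qed
    then show ?thesis using \<F>(1) finite_subset by auto
  qed
  have "\<exists>x. P = {r. r * x \<in> J}"
  proof (rule minimal_prime_associated[OF J P(1)])
    show "J \<subseteq> P" using P(2) by (simp add: J_def)
    show "Q = P" if "is_prime Q" "J \<subseteq> Q" "Q \<subseteq> P" for Q
      using min[OF P(1) _ P(3) that] P(2) by (simp add: J_def)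
  qed
  then have "P \<in> assoc_primes Rg J" unfolding assoc_primes_Rg[OF J] using P(1) by blast
  moreover have "prime_height Rg P = 2"
    unfolding prime_height_eq_2_iff using P(3) chain[OF P(1)] P(2) by (simp add: J_def)
  ultimately have PP: "P \<in> \<P>" by (simp add: \<P>_def)
  define tm where "tm = (\<lambda>Q. ereal_of_enat (ring_length (quot_local Rg J Q)) * ereal (quot_degree Q))"
  have nonneg: "tm Q \<ge> 0" if "Q \<in> \<P>" for Q
  proof -
    have "quot_degree Q \<ge> 0" using \<P>[OF that] by (intro quot_degree_nonneg) (simp add: is_prime_def)
    then show ?thesis by (simp add: tm_def)
  qed
  have "tm P > 0"
  proof -
    obtain x where "var x \<notin> P" using var_not_in_small_prime[OF n P(1,3)] by blast
    then have "quot_degree P > 0" using quot_degree_pos[OF P(1)] by simp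
    moreover have "1 \<le> ring_length (quot_local Rg J P)"
      using P(1,2) by (intro ring_length_quot_local_ge_1[OF J]) (simp_all add: J_def)
    then have "0 < ring_length (quot_local Rg J P)" using less_le_trans[OF zero_less_one] by blast
    then have "0 < ereal_of_enat (ring_length (quot_local Rg J P))" by simp
    ultimately show ?thesis unfolding tm_def by (simp add: ereal_zero_less_0_iff)
  qed
  also have "tm P \<le> (\<Sum>Q\<in>\<P>. tm Q)"
  proof -
    have "(\<Sum>Q\<in>\<P>. tm Q) = tm P + (\<Sum>Q\<in>\<P> - {P}. tm Q)" by (rule sum.remove[OF fin PP])
    moreover have "0 \<le> (\<Sum>Q\<in>\<P> - {P}. tm Q)" using nonneg by (intro sum_nonneg) auto
    ultimately show ?thesis using add_left_mono[of 0 "\<Sum>Q\<in>\<P> - {P}. tm Q" "tm P"] by simp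
  qed
  also have "\<dots> = codim2_degree J" by (simp add: codim2_degree_def \<P>_def tm_def)
  finally show ?thesis by (simp add: J_def)
qed

lemma ideal_height_Rg: "ideal_height (Rg :: 'a::comm_ring_1 ring) J
    = (INF P\<in>{P. is_prime P \<and> J \<subseteq> P}. prime_height Rg P)"
  by (simp add: ideal_height_def primeideal_Rg_iff)

lemma ideal_height_ge_3_iff: "ideal_height (Rg :: 'a::comm_ring_1 ring) J \<ge> 3
    \<longleftrightarrow> (\<forall>P. is_prime P \<longrightarrow> J \<subseteq> P \<longrightarrow> \<not> height_le P 2)"
proof -
  have "3 \<le> prime_height (Rg :: 'a ring) P \<longleftrightarrow> \<not> height_le P 2" for P
    unfolding prime_height_le_iff[symmetric]
    by (cases "prime_height (Rg :: 'a ring) P") (auto simp: numeral_eq_enat)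
  then show ?thesis unfolding ideal_height_Rg le_INF_iff by auto
qed

text \<open>Some prime over the ideal has height at most three, so the height equals three as soon
  as no prime of height at most two lies over it.\<close>

lemma complete_intersection_iff:
  fixes f1 f2 f3 :: "('n::{finite,linorder}, 'k::field) mpoly"
  assumes f: "f1 \<in> forms d1" "f2 \<in> forms d2" "f3 \<in> forms d3" and d: "d1 > 0" "d2 > 0" "d3 > 0"
    and n: "CARD('n) \<ge> 3"
  shows "complete_intersection (gen3 f1 f2 f3)
    \<longleftrightarrow> (\<forall>P. is_prime P \<longrightarrow> gen3 f1 f2 f3 \<subseteq> P \<longrightarrow> \<not> height_le P 2)"
proof -
  obtain P where P: "is_prime P" "gen3 f1 f2 f3 \<subseteq> P" "height_le P 3"
    using prime_height_le_3_exists[OF f d n] by blast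
  have "ideal_height Rg (gen3 f1 f2 f3) \<le> prime_height Rg P"
    unfolding ideal_height_Rg using P(1,2) by (intro INF_lower) simp
  also have "\<dots> \<le> 3" using P(3) prime_height_le_iff[of P 3] by (simp add: numeral_eq_enat)
  finally show ?thesis
    unfolding complete_intersection_def ideal_height_ge_3_iff[symmetric] by (auto intro: antisym)
qed

lemma codim2_degree_eq_0:
  assumes "\<And>P. is_prime P \<Longrightarrow> gen3 f1 f2 f3 \<subseteq> P \<Longrightarrow> \<not> height_le P 2"
  shows "codim2_degree (gen3 f1 f2 f3) = 0"
proof -
  have "{P \<in> assoc_primes Rg (gen3 f1 f2 f3). prime_height Rg P = 2} = {}"
  proof (rule equals0I)
    fix P assume "P \<in> {P \<in> assoc_primes Rg (gen3 f1 f2 f3). prime_height Rg P = 2}"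
    then have P: "P \<in> assoc_primes Rg (gen3 f1 f2 f3)" "height_le P 2"
      by (simp_all add: prime_height_eq_2_iff)
    show False using subset_assoc_prime[OF is_ideal_gen3 P(1)] P(2) assms by simp
  qed
  then show ?thesis unfolding codim2_degree_def by (simp only: sum.empty)
qed

section \<open>An ideal of codimension-two degree one\<close>

text \<open>As \<open>w\<close> is free of \<open>y\<close>, the power y^m would have to divide
  \<open>r\<close>, whose degree is below \<open>m\<close>.\<close>

lemma var_power_cancel:
  fixes r s w :: "('n::{finite,linorder}, 'k::field) mpoly"
  assumes eq: "var y ^ m * s = r * w" and w: "w \<in> whom {y} 0" "w \<noteq> 0" and r: "wdeg UNIV r < m"
  shows "r = 0"
proof (rule ccontr)
  assume r0: "r \<noteq> 0"
  define j where "j = wdeg {y} r"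
  have "j < m" using wdeg_mono[of "{y}" UNIV r] r by (simp add: j_def)
  have "(var y ^ m :: ('n, 'k) mpoly) \<in> whom {y} m" by (simp add: var_power)
  from hcomp_mult_whom[OF this, of j s] have "hcomp {y} j (var y ^ m * s) = 0" using \<open>j < m\<close> by simp
  moreover have "hcomp {y} j (r * w) = w * hcomp {y} j r"
    using hcomp_mult_whom[OF w(1), of j r] by (simp add: mult.commute)
  ultimately have "w * hcomp {y} j r = 0" unfolding eq by simp
  then show False using w(2) hcomp_wdeg_nonzero[OF r0, of "{y}"] by (simp add: j_def)
qed

lemma var_power_whom: "i \<notin> T \<Longrightarrow> var i ^ k \<in> whom T 0"
  by (simp add: var_power wt_def lookup_single when_def sum.delta)

lemma var_dvd_if_hcomp_0:
  assumes "hcomp {x} 0 f = 0"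
  shows "var x dvd f"
proof -
  have "var x dvd hcomp {x} j f" for j
  proof (cases j)
    case (Suc k)
    obtain c where "hcomp {x} j f = var x ^ j * c" using whom_var_factor[OF hcomp_whom] by blast
    then show ?thesis using Suc by simp
  qed (simp add: assms)
  then have "var x dvd (\<Sum>j\<le>wdeg {x} f. hcomp {x} j f)" by (intro dvd_sum) auto
  then show ?thesis by (simp add: sum_hcomp_atMost)
qed

text \<open>The argument \<open>kk\<close> names the coefficient field, which the other parameters
  do not mention.\<close>

locale degree_one_example =
  fixes x y z :: "'n::{finite,linorder}" and d1 d :: nat and kk :: "'k::field_char_0 itself"
  assumes xyz: "x \<noteq> y" "y \<noteq> z" "x \<noteq> z" and d: "1 \<le> d1" "d1 < d"
begin

definition f1 :: "('n, 'k) mpoly" where "f1 = var x * var z ^ (d1 - 1)"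
definition f2 :: "('n, 'k) mpoly" where "f2 = var y ^ d"
definition f3 :: "('n, 'k) mpoly" where "f3 = var y * var z ^ (d - 1) + var x ^ d"

lemma f_forms: "f1 \<in> forms d1" "f2 \<in> forms d" "f3 \<in> forms d"
proof -
  have v: "(var i ^ k :: ('n, 'k) mpoly) \<in> whom UNIV k" for i k
    by (simp add: var_power wt_UNIV)
  have 1: "(var i * var j ^ (k - 1) :: ('n, 'k) mpoly) \<in> whom UNIV k" if "1 \<le> k" for i j k
    using whom_mult[OF v[of i 1] v[of j "k - 1"]] that by simp
  show "f1 \<in> forms d1" using 1[OF d(1)] by (simp add: f1_def forms_eq_whom)
  show "f2 \<in> forms d" using v by (simp add: f2_def forms_eq_whom)
  have "1 \<le> d" using d by simp
  then show "f3 \<in> forms d" unfolding f3_def forms_eq_whom by (intro whom_add 1 v)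
qed

lemma f_nonzero: "f1 \<noteq> 0" "f2 \<noteq> 0" "f3 \<noteq> 0"
proof -
  show "f1 \<noteq> 0" "f2 \<noteq> 0" by (simp_all add: f1_def f2_def)
  have "(var x :: ('n, 'k) mpoly) \<in> whom {x} 1" using var_whom[of x "{x}"] by simp
  from hcomp_mult_whom[OF this, of 0 "var x ^ (d - 1)"]
  have "hcomp {x} 0 (var x * var x ^ (d - 1)) = (0 :: ('n, 'k) mpoly)" by simp
  moreover have "var x * var x ^ (d - 1) = (var x ^ d :: ('n, 'k) mpoly)"
    using d by (simp flip: power_Suc)
  moreover have "(var y ^ 1 * var z ^ (d - 1) :: ('n, 'k) mpoly) \<in> whom {x} (0 + 0)"
    using xyz by (intro whom_mult var_power_whom) auto
  then have "hcomp {x} 0 (var y * var z ^ (d - 1)) = (var y * var z ^ (d - 1) :: ('n, 'k) mpoly)"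
    using hcomp_id[of "var y * var z ^ (d - 1)" "{x}" 0 0] by simp
  ultimately have "hcomp {x} 0 f3 = var y * var z ^ (d - 1)" by (simp add: f3_def hcomp_add)
  then show "f3 \<noteq> 0" by auto
qed

text \<open>Modulo \<open>x\<close> the relation involves only the coprime monomials \<open>y\<^sup>d\<^sup>-\<^sup>1\<close> and \<open>z\<^sup>d\<^sup>-\<^sup>1\<close>; after dividing by \<open>x\<close>,
  the components of low degree in \<open>z\<close> involve only \<open>x\<^sup>d\<close> and \<open>y\<^sup>d\<close>.\<close>

lemma no_syzygy:
  assumes syz: "a1 * f1 + a2 * f2 + a3 * f3 = 0" and deg: "wdeg UNIV a2 < d1" "wdeg UNIV a3 < d1"
  shows "a1 = 0 \<and> a2 = 0 \<and> a3 = 0"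
proof -
  let ?h = "hcomp {x} 0"
  have hx: "?h (var x :: ('n, 'k) mpoly) = 0" using hcomp_id[OF var_whom[of x "{x}"], of 0] by simp
  have hk: "?h (var x ^ Suc k :: ('n, 'k) mpoly) = 0" for k by (simp add: hcomp_mult_0 hx)
  have xd: "var x ^ d = (var x ^ Suc (d - 1) :: ('n, 'k) mpoly)" using d by simp
  have hv: "?h (var i ^ k) = (var i ^ k :: ('n, 'k) mpoly)" if "i \<noteq> x" for i k
    using hcomp_id[OF var_power_whom[of i "{x}" k], of 0] that by simp
  have hy: "?h (var y) = (var y :: ('n, 'k) mpoly)" using hv[of y 1] xyz by simp
  have "?h (a1 * f1 + a2 * f2 + a3 * f3) = ?h a2 * var y ^ d + ?h a3 * (var y * var z ^ (d - 1))"
    using xyz by (simp add: hcomp_add hcomp_mult_0 f1_def f2_def f3_def hx xd hk hv hy del: power_Suc)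
  then have "?h a2 * var y ^ d + ?h a3 * (var y * var z ^ (d - 1)) = 0" by (simp add: syz)
  moreover have "var y ^ d = (var y * var y ^ (d - 1) :: ('n, 'k) mpoly)" using d by (simp flip: power_Suc)
  ultimately have "var y * (?h a2 * var y ^ (d - 1) + ?h a3 * var z ^ (d - 1)) = 0"
    by (simp add: algebra_simps)
  then have e: "?h a2 * var y ^ (d - 1) + ?h a3 * var z ^ (d - 1) = 0" by simp
  have hdeg: "wdeg UNIV (?h a) \<le> wdeg UNIV a" for a :: "('n, 'k) mpoly"
    unfolding wdeg_le_iff by (auto simp: keys_hcomp wt_le_wdeg)
  \<comment> \<open>The relation forces y^(d - 1) to divide the part of \<open>a3\<close> free of x,
    whose degree is below d1 \<le> d - 1; this uses \<open>d1 < d\<close>.\<close>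
  have "- ?h a3 = 0"
  proof (rule var_power_cancel[where y = y and m = "d - 1" and s = "?h a2" and w = "var z ^ (d - 1)"])
    show "var y ^ (d - 1) * ?h a2 = - ?h a3 * var z ^ (d - 1)"
      using e by (simp add: eq_neg_iff_add_eq_0 mult.commute)
    show "var z ^ (d - 1) \<in> whom {y} 0" using xyz by (intro var_power_whom) auto
    show "wdeg UNIV (- ?h a3) < d - 1" using hdeg[of a3] deg(2) d by simp
  qed simp
  then have h3: "?h a3 = 0" by simp
  then have h2: "?h a2 = 0" using e by simp
  obtain b2 b3 where b: "a2 = var x * b2" "a3 = var x * b3"
    using var_dvd_if_hcomp_0[OF h2] var_dvd_if_hcomp_0[OF h3] by (auto simp: dvd_def)
  have "var x * (a1 * var z ^ (d1 - 1) + b2 * f2 + b3 * f3) = 0"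
    using syz by (simp add: b f1_def algebra_simps)
  then have s: "a1 * var z ^ (d1 - 1) + b2 * f2 + b3 * f3 = 0" by simp
  have bdeg: "b = 0 \<or> wdeg UNIV b < d1 - 1" if "wdeg UNIV (var x * b) < d1" for b :: "('n, 'k) mpoly"
  proof (cases "b = 0")
    case False
    have "wdeg UNIV (var x :: ('n, 'k) mpoly) = 1" using wdeg_whom[OF var_whom[of x UNIV]] by simp
    then show ?thesis using that False by (simp add: wdeg_mult)
  qed simp
  have comp: "hcomp {z} j b3 = 0 \<and> hcomp {z} j b2 = 0" if j: "j < d1 - 1" for j
  proof -
    have 1: "hcomp {z} j (a1 * var z ^ (d1 - 1)) = 0"
      using hcomp_mult_whom[of "var z ^ (d1 - 1)" "{z}" "d1 - 1" j a1] j
      by (simp add: mult.commute var_power)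
    have y0: "var y ^ d \<in> whom {z} 0" and x0: "var x ^ d \<in> whom {z} 0"
      using xyz by (auto intro: var_power_whom)
    have 2: "hcomp {z} j (b2 * f2) = var y ^ d * hcomp {z} j b2"
      using hcomp_mult_whom[OF y0, of j b2] by (simp add: f2_def mult.commute)
    have zz: "var z ^ (d - 1) \<in> whom {z} (d - 1)" by (simp add: var_power)
    have "hcomp {z} j (var z ^ (d - 1) * (b3 * var y)) = 0"
      using hcomp_mult_whom[OF zz, of j "b3 * var y"] j d by simp
    moreover have "hcomp {z} j (var x ^ d * b3) = var x ^ d * hcomp {z} j b3"
      using hcomp_mult_whom[OF x0, of j b3] by simp
    moreover have "b3 * f3 = var z ^ (d - 1) * (b3 * var y) + var x ^ d * b3"
      by (simp add: f3_def algebra_simps)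
    ultimately have 3: "hcomp {z} j (b3 * f3) = var x ^ d * hcomp {z} j b3" by (simp add: hcomp_add)
    have "hcomp {z} j (a1 * var z ^ (d1 - 1) + b2 * f2 + b3 * f3) = 0" by (simp only: s hcomp_zero)
    then have e: "var y ^ d * hcomp {z} j b2 + var x ^ d * hcomp {z} j b3 = 0"
      by (simp only: hcomp_add 1 2 3 add_0)
    have "- hcomp {z} j b3 = 0"
    proof (rule var_power_cancel[where y = y and m = d and s = "hcomp {z} j b2" and w = "var x ^ d"])
      show "var y ^ d * hcomp {z} j b2 = - hcomp {z} j b3 * var x ^ d"
        using e by (simp add: eq_neg_iff_add_eq_0 mult.commute)
      show "var x ^ d \<in> whom {y} 0" using xyz by (intro var_power_whom) auto
      have "wdeg UNIV (hcomp {z} j b3) \<le> wdeg UNIV b3"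
        unfolding wdeg_le_iff by (auto simp: keys_hcomp wt_le_wdeg)
      also have "\<dots> < d" using bdeg[of b3] deg(2) d by (auto simp: b)
      finally show "wdeg UNIV (- hcomp {z} j b3) < d" by simp
    qed simp
    then show ?thesis using e by simp
  qed
  \<comment> \<open>The degree of b in z is below d1 - 1, so the components known to vanish are all
    of them.\<close>
  have "b = 0" if "\<And>j. j < d1 - 1 \<Longrightarrow> hcomp {z} j b = 0" "wdeg UNIV (var x * b) < d1" for b :: "('n, 'k) mpoly"
  proof (rule ccontr)
    assume "b \<noteq> 0"
    then have "wdeg {z} b < d1 - 1" using bdeg[OF that(2)] wdeg_mono[of "{z}" UNIV b] by simp
    then have "hcomp {z} (wdeg {z} b) b = 0" by (rule that(1))
    then show False using hcomp_wdeg_nonzero[OF \<open>b \<noteq> 0\<close>] by simp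
  qed
  then have "b2 = 0" "b3 = 0" using comp deg unfolding b by blast+
  then show ?thesis using syz f_nonzero(1) by (simp add: b)
qed

lemma coprime3_f: "coprime3 f1 f2 f3"
  unfolding coprime3_def
proof (intro allI impI)
  fix g assume g: "g dvd f1 \<and> g dvd f2 \<and> g dvd f3"
  show "g dvd 1"
  proof (rule ccontr)
    assume "\<not> g dvd 1"
    moreover have "g \<noteq> 0" using g f_nonzero by auto
    ultimately obtain p where p: "irreducible p" "p dvd g" using irreducible_factor_exists by blast
    have pr: "prime_elem p" using irreducible_imp_prime_mpoly[OF p(1)] .
    have f: "p dvd f1" "p dvd f2" "p dvd f3" using g p(2) dvd_trans by blast+
    have y: "p dvd var y" using f(2) pr by (simp add: f2_def prime_elem_dvd_power)
    have "p dvd var x"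
    proof (rule ccontr)
      assume nx: "\<not> p dvd var x"
      have "p dvd f3 - var y * var z ^ (d - 1)" using f(3) y by (intro dvd_diff) auto
      then have "p dvd var x ^ d" by (simp add: f3_def)
      then show False using pr nx prime_elem_dvd_power by blast
    qed
    have "wdeg {i} p = 0" for i
    proof (cases "i = y")
      case True
      have "wdeg {y} (var x :: ('n, 'k) mpoly) = 0"
        using wdeg_whom[OF var_whom[of x "{y}"]] xyz by simp
      then show ?thesis using wdeg_dvd_le[OF \<open>p dvd var x\<close>, of "{y}"] True by simp
    next
      case False
      then have "wdeg {i} (var y :: ('n, 'k) mpoly) = 0"
        using wdeg_whom[OF var_whom[of y "{i}"]] by simp
      then show ?thesis using wdeg_dvd_le[OF y, of "{i}"] by simp
    qed
    then have "wdeg UNIV p = 0" using wdeg_pos_var[of p] by (metis less_irrefl)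
    then show False using p(1) by (auto simp: irreducible_def is_unit_iff)
  qed
qed

text \<open>A generator of degree \<open>d\<close> lying in the ideal of the other two would give,
  in degree \<open>d\<close>, a syzygy with entry -1 and a second constant entry; constants have
  degree below \<open>d1\<close>, so \<open>no_syzygy\<close> applies.\<close>

lemma degree_0_syzygy:
  assumes "g = u * f1 + v * f'" "{g, f'} = {f2, f3}"
  shows False
proof -
  have forms: "g \<in> forms d" "f' \<in> forms d" using assms(2) f_forms by (metis insertCI insertE singletonD)+
  have "hcomp UNIV d g = g" using forms(1) by (simp add: forms_eq_whom hcomp_id[where j = d])
  moreover have "hcomp UNIV d (f1 * u + f' * v) = f1 * hcomp UNIV (d - d1) u + f' * hcomp UNIV 0 v"
    using hcomp_mult_whom[of f1 UNIV d1 d u] hcomp_mult_whom[of f' UNIV d d v] f_forms(1) forms(2) d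
    by (simp add: hcomp_add forms_eq_whom)
  ultimately have g: "g = f1 * hcomp UNIV (d - d1) u + f' * hcomp UNIV 0 v"
    using assms(1) by (simp add: mult.commute)
  have "wdeg UNIV (hcomp UNIV 0 v) = 0" "wdeg UNIV (- 1 :: ('n, 'k) mpoly) = 0"
    by (simp_all add: wdeg_eq_0_iff)
  then have lt: "wdeg UNIV (hcomp UNIV 0 v) < d1" "wdeg UNIV (- 1 :: ('n, 'k) mpoly) < d1"
    using d by simp_all
  show False
  proof (cases "g = f2 \<and> f' = f3")
    case True
    then have "f2 = f1 * hcomp UNIV (d - d1) u + f3 * hcomp UNIV 0 v" using g by metis
    moreover have "hcomp UNIV (d - d1) u * f1 + (- 1) * f2 + hcomp UNIV 0 v * f3
        = f1 * hcomp UNIV (d - d1) u + f3 * hcomp UNIV 0 v - f2" by (simp add: mult.commute)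
    ultimately have "hcomp UNIV (d - d1) u * f1 + (- 1) * f2 + hcomp UNIV 0 v * f3 = 0" by simp
    from no_syzygy[OF this lt(2,1)] have "(- 1 :: ('n, 'k) mpoly) = 0" by simp
    then show False by simp
  next
    case False
    then have "g = f3" "f' = f2" using assms(2) by (auto simp: doubleton_eq_iff)
    then have "f3 = f1 * hcomp UNIV (d - d1) u + f2 * hcomp UNIV 0 v" using g by metis
    moreover have "hcomp UNIV (d - d1) u * f1 + hcomp UNIV 0 v * f2 + (- 1) * f3
        = f1 * hcomp UNIV (d - d1) u + f2 * hcomp UNIV 0 v - f3" by (simp add: mult.commute)
    ultimately have "hcomp UNIV (d - d1) u * f1 + hcomp UNIV 0 v * f2 + (- 1) * f3 = 0" by simp
    from no_syzygy[OF this lt(1,2)] have "(- 1 :: ('n, 'k) mpoly) = 0" by simp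
    then show False by simp
  qed
qed

lemma degree_vector: "has_degree_vector (d1, d, d) (f1, f2, f3)"
proof -
  have gen2: "Idl\<^bsub>Rg\<^esub> {a, b} = gen3 a b b" for a b :: "('n, 'k) mpoly"
    using genideal_Rg[of a b b] by simp
  have E: "\<exists>u v. r = u * a + v * b" if "r \<in> gen3 a b b" for r a b :: "('n, 'k) mpoly"
  proof -
    obtain u v w where "r = u * a + v * b + w * b" using \<open>r \<in> gen3 a b b\<close> by (rule gen3E)
    then have "r = u * a + (v + w) * b" by (simp add: algebra_simps)
    then show ?thesis by blast
  qed
  have "f1 \<notin> gen3 f2 f3 f3"
  proof
    assume "f1 \<in> gen3 f2 f3 f3"
    then obtain u v where "f1 = u * f2 + v * f3" using E by blast
    then have "hcomp UNIV d1 f1 = hcomp UNIV d1 (f2 * u + f3 * v)" by (simp add: mult.commute)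
    also have "\<dots> = 0" using f_forms d by (simp add: hcomp_add hcomp_mult_whom forms_eq_whom)
    finally show False using f_forms(1) f_nonzero(1) by (simp add: forms_eq_whom hcomp_id[where j = d1])
  qed
  moreover have "f2 \<notin> gen3 f1 f3 f3" using E[of f2 f1 f3] degree_0_syzygy[of f2 _ _ f3] by blast
  moreover have "f3 \<notin> gen3 f1 f2 f2" using E[of f3 f1 f2] degree_0_syzygy[of f3 _ _ f2] by (metis insert_commute)
  moreover have "f1 \<in> gen3 f1 f2 f3" "f2 \<in> gen3 f1 f2 f3" "f3 \<in> gen3 f1 f2 f3"
    by (rule gen3_mem)+
  ultimately have "gen3 f2 f3 f3 \<noteq> gen3 f1 f2 f3" "gen3 f1 f3 f3 \<noteq> gen3 f1 f2 f3" "gen3 f1 f2 f2 \<noteq> gen3 f1 f2 f3"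
    by metis+
  then show ?thesis
    using f_forms f_nonzero coprime3_f d
    by (simp add: gen2 genideal_Rg coprime3_def)
qed

definition J where "J = gen3 f1 f2 f3"
definition Pxy :: "('n, 'k) mpoly set" where "Pxy = var_ideal {x, y}"

lemma is_ideal_J: "is_ideal J"
  unfolding J_def by (rule is_ideal_gen3)

lemma is_prime_Pxy: "is_prime Pxy"
  unfolding Pxy_def by (rule is_prime_var_ideal)

lemma vars_Pxy: "var x \<in> Pxy" "var y \<in> Pxy" "var z \<notin> Pxy"
  using xyz by (auto simp: Pxy_def var_in_var_ideal_iff)

lemma J_subset_Pxy: "J \<subseteq> Pxy"
proof -
  note I = is_primeD(1)[OF is_prime_Pxy]
  have p: "var x ^ d = (var x * var x ^ (d - 1) :: ('n, 'k) mpoly)"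
    "var y ^ d = (var y * var y ^ (d - 1) :: ('n, 'k) mpoly)" using d by (simp_all flip: power_Suc)
  have "f1 \<in> Pxy" "f2 \<in> Pxy" "f3 \<in> Pxy"
    unfolding f1_def f2_def f3_def p
    by (rule is_idealD(4)[OF I vars_Pxy(1)] is_idealD(4)[OF I vars_Pxy(2)]
      is_idealD(2)[OF I is_idealD(4)[OF I vars_Pxy(2)] is_idealD(4)[OF I vars_Pxy(1)]])+
  then show ?thesis unfolding J_def by (rule gen3_least[OF I])
qed

text \<open>It is enough to treat x and y. The first form is x z^(d1 - 1); the third is y z^(d - 1)
  up to x^d, which z^(d1 - 1) carries into the ideal through the first. The exponent is the sum of
  the two, and \<open>J\<close> agrees with (x, y) once z is inverted.\<close>

lemma multiplier:
  assumes "a \<in> Pxy"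
  shows "a * var z ^ (d - 1 + (d1 - 1)) \<in> J"
proof -
  let ?I = "{r. r * var z ^ (d - 1 + (d1 - 1)) \<in> J}"
  have mem: "f1 \<in> J" "f2 \<in> J" "f3 \<in> J" unfolding J_def by (rule gen3_mem)+
  have "var x * var z ^ (d - 1 + (d1 - 1)) = var z ^ (d - 1) * f1"
    by (simp add: f1_def power_add ac_simps)
  then have "var x \<in> ?I" using is_idealD(3)[OF is_ideal_J mem(1)] by simp
  moreover have "var x ^ d = (var x * var x ^ (d - 1) :: ('n, 'k) mpoly)" using d by (simp flip: power_Suc)
  then have "var y * var z ^ (d - 1 + (d1 - 1)) = var z ^ (d1 - 1) * f3 - var x ^ (d - 1) * f1"
    by (simp add: f1_def f3_def power_add algebra_simps)
  then have "var y \<in> ?I"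
    using is_idealD(6)[OF is_ideal_J is_idealD(3)[OF is_ideal_J mem(3)] is_idealD(3)[OF is_ideal_J mem(1)]] by simp
  ultimately have "var_ideal {x, y} \<subseteq> ?I"
    by (intro var_ideal_subset is_ideal_colon is_ideal_J) auto
  then show ?thesis using assms by (auto simp: Pxy_def)
qed

lemma height_Pxy: "prime_height Rg Pxy = 2"
  unfolding prime_height_eq_2_iff
proof
  have "card {x, y} \<le> CARD('n)" by (rule card_mono) auto
  then have "CARD('n) - card (- {x, y}) = 2"
    using xyz by (simp add: Compl_eq_Diff_UNIV card_Diff_subset)
  then show "height_le Pxy 2"
    using height_le_of_trivial_intersection[of "var_ideal {x, y} :: ('n, 'k) mpoly set" "- {x, y}",
        OF var_ideal_inter_polys_in]
    unfolding Pxy_def by simp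
  show "\<exists>C. prime_chain C 2 \<and> C 2 = Pxy"
    unfolding Pxy_def by (rule chain_var_ideal_2[OF xyz(1)])
qed

text \<open>A prime over \<open>J\<close> contains y by the second form and then x by the third;
  with height two it must be (x, y). Conversely (x, y) is the annihilator of a power of z modulo
  \<open>J\<close>.\<close>

lemma assoc_height_2: "{P \<in> assoc_primes Rg J. prime_height Rg P = 2} = {Pxy}"
proof
  show "{P \<in> assoc_primes Rg J. prime_height Rg P = 2} \<subseteq> {Pxy}"
  proof
    fix P assume "P \<in> {P \<in> assoc_primes Rg J. prime_height Rg P = 2}"
    then have P: "is_prime P" "J \<subseteq> P" "height_le P 2"
      using subset_assoc_prime[OF is_ideal_J, of P] by (auto simp: prime_height_eq_2_iff)
    note I = is_primeD(1)[OF P(1)]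
    have f: "f1 \<in> P" "f2 \<in> P" "f3 \<in> P" using P(2) gen3_subset_iff[OF I] unfolding J_def by auto
    have y: "var y \<in> P" using is_prime_power[OF P(1)] f(2) unfolding f2_def by blast
    have "f3 - var y * var z ^ (d - 1) \<in> P" using f(3) y I by (intro is_idealD(6)) (auto intro: is_idealD(4))
    then have "var x ^ d \<in> P" by (simp add: f3_def)
    then have x: "var x \<in> P" using is_prime_power[OF P(1)] by blast
    have sub: "Pxy \<subseteq> P" unfolding Pxy_def using x y by (intro var_ideal_subset I) auto
    show "P \<in> {Pxy}"
    proof (rule ccontr)
      assume "P \<notin> {Pxy}"
      then have "Pxy \<subset> P" using sub by blast
      moreover obtain C where "prime_chain C 2" "C 2 = Pxy"
        using height_Pxy by (auto simp: prime_height_eq_2_iff)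
      ultimately show False using height_le_no_larger_chain[OF P(3) _ _ P(1), of C] by blast
    qed
  qed
  have "Pxy = {r. r * var z ^ (d - 1 + (d1 - 1)) \<in> J}"
  proof
    show "Pxy \<subseteq> {r. r * var z ^ (d - 1 + (d1 - 1)) \<in> J}" using multiplier by blast
    show "{r. r * var z ^ (d - 1 + (d1 - 1)) \<in> J} \<subseteq> Pxy"
    proof
      fix r assume "r \<in> {r. r * var z ^ (d - 1 + (d1 - 1)) \<in> J}"
      then have "r * var z ^ (d - 1 + (d1 - 1)) \<in> Pxy" using J_subset_Pxy by blast
      then show "r \<in> Pxy"
        using is_primeD(3)[OF is_prime_Pxy] is_prime_power[OF is_prime_Pxy] vars_Pxy(3) by blast
    qed
  qed
  then have "Pxy \<in> assoc_primes Rg J"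
    unfolding assoc_primes_Rg[OF is_ideal_J] using is_prime_Pxy by blast
  then show "{Pxy} \<subseteq> {P \<in> assoc_primes Rg J. prime_height Rg P = 2}" using height_Pxy by blast
qed

text \<open>The initial ideal of (x, y) consists of the monomials involving x or y, so the Hilbert
  polynomial is that of a polynomial ring in n - 2 variables: its degree is k = n - 3 and its
  leading coefficient 1 / k!.\<close>

lemma quot_degree_Pxy: "quot_degree Pxy = 1"
proof -
  define k where "k = card (- {x, y}) - 1"
  have init: "m \<in> init Pxy \<longleftrightarrow> wt {x, y} m \<noteq> 0" for m
  proof
    assume "m \<in> init Pxy"
    then obtain g where g: "g \<in> Pxy" "g \<noteq> 0" "lm g = m" by (auto simp: init_def)
    then show "wt {x, y} m \<noteq> 0" using lm_in_keys[OF g(2)] by (auto simp: Pxy_def var_ideal_iff)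
  next
    assume "wt {x, y} m \<noteq> 0"
    then have "(monom_of m :: ('n, 'k) mpoly) \<in> Pxy" by (simp add: Pxy_def var_ideal_iff)
    then show "m \<in> init Pxy"
      unfolding init_def by (intro CollectI bexI[of _ "monom_of m"]) (auto simp: single_eq_0_iff forms_def lm_def)
  qed
  have "{m. m \<notin> init Pxy \<and> mdeg m = t} = std (- {x, y}) {} t" for t
    by (auto simp: std_def init wt_eq_0_iff)
  moreover have "- {x, y} \<noteq> {}" using xyz by auto
  ultimately have h: "hilbert_fun Pxy t = real ((t + k) choose k)" for t
    by (simp add: hilbert_fun_eq[OF is_primeD(1)[OF is_prime_Pxy]] card_std_empty k_def)
  have "hilbert_poly Pxy = binomial_poly k"
    by (rule hilbert_poly_eqI) (simp add: h poly_binomial_poly)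
  then show ?thesis using lead_coeff_binomial_poly[of k] by (simp add: quot_degree_def degree_binomial_poly)
qed

lemma codim2_degree_J: "codim2_degree J = 1"
proof -
  have "ring_length (quot_local Rg J Pxy) = 1"
  proof (rule ring_length_quot_local_eq_1[OF is_ideal_J is_prime_Pxy J_subset_Pxy])
    show "var z ^ (d - 1 + (d1 - 1)) \<notin> Pxy" using is_prime_power[OF is_prime_Pxy] vars_Pxy(3) by blast
    show "var z ^ (d - 1 + (d1 - 1)) * a \<in> J" if "a \<in> Pxy" for a
      using multiplier[OF that] by (simp add: mult.commute)
  qed
  then show ?thesis
    unfolding codim2_degree_def assoc_height_2 by (simp add: quot_degree_Pxy one_ereal_def one_enat_def)
qed

lemma realizes_1: "realizes (d1, d, d) (f1, f2, f3) (int d1 + int d, 1)"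
proof -
  have "indeg_syz (d1, d, d) (f1, f2, f3) = d1 + d"
  proof (rule indeg_syz_eq[OF f_forms(1,2) f_nonzero(2) d(1)])
    show "d1 \<le> d" using d by simp
  qed (rule no_syzygy)
  moreover have "gen_ideal (f1, f2, f3) = J" by (simp add: genideal_Rg J_def)
  ultimately show ?thesis using degree_vector codim2_degree_J by (simp add: one_ereal_def)
qed

end

text \<open>Both conditions amount to the absence of primes of height at most two over the ideal.
  Degree 0 alone implies this absence, which in turn yields the initial degree d1 + d besides degree
  0.\<close>

lemma realizes_0_iff:
  fixes f1 f2 f3 :: "('n::{finite,linorder}, 'k::field_char_0) mpoly"
  assumes n: "CARD('n) \<ge> 3" and f: "has_degree_vector (d1, d, d) (f1, f2, f3)"
  shows "realizes (d1, d, d) (f1, f2, f3) (int d1 + int d, 0)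
    \<longleftrightarrow> complete_intersection (gen_ideal (f1, f2, f3))"
proof -
  have d: "1 \<le> d1" "d1 \<le> d" and nz: "f1 \<noteq> 0" "f2 \<noteq> 0"
    and fo: "f1 \<in> forms d1" "f2 \<in> forms d" "f3 \<in> forms d" and cop: "coprime3 f1 f2 f3"
    using f by (auto simp: coprime3_def)
  have gen: "gen_ideal (f1, f2, f3) = gen3 f1 f2 f3" by (simp add: genideal_Rg)
  define NP where "NP \<longleftrightarrow> (\<forall>P. is_prime P \<longrightarrow> gen3 f1 f2 f3 \<subseteq> P \<longrightarrow> \<not> height_le P 2)"
  have ci: "complete_intersection (gen3 f1 f2 f3) \<longleftrightarrow> NP"
    unfolding NP_def using d by (intro complete_intersection_iff[OF fo _ _ _ n]) auto
  have "NP" if "codim2_degree (gen3 f1 f2 f3) = 0"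
    unfolding NP_def using codim2_degree_pos[OF n nz(1) cop] that by (metis less_irrefl)
  moreover have "codim2_degree (gen3 f1 f2 f3) = 0" "indeg_syz (d1, d, d) (f1, f2, f3) = d1 + d" if NP
  proof -
    have ht: "\<And>P. is_prime P \<Longrightarrow> gen3 f1 f2 f3 \<subseteq> P \<Longrightarrow> \<not> height_le P 2"
      using that unfolding NP_def by blast
    show "codim2_degree (gen3 f1 f2 f3) = 0" using ht by (rule codim2_degree_eq_0)
    show "indeg_syz (d1, d, d) (f1, f2, f3) = d1 + d"
      by (rule indeg_syz_eq[OF fo(1,2) nz(2) d])
        (rule no_small_syzygy[OF fo nz(1) d cop ht])
  qed
  ultimately show ?thesis
    using f unfolding realizes.simps gen ci by (auto simp: zero_ereal_def)
qed

theorem proposition1p13: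
  fixes d1 d :: nat
  assumes "CARD('n::{finite,linorder}) \<ge> 3"
    and "1 \<le> d1" and "d1 \<le> d"
  shows "I_set (int d1 + int d) (d1, d, d) = {0 .. int d1 * int d}
    \<and> admissible (d1, d, d) (int d1 + int d, 0)
    \<and> (\<forall>f :: ('n, 'k::{alg_closed_field, field_char_0}) mpoly \<times> ('n, 'k) mpoly \<times> ('n, 'k) mpoly.
         has_degree_vector (d1, d, d) f \<longrightarrow>
         (realizes (d1, d, d) f (int d1 + int d, 0) \<longleftrightarrow> complete_intersection (gen_ideal f)))
    \<and> (d1 < d \<longrightarrow>
         admissible (d1, d, d) (int d1 + int d, 1)
         \<and> (\<exists>f :: ('n, 'k) mpoly \<times> ('n, 'k) mpoly \<times> ('n, 'k) mpoly.
              realizes (d1, d, d) f (int d1 + int d, 1)))"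
proof -
  \<comment> \<open>For e = d1 + d the lower bound of the interval is the maximum of -(d1^2 + d1 d +
    d^2) and 0.\<close>
  have "int d1 * int d + int d1 * int d + int d * int d - (int d1 + int d) * (int d1 + int d + int d)
      = - (int d1 * int d1 + int d1 * int d + int d * int d)"
    by (simp add: algebra_simps)
  moreover have "0 \<le> int d1 * int d1 + int d1 * int d + int d * int d" by simp
  ultimately have le: "int d1 * int d + int d1 * int d + int d * int d
      - (int d1 + int d) * (int d1 + int d + int d) \<le> 0" by linarith
  have eq: "(int d1 + int d)\<^sup>2 - (int d1 + int d) * (int d1 + int d + int d)
      + (int d1 * int d + int d1 * int d + int d * int d) = int d1 * int d"
    by (simp add: power2_eq_square algebra_simps)
  have I: "I_set (int d1 + int d) (d1, d, d) = {0 .. int d1 * int d}"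
    unfolding I_set.simps Let_def by (simp only: max_absorb2[OF le] eq)
  have pos: "1 \<le> int d1 * int d"
    using assms(2,3) by (metis One_nat_def int_one_le_iff_zero_less less_le_trans mult_pos_pos of_nat_0_less_iff zero_less_one)
  have adm: "admissible (d1, d, d) (int d1 + int d, j)" if "0 \<le> j" "j \<le> int d1 * int d" for j
    using assms(2) that I by simp
  have ci: "realizes (d1, d, d) f (int d1 + int d, 0) \<longleftrightarrow> complete_intersection (gen_ideal f)"
    if "has_degree_vector (d1, d, d) f" for f :: "('n, 'k) mpoly \<times> ('n, 'k) mpoly \<times> ('n, 'k) mpoly"
    using realizes_0_iff[OF assms(1)] that by (cases f) blast
  have ex: "\<exists>f :: ('n, 'k) mpoly \<times> ('n, 'k) mpoly \<times> ('n, 'k) mpoly.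
      realizes (d1, d, d) f (int d1 + int d, 1)" if "d1 < d"
  proof -
    obtain T :: "'n set" where "card T = 3" using subset_of_card[of "UNIV :: 'n set" 3] assms(1) by auto
    then obtain x y z :: 'n where xyz: "x \<noteq> y" "y \<noteq> z" "x \<noteq> z" by (auto simp: card_3_iff)
    interpret degree_one_example x y z d1 d "TYPE('k)"
      using xyz assms(2) that by unfold_locales
    show ?thesis using realizes_1 by blast
  qed
  show ?thesis
    by (intro conjI allI impI) (rule I | rule adm | rule ci | rule ex | use pos in linarith | assumption)+
qed

end
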